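(* Let $L>0$, let $P\in H^2(0,L)$ be real-valued with $P(x)\ge P^0>0$ on $[0,L]$, and let $\theta_1,\dots,\theta_4\in\mathbb R$. Suppose there are constants $a,b>0$ with $(a+b-1)^2<4ab$ such that $\theta_1=\theta_3/b-a$, $\theta_2=\theta_4/b$, and suppose $\theta_1,\theta_3<0$, $\theta_2,\theta_4>0$. Let $\mathcal H=\{(w,v,\xi,\psi): w\in H^2(0,L),\ v\in H^1(0,L),\ \xi=v(L),\ \psi=v(0)\}$ with the norm $\|\cdot\|$ of $H^2\times H^1\times\mathbb C\times\mathbb C$, $F[w,v]=\theta_1v(0)+\theta_2v'(0)+\theta_3w(0)+\theta_4w'(0)$, and $A(w,v,\xi,\psi)=(v,(Pw')',-w'(L),F[w,v])$ with domain $$D(A)=\{(w,v,\xi,\psi): w\in H^3(0,L),\ v\in H^2(0,L),\ \xi=v(L),\ \psi=v(0),\ (Pw')'(L)=-w'(L),\ (Pw')'(0)=F[w,v]\}.$$ Then the $C_0$-semigroup $\{T(t)\}_{t\ge0}$ generated by $A$ is asymptotically stable, i.e. $\|T(t)z_0\|\to0$ as $t\to\infty$ for every $z_0\in\mathcal H$.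
   Context: Prime denotes $d/dx$; functions are complex-valued. *)

theory Defs
  imports "HOL-Analysis.Analysis"
begin

definition L2fun :: "real \<Rightarrow> (real \<Rightarrow> complex) \<Rightarrow> bool" where
  "L2fun L g \<longleftrightarrow> g measurable_on {0..L} \<and> (\<lambda>x. (cmod (g x))\<^sup>2) integrable_on {0..L}"

text \<open>Sobolev spaces H^k(0,L): f in H^(k+1) iff f in L^2 and f is the indefinite integral
  of some function in H^k (i.e. f is absolutely continuous with weak derivative in H^k).\<close>
fun Sob :: "nat \<Rightarrow> real \<Rightarrow> (real \<Rightarrow> complex) set" where
  "Sob 0 L = {f. L2fun L f}"
| "Sob (Suc k) L = {f. L2fun L f \<and>
      (\<exists>g\<in>Sob k L. \<forall>x\<in>{0..L}. f x = f 0 + integral {0..x} g)}"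

definition wderiv :: "nat \<Rightarrow> real \<Rightarrow> (real \<Rightarrow> complex) \<Rightarrow> (real \<Rightarrow> complex)" where
  "wderiv k L f = (SOME g. g \<in> Sob k L \<and> (\<forall>x\<in>{0..L}. f x = f 0 + integral {0..x} g))"

fun sobnorm2 :: "nat \<Rightarrow> real \<Rightarrow> (real \<Rightarrow> complex) \<Rightarrow> real" where
  "sobnorm2 0 L f = integral {0..L} (\<lambda>x. (cmod (f x))\<^sup>2)"
| "sobnorm2 (Suc k) L f = integral {0..L} (\<lambda>x. (cmod (f x))\<^sup>2) + sobnorm2 k L (wderiv k L f)"

definition dv :: "real \<Rightarrow> (real \<Rightarrow> complex) \<Rightarrow> real \<Rightarrow> complex" where
  "dv L f x = vector_derivative f (at x within {0..L})"

definition restr :: "real \<Rightarrow> (real \<Rightarrow> complex) \<Rightarrow> (real \<Rightarrow> complex)" where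
  "restr L f = (\<lambda>x. if x \<in> {0..L} then f x else 0)"

text \<open>States (w, v, xi, psi). Functions are represented by their (continuous) representative
  on [0,L], extended by 0 outside [0,L], so that representatives are canonical.\<close>
type_synonym st = "(real \<Rightarrow> complex) \<times> (real \<Rightarrow> complex) \<times> complex \<times> complex"

definition sadd :: "st \<Rightarrow> st \<Rightarrow> st" where
  "sadd z1 z2 = (case z1 of (w1, v1, a1, b1) \<Rightarrow> case z2 of (w2, v2, a2, b2) \<Rightarrow>
     (\<lambda>x. w1 x + w2 x, \<lambda>x. v1 x + v2 x, a1 + a2, b1 + b2))"

definition sscale :: "complex \<Rightarrow> st \<Rightarrow> st" where
  "sscale c z = (case z of (w, v, a, b) \<Rightarrow> (\<lambda>x. c * w x, \<lambda>x. c * v x, c * a, c * b))"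

definition sdiff :: "st \<Rightarrow> st \<Rightarrow> st" where
  "sdiff z1 z2 = sadd z1 (sscale (-1) z2)"

definition Hsp :: "real \<Rightarrow> st set" where
  "Hsp L = {(w, v, \<xi>, \<psi>). w \<in> Sob 2 L \<and> v \<in> Sob 1 L \<and> \<xi> = v L \<and> \<psi> = v 0 \<and>
             (\<forall>x. x \<notin> {0..L} \<longrightarrow> w x = 0 \<and> v x = 0)}"

definition Hnorm :: "real \<Rightarrow> st \<Rightarrow> real" where
  "Hnorm L z = (case z of (w, v, \<xi>, \<psi>) \<Rightarrow>
     sqrt (sobnorm2 2 L w + sobnorm2 1 L v + (cmod \<xi>)\<^sup>2 + (cmod \<psi>)\<^sup>2))"

definition Fbd :: "real \<Rightarrow> real \<Rightarrow> real \<Rightarrow> real \<Rightarrow> real \<Rightarrow>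
                   (real \<Rightarrow> complex) \<Rightarrow> (real \<Rightarrow> complex) \<Rightarrow> complex" where
  "Fbd L \<theta>1 \<theta>2 \<theta>3 \<theta>4 w v =
     of_real \<theta>1 * v 0 + of_real \<theta>2 * dv L v 0 + of_real \<theta>3 * w 0 + of_real \<theta>4 * dv L w 0"

definition flux_d :: "real \<Rightarrow> (real \<Rightarrow> real) \<Rightarrow> (real \<Rightarrow> complex) \<Rightarrow> real \<Rightarrow> complex" where
  "flux_d L P w = dv L (\<lambda>y. complex_of_real (P y) * dv L w y)"

definition Aop :: "real \<Rightarrow> (real \<Rightarrow> real) \<Rightarrow> real \<Rightarrow> real \<Rightarrow> real \<Rightarrow> real \<Rightarrow> st \<Rightarrow> st" where
  "Aop L P \<theta>1 \<theta>2 \<theta>3 \<theta>4 z = (case z of (w, v, \<xi>, \<psi>) \<Rightarrow>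
     (v, restr L (flux_d L P w), - dv L w L, Fbd L \<theta>1 \<theta>2 \<theta>3 \<theta>4 w v))"

definition DomA :: "real \<Rightarrow> (real \<Rightarrow> real) \<Rightarrow> real \<Rightarrow> real \<Rightarrow> real \<Rightarrow> real \<Rightarrow> st set" where
  "DomA L P \<theta>1 \<theta>2 \<theta>3 \<theta>4 = {(w, v, \<xi>, \<psi>). (w, v, \<xi>, \<psi>) \<in> Hsp L \<and>
      w \<in> Sob 3 L \<and> v \<in> Sob 2 L \<and>
      flux_d L P w L = - dv L w L \<and>
      flux_d L P w 0 = Fbd L \<theta>1 \<theta>2 \<theta>3 \<theta>4 w v}"

definition C0_semigroup :: "st set \<Rightarrow> (st \<Rightarrow> real) \<Rightarrow> (real \<Rightarrow> st \<Rightarrow> st) \<Rightarrow> bool" where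
  "C0_semigroup H nrm T \<longleftrightarrow>
     (\<forall>t\<ge>0. \<forall>z\<in>H. T t z \<in> H) \<and>
     (\<forall>t\<ge>0. \<forall>z1\<in>H. \<forall>z2\<in>H. \<forall>c. T t (sadd (sscale c z1) z2) = sadd (sscale c (T t z1)) (T t z2)) \<and>
     (\<forall>t\<ge>0. \<exists>M. \<forall>z\<in>H. nrm (T t z) \<le> M * nrm z) \<and>
     (\<forall>z\<in>H. T 0 z = z) \<and>
     (\<forall>s\<ge>0. \<forall>t\<ge>0. \<forall>z\<in>H. T (s + t) z = T s (T t z)) \<and>
     (\<forall>z\<in>H. ((\<lambda>t. nrm (sdiff (T t z) z)) \<longlongrightarrow> 0) (at_right 0))"

definition generated_by :: "st set \<Rightarrow> (st \<Rightarrow> real) \<Rightarrow> (real \<Rightarrow> st \<Rightarrow> st) \<Rightarrow> st set \<Rightarrow> (st \<Rightarrow> st) \<Rightarrow> bool" where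
  "generated_by H nrm T D A \<longleftrightarrow>
     C0_semigroup H nrm T \<and> D \<subseteq> H \<and>
     (\<forall>z\<in>H. z \<in> D \<longleftrightarrow>
        (\<exists>y\<in>H. ((\<lambda>h. nrm (sdiff (sscale (complex_of_real (1 / h)) (sdiff (T h z) z)) y)) \<longlongrightarrow> 0) (at_right 0))) \<and>
     (\<forall>z\<in>D. A z \<in> H \<and>
        ((\<lambda>h. nrm (sdiff (sscale (complex_of_real (1 / h)) (sdiff (T h z) z)) (A z))) \<longlongrightarrow> 0) (at_right 0))"

end

theory Submission
  imports Defs "HOL-Library.Function_Algebras"
begin

text \<open>The states w in H^2, v in H^1 form the domain of a dissipative operator for the weaker energy
  E of H^1 x L^2 type with boundary variables v(L) and eta = v(0) - (theta3 w(0) + theta4 w'(0)) / b.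
  Along solutions this energy decreases by a multiple of |v(0)|^2 + |theta3 w(0) + theta4 w'(0)|^2. Adding to a
  large multiple of E the multiplier terms - int exp(-K x) v w' dx, which controls the interior and the mass
  at L, and Re (conj w(0) (int v dx + P(L) v(L))), which controls w(0), yields an equivalent quadratic form W
  that decays exponentially along solutions with initial value in the domain of A, hence by density along all
  solutions. The norm of the state space is equivalent to the graph norm, given by W z + W (A z), and A
  commutes with the semigroup; so the norm decays exponentially as well. No compactness is needed.\<close>

section \<open>Semigroups with a dissipative quadratic form\<close>

text \<open>With u = \<theta>3 w(0) + \<theta>4 w'(0) the relations for \<theta>1 and \<theta>2 turn
  the feedback law v_t(0) = F into (v(0) - u/b)_t = u - a v(0); this is where eta comes from. The
  flux at 0 leaves an indefinite multiple of Re (conj u v(0)) in the energy balance, and the weight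
  of |eta|^2 is the one that cancels it. Since eta contains the trace w'(0), E is bounded by the
  norm of H^2 x H^1 but not by that of H^1 x L^2, while E does not see w'' or v'. Decay of W alone
  therefore does not give decay of the state norm. The gap closes because A costs exactly one
  derivative: W (A z) contains (P w')' and v' in L^2, and both W z and W (A z) are bounded by the
  squared state norm of z itself. Decay of W along the orbits of z and of A z thus gives a bound by
  the norm of z with a constant independent of z, and such a bound passes from the domain to its
  closure. All scalars are real: \<open>\<bullet>\<close> on the complex numbers is Re (conj x y),
  and only such real parts are differentiated.\<close>

lemma nonincreasing_of_right_derivative:
  fixes f :: "real \<Rightarrow> real"
  assumes "a \<le> b" and cont: "continuous_on {a..b} f"
    and der: "\<And>s. a \<le> s \<Longrightarrow> s < b \<Longrightarrow> (f has_real_derivative f' s) (at_right s)"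
    and neg: "\<And>s. a \<le> s \<Longrightarrow> s < b \<Longrightarrow> f' s \<le> 0"
  shows "f b \<le> f a"
proof (rule field_le_epsilon)
  fix e0 :: real assume "e0 > 0"
  \<comment> \<open>The + 1 keeps the quotient defined for a = b and still gives e * (b - a) \<le>
    e0.\<close>
  define e where "e = e0 / (b - a + 1)"
  have e: "e > 0" "e * (b - a) \<le> e0"
    using \<open>e0 > 0\<close> \<open>a \<le> b\<close> by (auto simp: e_def field_simps)
  \<comment> \<open>The hypothesis looks only to the right of a point. At the last point s of K the
    right derivative lies below e, so K would reach beyond s unless s = b.\<close>
  define K where "K = {s\<in>{a..b}. f s - e * (s - a) \<le> f a}"
  have "closed K"
    unfolding K_def by (intro continuous_on_closed_Collect_le continuous_intros cont)
  moreover have ne: "a \<in> K" and bd: "K \<subseteq> {a..b}" using \<open>a \<le> b\<close> by (auto simp: K_def)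
  ultimately have "compact K"
    using bounded_subset[OF bounded_closed_interval] by (simp add: compact_eq_bounded_closed)
  then obtain s where s: "s \<in> K" "\<And>r. r \<in> K \<Longrightarrow> r \<le> s"
    using compact_attains_sup[of K] ne by blast
  have "s = b"
  proof (rule ccontr)
    assume "s \<noteq> b"
    then have "a \<le> s" "s < b" using s bd by auto
    have "((\<lambda>r. (f r - f s) / (r - s)) \<longlongrightarrow> f' s) (at_right s)"
      using der[OF \<open>a \<le> s\<close> \<open>s < b\<close>] by (simp add: has_field_derivative_iff)
    then have "\<forall>\<^sub>F r in at_right s. (f r - f s) / (r - s) < e"
      by (rule order_tendstoD) (use neg[OF \<open>a \<le> s\<close> \<open>s < b\<close>] e in auto)
    moreover have "\<forall>\<^sub>F r in at_right s. r \<in> {s<..<b}"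
      using \<open>s < b\<close> by (rule eventually_at_right_real)
    ultimately have "\<forall>\<^sub>F r in at_right s. (f r - f s) / (r - s) < e \<and> r \<in> {s<..<b}"
      by (rule eventually_conj)
    then obtain r where r: "(f r - f s) / (r - s) < e" "s < r" "r < b"
      using eventually_happens[of _ "at_right s"] by (auto simp: trivial_limit_at_right_real)
    then have "f r - f s < e * (r - s)" by (simp add: field_simps)
    then have "r \<in> K" using s(1) r \<open>a \<le> s\<close> by (auto simp: K_def algebra_simps)
    then show False using s(2) r by fastforce
  qed
  then show "f b \<le> f a + e0" using s(1) e by (auto simp: K_def)
qed

text \<open>Baire category: d is the pseudometric pulled back along a curve, and the points near which the
  curve oscillates by less than 1/n form an open set, which is dense by right continuity.\<close>
lemma right_continuous_imp_continuity_point: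
  fixes d :: "real \<Rightarrow> real \<Rightarrow> real"
  assumes sym: "\<And>s t. d s t = d t s" and tri: "\<And>r s t. d r t \<le> d r s + d s t"
    and zero: "\<And>t. d t t = 0"
    and rc: "\<And>t. ((\<lambda>s. d s t) \<longlongrightarrow> 0) (at_right t)"
    and "a < b"
  obtains t where "a < t" "t < b" "((\<lambda>s. d s t) \<longlongrightarrow> 0) (at t)"
proof -
  have nonneg: "0 \<le> d s t" for s t
    using tri[of s s t] sym[of s t] zero[of s] tri[where r=s and s=t and t=s] by simp
  define G where "G n = {t. \<exists>e>0. \<forall>r\<in>ball t e. \<forall>s\<in>ball t e. d r s < inverse (real (Suc n))}" for n
  have "open (G n)" for n
    unfolding open_contains_ball
  proof safe
    fix t assume "t \<in> G n"
    then obtain e where e: "e > 0" "\<forall>r\<in>ball t e. \<forall>s\<in>ball t e. d r s < inverse (real (Suc n))"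
      by (auto simp: G_def)
    have "ball t e \<subseteq> G n"
    proof
      fix t' assume "t' \<in> ball t e"
      then obtain e' where "e' > 0" "ball t' e' \<subseteq> ball t e"
        by (meson open_ball open_contains_ball)
      then show "t' \<in> G n" using e(2) unfolding G_def by blast
    qed
    then show "\<exists>e>0. ball t e \<subseteq> G n" using e(1) by blast
  qed
  moreover have "closure (G n) = UNIV" for n
  proof -
    have "t \<in> closure (G n)" for t
    proof -
      \<comment> \<open>Half the tolerance, because two points to the right of t are compared
        through t.\<close>
      define c where "c = inverse (real (Suc n)) / 2"
      have "c > 0" by (simp add: c_def)
      then have "\<forall>\<^sub>F s in at_right t. d s t < c"
        using rc order_tendstoD(2) by blast
      then obtain b' where b': "b' > t" "\<And>y. t < y \<Longrightarrow> y < b' \<Longrightarrow> d y t < c"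
        by (auto simp: eventually_at_right_field)
      have "{t<..<b'} \<subseteq> G n"
      proof
        fix u assume "u \<in> {t<..<b'}"
        then obtain e where e: "e > 0" "ball u e \<subseteq> {t<..<b'}"
          by (meson open_contains_ball open_greaterThanLessThan)
        have "d r s < inverse (real (Suc n))" if "r \<in> ball u e" "s \<in> ball u e" for r s
        proof -
          have "d r t < c" "d s t < c" using that e b' by auto
          then show ?thesis using tri[of r s t] sym[of s t] unfolding c_def by simp
        qed
        then show "u \<in> G n" unfolding G_def using e by auto
      qed
      then have "closure {t<..<b'} \<subseteq> closure (G n)" by (rule closure_mono)
      then show ?thesis using b'(1) by (auto simp: closure_greaterThanLessThan)
    qed
    then show ?thesis by auto
  qed
  ultimately have "UNIV \<subseteq> closure (\<Inter> (range G))"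
    by (intro Baire) auto
  then have "{a<..<b} \<inter> \<Inter> (range G) \<noteq> {}"
    using \<open>a < b\<close> open_Int_closure_eq_empty[of "{a<..<b}" "\<Inter> (range G)"]
    by (metis Int_UNIV_right UNIV_I greaterThanLessThan_empty_iff not_le open_greaterThanLessThan top.extremum_uniqueI)
  then obtain t where t: "a < t" "t < b" "\<And>n. t \<in> G n" by force
  have "((\<lambda>s. d s t) \<longlongrightarrow> 0) (at t)"
  proof (rule tendstoI)
    fix e :: real assume "e > 0"
    then obtain n where n: "inverse (real (Suc n)) < e" using reals_Archimedean by blast
    obtain e' where "e' > 0" "\<forall>r\<in>ball t e'. \<forall>s\<in>ball t e'. d r s < inverse (real (Suc n))"
      using t(3)[of n] by (auto simp: G_def)
    then show "\<forall>\<^sub>F s in at t. dist (d s t) 0 < e"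
      using n nonneg unfolding eventually_at
      by (intro exI[of _ e'] conjI ballI impI) (simp_all add: dist_commute less_trans[OF _ n] del: of_nat_Suc)
  qed
  then show ?thesis using that t by blast
qed

section \<open>Semi-inner products on a subspace\<close>

locale semi_inner =
  fixes S :: "'a::real_vector set" and B :: "'a \<Rightarrow> 'a \<Rightarrow> real"
  assumes subspace: "subspace S"
    and sym: "x \<in> S \<Longrightarrow> y \<in> S \<Longrightarrow> B x y = B y x"
    and add: "x \<in> S \<Longrightarrow> y \<in> S \<Longrightarrow> z \<in> S \<Longrightarrow> B (x + y) z = B x z + B y z"
    and scale: "x \<in> S \<Longrightarrow> z \<in> S \<Longrightarrow> B (c *\<^sub>R x) z = c * B x z"
    and nonneg: "x \<in> S \<Longrightarrow> 0 \<le> B x x"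
begin

definition nrm :: "'a \<Rightarrow> real" where "nrm x = sqrt (B x x)"

lemmas mem = subspace_add[OF subspace] subspace_scale[OF subspace] subspace_diff[OF subspace]
  subspace_neg[OF subspace]

lemma add_right: "x \<in> S \<Longrightarrow> y \<in> S \<Longrightarrow> z \<in> S \<Longrightarrow> B z (x + y) = B z x + B z y"
  using sym add mem by metis

lemma scale_right: "x \<in> S \<Longrightarrow> z \<in> S \<Longrightarrow> B z (c *\<^sub>R x) = c * B z x"
  using sym scale mem by metis

lemma diff: "x \<in> S \<Longrightarrow> y \<in> S \<Longrightarrow> z \<in> S \<Longrightarrow> B (x - y) z = B x z - B y z"
  using add[of x "(-1) *\<^sub>R y" z] scale[of y z "-1"] mem by simp

lemma diff_right: "x \<in> S \<Longrightarrow> y \<in> S \<Longrightarrow> z \<in> S \<Longrightarrow> B z (x - y) = B z x - B z y"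
  using sym diff mem by metis

lemma nrm_ge_0 [simp]: "x \<in> S \<Longrightarrow> 0 \<le> nrm x"
  by (simp add: nrm_def nonneg)

lemma nrm_sq: "x \<in> S \<Longrightarrow> (nrm x)\<^sup>2 = B x x"
  by (simp add: nrm_def nonneg)

lemma square_expand:
  assumes "x \<in> S" "y \<in> S"
  shows "B (x + c *\<^sub>R y) (x + c *\<^sub>R y) = B x x + 2 * c * B x y + c\<^sup>2 * B y y"
  using assms sym[of y x] by (simp add: add add_right scale scale_right mem power2_eq_square algebra_simps)

lemma Cauchy_Schwarz:
  assumes "x \<in> S" "y \<in> S"
  shows "\<bar>B x y\<bar> \<le> nrm x * nrm y"
proof -
  have pos: "0 \<le> B x x + 2 * c * B x y + c\<^sup>2 * B y y" for c
    using square_expand[OF assms, of c] nonneg[of "x + c *\<^sub>R y"] assms mem by simp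
  have "(B x y)\<^sup>2 \<le> B x x * B y y"
  proof (cases "B y y = 0")
    case False
    then have "B y y > 0" using nonneg[OF assms(2)] by simp
    have "0 \<le> B x x + 2 * (- B x y / B y y) * B x y + (- B x y / B y y)\<^sup>2 * B y y"
      using pos by blast
    then show ?thesis using \<open>B y y > 0\<close> by (simp add: field_simps power2_eq_square)
  next
    case True
    have "B x y = 0"
    proof (rule ccontr)
      assume "B x y \<noteq> 0"
      \<comment> \<open>With B y y = 0 the nonnegative quadratic in c is affine; this value of c
        would make it -1.\<close>
      then have "B x x + 2 * (- (B x x + 1) / (2 * B x y)) * B x y = -1" by (simp add: field_simps)
      then show False using pos[of "- (B x x + 1) / (2 * B x y)"] True by simp
    qed
    then show ?thesis using True by simp
  qed
  then have "sqrt ((B x y)\<^sup>2) \<le> sqrt (B x x * B y y)" by (rule real_sqrt_le_mono)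
  then show ?thesis by (simp add: nrm_def real_sqrt_mult)
qed

lemma nrm_add:
  assumes "x \<in> S" "y \<in> S"
  shows "nrm (x + y) \<le> nrm x + nrm y"
proof (rule power2_le_imp_le)
  have "(nrm (x + y))\<^sup>2 = (nrm x)\<^sup>2 + 2 * B x y + (nrm y)\<^sup>2"
    using square_expand[OF assms, of 1] assms by (simp add: nrm_sq mem)
  then show "(nrm (x + y))\<^sup>2 \<le> (nrm x + nrm y)\<^sup>2"
    using Cauchy_Schwarz[OF assms] by (simp add: power2_sum)
qed (use assms in simp)

lemma nrm_scale: "x \<in> S \<Longrightarrow> nrm (c *\<^sub>R x) = \<bar>c\<bar> * nrm x"
  by (simp add: nrm_def scale scale_right mem real_sqrt_mult flip: power2_eq_square mult.assoc)

lemma nrm_minus_commute: "x \<in> S \<Longrightarrow> y \<in> S \<Longrightarrow> nrm (x - y) = nrm (y - x)"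
  using nrm_scale[of "x - y" "-1"] mem by simp

lemma nrm_triangle: "x \<in> S \<Longrightarrow> y \<in> S \<Longrightarrow> z \<in> S \<Longrightarrow> nrm (x - z) \<le> nrm (x - y) + nrm (y - z)"
  using nrm_add[of "x - y" "y - z"] mem by simp

lemma nrm_0 [simp]: "nrm 0 = 0"
  using nrm_scale[of 0 0] subspace_0[OF subspace] by simp

lemma nrm_diff_ineq: "x \<in> S \<Longrightarrow> y \<in> S \<Longrightarrow> \<bar>nrm x - nrm y\<bar> \<le> nrm (x - y)"
  using nrm_add[of "x - y" y] nrm_add[of "y - x" x] nrm_minus_commute[of x y] mem by auto

end

section \<open>Strongly continuous semigroups and continuity of their orbits\<close>

locale strong_semigroup = semi_inner +
  fixes T :: "real \<Rightarrow> 'a \<Rightarrow> 'a"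
  assumes T_mem: "t \<ge> 0 \<Longrightarrow> x \<in> S \<Longrightarrow> T t x \<in> S"
    and T_linear: "t \<ge> 0 \<Longrightarrow> x \<in> S \<Longrightarrow> y \<in> S \<Longrightarrow> T t (c *\<^sub>R x + y) = c *\<^sub>R T t x + T t y"
    and T_bounded: "t \<ge> 0 \<Longrightarrow> \<exists>M. \<forall>x\<in>S. nrm (T t x) \<le> M * nrm x"
    and T_0: "x \<in> S \<Longrightarrow> T 0 x = x"
    and T_plus: "s \<ge> 0 \<Longrightarrow> t \<ge> 0 \<Longrightarrow> x \<in> S \<Longrightarrow> T (s + t) x = T s (T t x)"
    and T_right: "x \<in> S \<Longrightarrow> ((\<lambda>t. nrm (T t x - x)) \<longlongrightarrow> 0) (at_right 0)"
begin

lemma T_diff: "t \<ge> 0 \<Longrightarrow> x \<in> S \<Longrightarrow> y \<in> S \<Longrightarrow> T t (x - y) = T t x - T t y"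
  using T_linear[of t y x "-1"] by (simp add: algebra_simps)

lemma T_scale:
  assumes "t \<ge> 0" "x \<in> S"
  shows "T t (c *\<^sub>R x) = c *\<^sub>R T t x"
proof -
  have 0: "0 \<in> S" by (rule subspace_0[OF subspace])
  have "T t 0 = 0" using T_diff[OF assms(1) 0 0] by simp
  then show ?thesis using T_linear[OF assms 0, of c] by simp
qed

lemma T_tendsto:
  assumes "t \<ge> 0" "\<forall>\<^sub>F s in F. f s \<in> S" "((\<lambda>s. nrm (f s)) \<longlongrightarrow> 0) F"
  shows "((\<lambda>s. nrm (T t (f s))) \<longlongrightarrow> 0) F"
proof -
  obtain M where M: "\<And>x. x \<in> S \<Longrightarrow> nrm (T t x) \<le> M * nrm x" using T_bounded assms(1) by blast
  have lim: "((\<lambda>s. M * nrm (f s)) \<longlongrightarrow> 0) F" using tendsto_mult_right_zero[OF assms(3)] by simp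
  show ?thesis
  proof (rule real_tendsto_sandwich[OF _ _ tendsto_const lim])
    show "\<forall>\<^sub>F s in F. 0 \<le> nrm (T t (f s))" "\<forall>\<^sub>F s in F. nrm (T t (f s)) \<le> M * nrm (f s)"
      using assms(2) by (eventually_elim, use M T_mem[OF assms(1)] in auto)+
  qed
qed

lemma T_right_continuous:
  assumes "t \<ge> 0" "x \<in> S"
  shows "((\<lambda>s. nrm (T s x - T t x)) \<longlongrightarrow> 0) (at_right t)"
proof -
  have ev: "\<forall>\<^sub>F h in at_right (0::real). h > 0" by (simp add: eventually_at_right_less)
  have "((\<lambda>h. nrm (T t (T h x - x))) \<longlongrightarrow> 0) (at_right 0)"
    by (rule T_tendsto[OF assms(1) _ T_right[OF assms(2)]])
       (use ev in eventually_elim, use assms T_mem mem in auto)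
  then have "((\<lambda>h. nrm (T (h + t) x - T t x)) \<longlongrightarrow> 0) (at_right 0)"
    by (rule Lim_transform_eventually)
       (use ev in eventually_elim, use assms T_mem T_plus[of t] T_diff in \<open>auto simp: add.commute\<close>)
  then show ?thesis by (subst filterlim_at_right_to_0)
qed

text \<open>A single continuity point before t suffices: its continuity is transported to t by a bounded
  operator of the semigroup. This avoids the uniform boundedness principle, hence completeness.\<close>
lemma T_continuous:
  assumes "t > 0" "x \<in> S"
  shows "((\<lambda>s. nrm (T s x - T t x)) \<longlongrightarrow> 0) (at t)"
proof -
  \<comment> \<open>Constant continuation to negative times, so that the Baire argument can run on
    the whole line; right continuity is trivial there.\<close>
  define u where "u s = T (max 0 s) x" for s
  have uS: "u s \<in> S" for s using T_mem assms by (simp add: u_def)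
  obtain t0 where t0: "0 < t0" "t0 < t" and lim: "((\<lambda>s. nrm (u s - u t0)) \<longlongrightarrow> 0) (at t0)"
  proof (rule right_continuous_imp_continuity_point[of "\<lambda>s t. nrm (u s - u t)" 0 t])
    fix s :: real
    show "((\<lambda>r. nrm (u r - u s)) \<longlongrightarrow> 0) (at_right s)"
    proof (cases "s \<ge> 0")
      case True
      have "\<forall>\<^sub>F r in at_right s. r > s" by (simp add: eventually_at_right_less)
      then have "\<forall>\<^sub>F r in at_right s. nrm (T r x - T s x) = nrm (u r - u s)"
        by eventually_elim (use True in \<open>simp add: u_def\<close>)
      with T_right_continuous[OF True assms(2)] show ?thesis by (rule Lim_transform_eventually)
    next
      case False
      then have "\<forall>\<^sub>F r in at_right s. r < 0"
        by (intro order_tendstoD(2)[OF tendsto_ident_at]) simp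
      then have "\<forall>\<^sub>F r in at_right s. 0 = nrm (u r - u s)"
        by eventually_elim (use False in \<open>simp add: u_def\<close>)
      with tendsto_const show ?thesis by (rule Lim_transform_eventually)
    qed
  qed (use assms(1) uS nrm_minus_commute nrm_triangle in auto)
  have pos: "\<forall>\<^sub>F s in at t0. s > 0"
    by (rule order_tendstoD(1)[OF tendsto_ident_at]) (use t0 in simp)
  have "((\<lambda>s. nrm (T (t - t0) (u s - u t0))) \<longlongrightarrow> 0) (at t0)"
    by (rule T_tendsto[OF _ _ lim]) (use t0 uS mem in auto)
  then have "((\<lambda>s. nrm (T (s + (t - t0)) x - T t x)) \<longlongrightarrow> 0) (at t0)"
  proof (rule Lim_transform_eventually)
    show "\<forall>\<^sub>F s in at t0. nrm (T (t - t0) (u s - u t0)) = nrm (T (s + (t - t0)) x - T t x)"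
      using pos
    proof eventually_elim
      case (elim s)
      have "T (s + (t - t0)) x = T (t - t0) (T s x)" "T t x = T (t - t0) (T t0 x)"
        using T_plus[of "t - t0" s x] T_plus[of "t - t0" t0 x] t0 elim assms by (simp_all add: add.commute)
      then show ?case using T_diff t0 uS elim by (simp add: u_def T_mem assms)
    qed
  qed
  then show ?thesis
    using filterlim_shift_iff[of "\<lambda>s. nrm (T s x - T t x)" "t - t0" "nhds 0" "t"]
    by (simp add: o_def add.commute)
qed

lemma T_continuous_0:
  assumes "t \<ge> 0" "x \<in> S"
  shows "((\<lambda>s. nrm (T s x - T t x)) \<longlongrightarrow> 0) (at t within {0..})"
proof (cases "t = 0")
  case True
  then show ?thesis using T_right_continuous[OF assms] by (simp add: at_within_Ici_at_right)
next
  case False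
  then show ?thesis using T_continuous[of t x] assms by (auto intro: tendsto_within_subset)
qed

end

text \<open>W is the Lyapunov form. It may be much weaker than B, but its seminorm is continuous for
  that of B, so quantities built from W pass to limits taken in the norm of B.\<close>

locale bounded_form = semi_inner + W: semi_inner S W for W +
  fixes C :: real
  assumes W_le: "x \<in> S \<Longrightarrow> W x x \<le> C * B x x"
begin

lemma C_bound:
  obtains K where "K \<ge> 0" "\<And>x. x \<in> S \<Longrightarrow> W.nrm x \<le> K * nrm x"
proof
  show "sqrt \<bar>C\<bar> \<ge> 0" by simp
  fix x assume "x \<in> S"
  have "W x x \<le> \<bar>C\<bar> * B x x"
    using W_le[OF \<open>x \<in> S\<close>] nonneg[OF \<open>x \<in> S\<close>] mult_right_mono[of C "\<bar>C\<bar>" "B x x"] by linarith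
  then show "W.nrm x \<le> sqrt \<bar>C\<bar> * nrm x"
    unfolding W.nrm_def nrm_def by (simp flip: real_sqrt_mult)
qed

lemma W_nrm_tendsto:
  assumes "\<forall>\<^sub>F s in F. f s \<in> S" "((\<lambda>s. nrm (f s)) \<longlongrightarrow> 0) F"
  shows "((\<lambda>s. W.nrm (f s)) \<longlongrightarrow> 0) F"
proof -
  obtain K where K: "\<And>x. x \<in> S \<Longrightarrow> W.nrm x \<le> K * nrm x" using C_bound by blast
  have lim: "((\<lambda>s. K * nrm (f s)) \<longlongrightarrow> 0) F" using tendsto_mult_right_zero[OF assms(2)] by simp
  show ?thesis
  proof (rule real_tendsto_sandwich[OF _ _ tendsto_const lim])
    show "\<forall>\<^sub>F s in F. 0 \<le> W.nrm (f s)" "\<forall>\<^sub>F s in F. W.nrm (f s) \<le> K * nrm (f s)"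
      using assms(1) by (eventually_elim, use K in auto)+
  qed
qed

lemma W_tendsto:
  assumes "\<forall>\<^sub>F s in F. f s \<in> S" "x \<in> S" "((\<lambda>s. nrm (f s - x)) \<longlongrightarrow> 0) F"
  shows W_nrm_lim: "((\<lambda>s. W.nrm (f s)) \<longlongrightarrow> W.nrm x) F"
    and W_lim: "y \<in> S \<Longrightarrow> ((\<lambda>s. W y (f s)) \<longlongrightarrow> W y x) F"
proof -
  have ev: "\<forall>\<^sub>F s in F. f s - x \<in> S"
    using assms(1) by eventually_elim (use assms mem in auto)
  have lim: "((\<lambda>s. W.nrm (f s - x)) \<longlongrightarrow> 0) F"
    by (rule W_nrm_tendsto[OF ev assms(3)])
  have "\<forall>\<^sub>F s in F. norm (W.nrm (f s) - W.nrm x) \<le> W.nrm (f s - x)"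
    using assms(1) by eventually_elim (simp add: W.nrm_diff_ineq assms(2))
  then show "((\<lambda>s. W.nrm (f s)) \<longlongrightarrow> W.nrm x) F"
    by (subst Lim_null, rule Lim_null_comparison[OF _ lim])
  assume y: "y \<in> S"
  have lim': "((\<lambda>s. W.nrm y * W.nrm (f s - x)) \<longlongrightarrow> 0) F"
    using tendsto_mult_right_zero[OF lim] by simp
  have "\<forall>\<^sub>F s in F. norm (W y (f s) - W y x) \<le> W.nrm y * W.nrm (f s - x)"
    using assms(1)
  proof eventually_elim
    case (elim s)
    then show ?case using W.Cauchy_Schwarz[OF y, of "f s - x"] W.diff_right[OF elim assms(2) y] assms(2) mem(3)
      by simp
  qed
  then show "((\<lambda>s. W y (f s)) \<longlongrightarrow> W y x) F"
    by (subst Lim_null, rule Lim_null_comparison[OF _ lim'])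
qed

end

text \<open>Together with \<open>W_le\<close>, the two graph conditions say that on D the form B is
  equivalent to the graph form W z + W (A z). \<open>D_I\<close> says that D is the full domain of
  the generator, which is what makes D invariant under the semigroup.\<close>

locale damped_semigroup = strong_semigroup + bounded_form +
  fixes D A \<kappa> C1 C2
  assumes D_sub: "D \<subseteq> S"
    and A_mem: "z \<in> D \<Longrightarrow> A z \<in> S"
    and gen: "z \<in> D \<Longrightarrow> ((\<lambda>h. nrm ((1 / h) *\<^sub>R (T h z - z) - A z)) \<longlongrightarrow> 0) (at_right 0)"
    and D_I: "z \<in> S \<Longrightarrow> y \<in> S \<Longrightarrow>
      ((\<lambda>h. nrm ((1 / h) *\<^sub>R (T h z - z) - y)) \<longlongrightarrow> 0) (at_right 0) \<Longrightarrow> z \<in> D"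
    and dense: "z \<in> S \<Longrightarrow> e > 0 \<Longrightarrow> \<exists>y\<in>D. nrm (z - y) < e"
    and \<kappa>: "\<kappa> > 0"
    and dissipative: "z \<in> D \<Longrightarrow> W z (A z) \<le> - \<kappa> * W z z"
    and graph_upper: "z \<in> D \<Longrightarrow> B z z \<le> C1 * (W z z + W (A z) (A z))"
    and graph_lower: "z \<in> D \<Longrightarrow> W (A z) (A z) \<le> C2 * B z z"
begin

text \<open>The difference quotient at T t z is the image under T t of the one at z.\<close>

lemma T_gen:
  assumes "t \<ge> 0" "z \<in> D"
  shows "((\<lambda>h. nrm ((1 / h) *\<^sub>R (T h (T t z) - T t z) - T t (A z))) \<longlongrightarrow> 0) (at_right 0)"
proof -
  have ev: "\<forall>\<^sub>F h in at_right (0::real). h > 0" by (simp add: eventually_at_right_less)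
  have zS: "z \<in> S" using assms D_sub by auto
  have "((\<lambda>h. nrm (T t ((1 / h) *\<^sub>R (T h z - z) - A z))) \<longlongrightarrow> 0) (at_right 0)"
    by (rule T_tendsto[OF assms(1) _ gen[OF assms(2)]])
       (use ev in eventually_elim, use zS A_mem[OF assms(2)] T_mem in \<open>auto intro!: mem\<close>)
  then show ?thesis
  proof (rule Lim_transform_eventually)
    show "\<forall>\<^sub>F h in at_right 0. nrm (T t ((1 / h) *\<^sub>R (T h z - z) - A z)) =
        nrm ((1 / h) *\<^sub>R (T h (T t z) - T t z) - T t (A z))"
      using ev
    proof eventually_elim
      case (elim h)
      have "T h (T t z) = T t (T h z)"
        using T_plus[of h t z] T_plus[of t h z] elim assms zS by (simp add: add.commute)
      then show ?case
        using zS A_mem[OF assms(2)] T_mem[OF _ zS] assms elim by (simp add: T_diff T_scale mem)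
    qed
  qed
qed

lemma T_D: "t \<ge> 0 \<Longrightarrow> z \<in> D \<Longrightarrow> T t z \<in> D"
  using T_gen D_I T_mem A_mem D_sub by blast

text \<open>Both vectors are limits of the same difference quotient. A seminorm identifies limits
  only up to distance 0, which is enough because W is bounded by B.\<close>

lemma A_T:
  assumes "t \<ge> 0" "z \<in> D"
  shows "nrm (A (T t z) - T t (A z)) = 0"
proof -
  define q where "q h = (1 / h) *\<^sub>R (T h (T t z) - T t z)" for h
  have S: "T t z \<in> S" "A (T t z) \<in> S" "T t (A z) \<in> S"
    using T_D[OF assms] A_mem assms T_mem D_sub by auto
  have ev: "\<forall>\<^sub>F h in at_right (0::real). h > 0" by (simp add: eventually_at_right_less)
  have "((\<lambda>h. nrm (q h - A (T t z)) + nrm (q h - T t (A z))) \<longlongrightarrow> 0 + 0) (at_right 0)"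
    unfolding q_def by (intro tendsto_add gen T_D T_gen assms)
  moreover have "\<forall>\<^sub>F h in at_right (0::real).
      nrm (A (T t z) - T t (A z)) \<le> nrm (q h - A (T t z)) + nrm (q h - T t (A z))"
    using ev
  proof eventually_elim
    case (elim h)
    have "q h \<in> S" using elim S T_mem by (auto simp: q_def intro!: mem)
    then show ?case using nrm_triangle[of "A (T t z)" "q h" "T t (A z)"] nrm_minus_commute S by simp
  qed
  ultimately have "nrm (A (T t z) - T t (A z)) \<le> 0 + 0"
    by (intro tendsto_lowerbound) auto
  then show ?thesis using nrm_ge_0[OF mem(3)[OF S(2,3)]] by simp
qed

text \<open>Writing T (t + h) z = x + h q, the difference quotient of W is 2 W x q + h W q q, and q
  tends to A x in the norm of B.\<close>

lemma W_right_derivative: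
  assumes "t \<ge> 0" "z \<in> D"
  shows "((\<lambda>s. W (T s z) (T s z)) has_real_derivative 2 * W (T t z) (A (T t z))) (at_right t)"
proof -
  define x where "x = T t z"
  define q where "q h = (1 / h) *\<^sub>R (T h x - x)" for h
  have xD: "x \<in> D" and S: "z \<in> S" "x \<in> S" "A x \<in> S"
    using T_D[OF assms] A_mem assms T_mem D_sub by (auto simp: x_def)
  have ev: "\<forall>\<^sub>F h in at_right (0::real). h > 0" by (simp add: eventually_at_right_less)
  have qS: "\<forall>\<^sub>F h in at_right (0::real). q h \<in> S"
    using ev by eventually_elim (use S T_mem in \<open>auto simp: q_def intro!: mem\<close>)
  have lim: "((\<lambda>h. nrm (q h - A x)) \<longlongrightarrow> 0) (at_right 0)"
    unfolding q_def by (rule gen[OF xD])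
  have "((\<lambda>h. 2 * W x (q h) + h * (W.nrm (q h))\<^sup>2) \<longlongrightarrow> 2 * W x (A x) + 0 * (W.nrm (A x))\<^sup>2) (at_right 0)"
    by (intro tendsto_intros W_tendsto[OF qS S(3) lim] S tendsto_ident_at)
  moreover have "\<forall>\<^sub>F h in at_right 0. 2 * W x (q h) + h * (W.nrm (q h))\<^sup>2 =
      (W (T (h + t) z) (T (h + t) z) - W x x) / h"
    using ev qS
  proof eventually_elim
    case (elim h)
    have "T (h + t) z = x + h *\<^sub>R q h"
      using T_plus[of h t z] elim assms S by (simp add: q_def x_def)
    then have "W (T (h + t) z) (T (h + t) z) = W x x + 2 * h * W x (q h) + h\<^sup>2 * W (q h) (q h)"
      using W.square_expand[of x "q h" h] S elim by simp
    then show ?case using elim by (simp add: W.nrm_sq add_divide_distrib) (simp add: power2_eq_square)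
  qed
  ultimately have "((\<lambda>h. (W (T (h + t) z) (T (h + t) z) - W x x) / h) \<longlongrightarrow> 2 * W x (A x)) (at_right 0)"
    by (simp add: Lim_transform_eventually)
  then show ?thesis
    unfolding has_field_derivative_iff x_def by (subst filterlim_at_right_to_0) simp
qed

lemma W_continuous:
  assumes "z \<in> S"
  shows "continuous_on {0..t} (\<lambda>s. W (T s z) (T s z))"
proof -
  have "continuous_on {0..t} (\<lambda>s. (W.nrm (T s z))\<^sup>2)"
    unfolding continuous_on_def
  proof (intro ballI tendsto_power)
    fix s assume s: "s \<in> {0..t}"
    have ev: "\<forall>\<^sub>F r in at s within {0..t}. T r z \<in> S"
      unfolding eventually_at_filter using T_mem assms by (simp add: always_eventually)
    show "((\<lambda>s. W.nrm (T s z)) \<longlongrightarrow> W.nrm (T s z)) (at s within {0..t})"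
      by (rule W_nrm_lim[OF ev])
         (use s assms T_mem in \<open>auto intro: tendsto_within_subset[OF T_continuous_0]\<close>)
  qed
  then show ?thesis
    by (rule continuous_on_eq) (use T_mem assms in \<open>auto simp: W.nrm_sq\<close>)
qed

lemma W_decay_D:
  assumes "t \<ge> 0" "z \<in> D"
  shows "W.nrm (T t z) \<le> exp (- \<kappa> * t) * W.nrm z"
proof -
  have zS: "z \<in> S" using assms D_sub by auto
  \<comment> \<open>Integrating factor: the derivative of W along the orbit is 2 W z (A z), at most
    - 2 \<kappa> W.\<close>
  define f where "f s = exp (2 * \<kappa> * s) * W (T s z) (T s z)" for s
  have "f t \<le> f 0"
  proof (rule nonincreasing_of_right_derivative[OF assms(1)])
    show "continuous_on {0..t} f"
      unfolding f_def by (intro continuous_intros W_continuous zS)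
    fix s :: real assume s: "0 \<le> s" "s < t"
    show "(f has_real_derivative
        (exp (2 * \<kappa> * s) * (2 * W (T s z) (A (T s z))) + exp (2 * \<kappa> * s) * (2 * \<kappa>) * W (T s z) (T s z))) (at_right s)"
      unfolding f_def
      by (rule DERIV_mult'[OF _ W_right_derivative[OF s(1) assms(2)]])
         (auto intro!: derivative_eq_intros)
    have "W (T s z) (A (T s z)) + \<kappa> * W (T s z) (T s z) \<le> 0"
      using dissipative[OF T_D[OF s(1) assms(2)]] by simp
    then have "exp (2 * \<kappa> * s) * (2 * (W (T s z) (A (T s z)) + \<kappa> * W (T s z) (T s z))) \<le> 0"
      by (simp add: mult_le_0_iff)
    then show "exp (2 * \<kappa> * s) * (2 * W (T s z) (A (T s z))) + exp (2 * \<kappa> * s) * (2 * \<kappa>) * W (T s z) (T s z) \<le> 0"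
      by (simp add: algebra_simps)
  qed
  then have "exp (2 * \<kappa> * t) * W (T t z) (T t z) \<le> W z z" by (simp add: f_def T_0 zS)
  then have "(exp (\<kappa> * t))\<^sup>2 * (W.nrm (T t z))\<^sup>2 \<le> (W.nrm z)\<^sup>2"
    using zS T_mem assms by (simp add: W.nrm_sq mult.assoc flip: exp_double)
  then have "(exp (\<kappa> * t) * W.nrm (T t z))\<^sup>2 \<le> (W.nrm z)\<^sup>2" by (simp only: power_mult_distrib)
  then have "exp (\<kappa> * t) * W.nrm (T t z) \<le> W.nrm z"
    by (rule power2_le_imp_le) (rule W.nrm_ge_0[OF zS])
  then show ?thesis by (simp add: exp_minus field_simps)
qed

lemma approx:
  assumes "z \<in> S"
  obtains y where "\<And>n::nat. y n \<in> D" "(\<lambda>n. nrm (y n - z)) \<longlonglongrightarrow> 0"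
proof -
  have "\<forall>n. \<exists>y\<in>D. nrm (z - y) < inverse (real (Suc n))"
    using dense[OF assms] by (metis inverse_positive_iff_positive of_nat_0_less_iff zero_less_Suc)
  then obtain y where y: "\<And>n. y n \<in> D" "\<And>n. nrm (z - y n) < inverse (real (Suc n))" by metis
  have "(\<lambda>n. nrm (y n - z)) \<longlonglongrightarrow> 0"
  proof (rule real_tendsto_sandwich[OF _ _ tendsto_const LIMSEQ_inverse_real_of_nat])
    have yS: "y n \<in> S" for n using y(1) D_sub by blast
    show "\<forall>\<^sub>F n in sequentially. 0 \<le> nrm (y n - z)"
      using yS assms by (simp add: mem(3))
    show "\<forall>\<^sub>F n in sequentially. nrm (y n - z) \<le> inverse (real (Suc n))"
      using y(2) by (simp add: nrm_minus_commute[OF yS assms] less_imp_le)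
  qed
  then show ?thesis using that y by blast
qed

lemma W_decay:
  assumes "t \<ge> 0" "z \<in> S"
  shows "W.nrm (T t z) \<le> exp (- \<kappa> * t) * W.nrm z"
proof -
  obtain y where y: "\<And>n::nat. y n \<in> D" "(\<lambda>n. nrm (y n - z)) \<longlonglongrightarrow> 0" using approx assms by blast
  have yS: "y n \<in> S" for n using y D_sub by blast
  have "(\<lambda>n. nrm (T t (y n - z))) \<longlonglongrightarrow> 0"
    by (rule T_tendsto[OF assms(1) _ y(2)]) (use yS assms in \<open>auto intro!: always_eventually mem\<close>)
  then have "(\<lambda>n. nrm (T t (y n) - T t z)) \<longlonglongrightarrow> 0"
    using T_diff assms yS by simp
  then have 1: "(\<lambda>n. W.nrm (T t (y n))) \<longlonglongrightarrow> W.nrm (T t z)"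
    by (rule W_nrm_lim[rotated -1]) (use yS T_mem assms in auto)
  have 2: "(\<lambda>n. exp (- \<kappa> * t) * W.nrm (y n)) \<longlonglongrightarrow> exp (- \<kappa> * t) * W.nrm z"
    by (intro tendsto_mult tendsto_const W_nrm_lim[OF _ _ y(2)]) (use yS assms in auto)
  show ?thesis
    by (rule LIMSEQ_le[OF 1 2]) (use W_decay_D y assms in blast)
qed

text \<open>W decays along the orbit of z, and also along that of A z, since A (T t z) and T t (A z)
  are at distance 0. The bound contains \<open>nrm z\<close> and no graph norm; this is what lets it
  survive the passage to the closure of D.\<close>

lemma decay_D:
  assumes "t \<ge> 0" "z \<in> D"
  shows "(nrm (T t z))\<^sup>2 \<le> (exp (- \<kappa> * t))\<^sup>2 * (\<bar>C1\<bar> * (C + C2) * (nrm z)\<^sup>2)"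
proof -
  define x where "x = T t z"
  have S: "z \<in> S" "A z \<in> S" "x \<in> S" "A x \<in> S" "T t (A z) \<in> S" and xD: "x \<in> D"
    using T_D[OF assms] A_mem assms T_mem D_sub by (auto simp: x_def)
  obtain K where K: "\<And>x. x \<in> S \<Longrightarrow> W.nrm x \<le> K * nrm x" using C_bound by blast
  have "W.nrm (A x - T t (A z)) \<le> 0"
    using K[OF mem(3)[OF S(4,5)]] A_T[OF assms] by (simp add: x_def)
  then have "W.nrm (A x) = W.nrm (T t (A z))"
    using W.nrm_diff_ineq[OF S(4,5)] by simp
  then have 1: "W.nrm (A x) \<le> exp (- \<kappa> * t) * W.nrm (A z)" using W_decay assms S by simp
  have 2: "W.nrm x \<le> exp (- \<kappa> * t) * W.nrm z" using W_decay assms S by (simp add: x_def)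
  have "W x x + W (A x) (A x) \<le> (exp (- \<kappa> * t))\<^sup>2 * (W z z + W (A z) (A z))"
    using power_mono[OF 1, of 2] power_mono[OF 2, of 2] S
    by (simp add: W.nrm_sq power_mult_distrib distrib_left)
  also have "\<dots> \<le> (exp (- \<kappa> * t))\<^sup>2 * ((C + C2) * B z z)"
    using W_le[OF S(1)] graph_lower[OF assms(2)] by (intro mult_left_mono) (auto simp: algebra_simps)
  finally have *: "W x x + W (A x) (A x) \<le> (exp (- \<kappa> * t))\<^sup>2 * ((C + C2) * B z z)" .
  have "B x x \<le> C1 * (W x x + W (A x) (A x))" by (rule graph_upper[OF xD])
  also have "\<dots> \<le> \<bar>C1\<bar> * (W x x + W (A x) (A x))"
    using W.nonneg S by (intro mult_right_mono) auto
  also have "\<dots> \<le> \<bar>C1\<bar> * ((exp (- \<kappa> * t))\<^sup>2 * ((C + C2) * B z z))"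
    by (intro mult_left_mono *) auto
  finally show ?thesis using S by (simp add: nrm_sq algebra_simps x_def)
qed

lemma bounded_decay:
  obtains K where "K \<ge> 0" "\<And>t z. t \<ge> 0 \<Longrightarrow> z \<in> D \<Longrightarrow> nrm (T t z) \<le> exp (- \<kappa> * t) * (K * nrm z)"
proof
  define M where "M = \<bar>C1\<bar> * (C + C2)"
  \<comment> \<open>No sign is known for C1, C and C2, hence the absolute value under the
    root.\<close>
  show "sqrt \<bar>M\<bar> \<ge> 0" by simp
  fix t z assume *: "t \<ge> (0::real)" "z \<in> D"
  have S: "z \<in> S" "T t z \<in> S" using * T_mem D_sub by auto
  have "(nrm (T t z))\<^sup>2 \<le> (exp (- \<kappa> * t))\<^sup>2 * (M * (nrm z)\<^sup>2)"
    unfolding M_def by (rule decay_D[OF *])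
  also have "\<dots> \<le> (exp (- \<kappa> * t))\<^sup>2 * (\<bar>M\<bar> * (nrm z)\<^sup>2)"
    by (rule mult_left_mono[OF mult_right_mono[OF abs_ge_self]]) (rule zero_le_power2)+
  also have "\<dots> = (exp (- \<kappa> * t) * (sqrt \<bar>M\<bar> * nrm z))\<^sup>2"
    by (simp only: power_mult_distrib real_sqrt_pow2[OF abs_ge_zero])
  finally show "nrm (T t z) \<le> exp (- \<kappa> * t) * (sqrt \<bar>M\<bar> * nrm z)"
    by (rule power2_le_imp_le) (intro mult_nonneg_nonneg nrm_ge_0 S real_sqrt_ge_zero abs_ge_zero exp_ge_zero)
qed

theorem stable:
  assumes "z \<in> S"
  shows "((\<lambda>t. nrm (T t z)) \<longlongrightarrow> 0) at_top"
proof -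
  obtain K where K: "K \<ge> 0" "\<And>t z. t \<ge> 0 \<Longrightarrow> z \<in> D \<Longrightarrow> nrm (T t z) \<le> exp (- \<kappa> * t) * (K * nrm z)"
    using bounded_decay by blast
  have bound: "nrm (T t z) \<le> exp (- \<kappa> * t) * (K * nrm z)" if "t \<ge> 0" for t
  proof -
    obtain y where y: "\<And>n::nat. y n \<in> D" "(\<lambda>n. nrm (y n - z)) \<longlonglongrightarrow> 0" using approx assms by blast
    have yS: "y n \<in> S" for n using y D_sub by blast
    have nrm_lim: "(\<lambda>n. nrm (x n)) \<longlonglongrightarrow> nrm u"
      if "(\<lambda>n. nrm (x n - u)) \<longlonglongrightarrow> 0" "\<And>n. x n \<in> S" "u \<in> S" for x :: "nat \<Rightarrow> 'a" and u
      by (subst Lim_null, rule Lim_null_comparison[OF _ that(1)])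
         (simp add: nrm_diff_ineq that)
    have "(\<lambda>n. nrm (T t (y n - z))) \<longlonglongrightarrow> 0"
      by (rule T_tendsto[OF that _ y(2)]) (use yS assms in \<open>auto intro!: always_eventually mem\<close>)
    then have "(\<lambda>n. nrm (T t (y n) - T t z)) \<longlonglongrightarrow> 0"
      using T_diff assms yS that by simp
    then have 1: "(\<lambda>n. nrm (T t (y n))) \<longlonglongrightarrow> nrm (T t z)"
      by (rule nrm_lim) (use yS T_mem assms that in auto)
    have 2: "(\<lambda>n. exp (- \<kappa> * t) * (K * nrm (y n))) \<longlonglongrightarrow> exp (- \<kappa> * t) * (K * nrm z)"
      by (intro tendsto_mult tendsto_const nrm_lim[OF y(2)]) (use yS assms in auto)
    show ?thesis
      by (rule LIMSEQ_le[OF 1 2]) (use K(2)[OF that] y in blast)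
  qed
  have "((\<lambda>t. exp (- \<kappa> * t)) \<longlongrightarrow> 0) at_top"
    using \<kappa> by (intro filterlim_compose[OF exp_at_bot] filterlim_tendsto_neg_mult_at_bot[OF tendsto_const])
      (auto simp: filterlim_ident)
  then have lim: "((\<lambda>t. exp (- \<kappa> * t) * (K * nrm z)) \<longlongrightarrow> 0) at_top"
    by (rule tendsto_mult_left_zero)
  show ?thesis
  proof (rule real_tendsto_sandwich[OF _ _ tendsto_const lim])
    show "\<forall>\<^sub>F t in at_top. 0 \<le> nrm (T t z)" "\<forall>\<^sub>F t in at_top. nrm (T t z) \<le> exp (- \<kappa> * t) * (K * nrm z)"
      using eventually_ge_at_top[of 0] by (eventually_elim, use bound assms T_mem in auto)+
  qed
qed

end

text \<open>As h has integral 0 over every interval, Henstock's lemma bounds the Riemann sums of its norm.\<close>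
lemma negligible_of_null_indefinite_integral:
  fixes h :: "real \<Rightarrow> 'a::euclidean_space"
  assumes int: "h integrable_on {a..b}" and zero: "\<And>x. x \<in> {a..b} \<Longrightarrow> integral {a..x} h = 0"
  shows "negligible {x\<in>{a..b}. h x \<noteq> 0}"
proof -
  \<comment> \<open>By additivity the indefinite integral from a determines the integral over every
    subinterval.\<close>
  have null: "integral K h = 0" if "K \<subseteq> {a..b}" "K \<noteq> {}" "K = cbox c d" for K c d
  proof -
    have "a \<le> c" "c \<le> d" "d \<le> b" using that by auto
    then have "h integrable_on {a..d}" by (intro integrable_on_subinterval[OF int]) auto
    then have "integral {a..c} h + integral {c..d} h = integral {a..d} h"
      using \<open>a \<le> c\<close> \<open>c \<le> d\<close> by (intro Henstock_Kurzweil_Integration.integral_combine)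
    moreover have "integral {a..c} h = 0" "integral {a..d} h = 0"
      using zero \<open>a \<le> c\<close> \<open>c \<le> d\<close> \<open>d \<le> b\<close> by auto
    ultimately show ?thesis by (simp add: \<open>K = cbox c d\<close>)
  qed
  have "((\<lambda>x. norm (h x)) has_integral 0) (cbox a b)"
    unfolding has_integral
  proof (intro allI impI)
    fix e :: real assume "e > 0"
    obtain \<gamma> where \<gamma>: "gauge \<gamma>"
      "\<And>p. p tagged_partial_division_of (cbox a b) \<Longrightarrow> \<gamma> fine p \<Longrightarrow>
        (\<Sum>(x,k)\<in>p. norm (measure lborel k *\<^sub>R h x - integral k h)) < e"
      using Henstock_lemma[of h a b e] int \<open>e > 0\<close> by (auto simp: box_real)
    show "\<exists>\<gamma>. gauge \<gamma> \<and> (\<forall>\<D>. \<D> tagged_division_of cbox a b \<and> \<gamma> fine \<D> \<longrightarrow>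
        norm ((\<Sum>(x, K)\<in>\<D>. measure lborel K *\<^sub>R norm (h x)) - 0) < e)"
    proof (intro exI[of _ \<gamma>] conjI allI impI)
      show "gauge \<gamma>" by (rule \<gamma>(1))
    next
      fix \<D> assume D: "\<D> tagged_division_of cbox a b \<and> \<gamma> fine \<D>"
      have "(\<Sum>(x, K)\<in>\<D>. measure lborel K *\<^sub>R norm (h x)) = (\<Sum>(x,k)\<in>\<D>. norm (measure lborel k *\<^sub>R h x - integral k h))"
      proof (intro sum.cong refl, clarify)
        fix x K assume "(x, K) \<in> \<D>"
        then obtain c d where "K = cbox c d" "x \<in> K" "K \<subseteq> cbox a b"
          using D tagged_division_ofD(2,3,4) by metis
        then have "integral K h = 0" using null[of K c d] by (auto simp: box_real)
        then show "measure lborel K *\<^sub>R norm (h x) = norm (measure lborel K *\<^sub>R h x - integral K h)" by simp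
      qed
      moreover have "0 \<le> (\<Sum>(x,k)\<in>\<D>. norm (measure lborel k *\<^sub>R h x - integral k h))"
        by (intro sum_nonneg) auto
      moreover have "(\<Sum>(x,k)\<in>\<D>. norm (measure lborel k *\<^sub>R h x - integral k h)) < e"
        using \<gamma>(2) D tagged_division_of_def by blast
      ultimately show "norm ((\<Sum>(x, K)\<in>\<D>. measure lborel K *\<^sub>R norm (h x)) - 0) < e" by simp
    qed
  qed
  then have hi: "((\<lambda>x. norm (h x)) has_integral 0) {a..b}" by (simp add: box_real)
  \<comment> \<open>A nonnegative gauge integrable function is Lebesgue integrable, and there a
    vanishing integral forces it to be 0 almost everywhere.\<close>
  then have "set_integrable lebesgue {a..b} (\<lambda>x. norm (h x))"
    by (intro nonnegative_absolutely_integrable_1) (auto simp: integrable_on_def)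
  moreover from this have "set_lebesgue_integral lebesgue {a..b} (\<lambda>x. norm (h x)) = 0"
    using hi set_lebesgue_integral_eq_integral(2) integral_unique by metis
  ultimately have "AE x in lebesgue. indicator {a..b} x *\<^sub>R norm (h x) = 0"
    unfolding set_lebesgue_integral_def set_integrable_def
    by (subst integral_nonneg_eq_0_iff_AE[symmetric]) auto
  then have "AE x in lebesgue. x \<notin> {x\<in>{a..b}. h x \<noteq> 0}"
    by eventually_elim (auto simp: indicator_def)
  then obtain N where "N \<in> null_sets lebesgue" "{x\<in>{a..b}. h x \<noteq> 0} \<subseteq> N"
    by (auto simp: eventually_ae_filter)
  then show ?thesis using negligible_iff_null_sets negligible_subset by blast
qed

section \<open>Square-integrable functions\<close>

text \<open>With the pointwise addition of functions this makes \<open>st\<close>, a product of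
  function types and complex numbers, a real vector space, so that \<open>sadd\<close> and
  \<open>sscale\<close> become its operations.\<close>

instantiation "fun" :: (type, real_vector) real_vector
begin

definition scaleR_fun_def: "r *\<^sub>R f = (\<lambda>x. r *\<^sub>R f x)"

instance
  by standard (auto simp: scaleR_fun_def plus_fun_def algebra_simps)

end

lemma scaleR_fun_apply [simp]: "(c *\<^sub>R f) x = c *\<^sub>R f x"
  by (simp add: scaleR_fun_def)

lemma L2fun_iff:
  "L2fun L g \<longleftrightarrow> g \<in> borel_measurable (lebesgue_on {0..L}) \<and> (\<lambda>x. (cmod (g x))\<^sup>2) integrable_on {0..L}"
  by (simp add: L2fun_def measurable_on_iff_borel_measurable)

lemma L2fun_cong:
  assumes "\<And>x. x \<in> {0..L} \<Longrightarrow> f x = g x"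
  shows "L2fun L f \<longleftrightarrow> L2fun L g"
proof -
  have "f \<in> borel_measurable (lebesgue_on {0..L}) \<longleftrightarrow> g \<in> borel_measurable (lebesgue_on {0..L})"
    by (rule measurable_cong) (use assms in auto)
  moreover have "(\<lambda>x. (cmod (f x))\<^sup>2) integrable_on {0..L} \<longleftrightarrow> (\<lambda>x. (cmod (g x))\<^sup>2) integrable_on {0..L}"
    by (rule integrable_cong) (use assms in auto)
  ultimately show ?thesis by (simp add: L2fun_iff)
qed

lemma L2fun_continuous: "continuous_on {0..L} f \<Longrightarrow> L2fun L f"
  by (auto simp: L2fun_iff intro!: continuous_imp_measurable_on_sets_lebesgue integrable_continuous_real
      continuous_intros)

lemma L2fun_inner_integrable:
  assumes "L2fun L f" "L2fun L g"
  shows "(\<lambda>x. f x \<bullet> g x) integrable_on {0..L}"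
proof (rule measurable_bounded_by_integrable_imp_integrable_real)
  show "(\<lambda>x. f x \<bullet> g x) \<in> borel_measurable (lebesgue_on {0..L})"
    using assms by (auto simp: L2fun_iff intro!: borel_measurable_inner)
  show "(\<lambda>x. (cmod (f x))\<^sup>2 + (cmod (g x))\<^sup>2) integrable_on {0..L}"
    using assms by (auto simp: L2fun_iff intro!: integrable_add)
  fix x
  have "\<bar>f x \<bullet> g x\<bar> \<le> cmod (f x) * cmod (g x)" by (rule Cauchy_Schwarz_ineq2)
  also have "\<dots> \<le> (cmod (f x))\<^sup>2 + (cmod (g x))\<^sup>2"
    using sum_squares_bound[of "cmod (f x)" "cmod (g x)"]
      mult_nonneg_nonneg[OF norm_ge_zero[of "f x"] norm_ge_zero[of "g x"]] by linarith
  finally show "\<bar>f x \<bullet> g x\<bar> \<le> (cmod (f x))\<^sup>2 + (cmod (g x))\<^sup>2" .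
qed auto

lemma L2fun_add:
  assumes "L2fun L f" "L2fun L g"
  shows "L2fun L (\<lambda>x. f x + g x)"
proof -
  have "(\<lambda>x. f x \<bullet> f x + 2 * (f x \<bullet> g x) + g x \<bullet> g x) integrable_on {0..L}"
    using L2fun_inner_integrable assms by (intro integrable_add integrable_on_mult_right) auto
  then have "(\<lambda>x. (cmod (f x + g x))\<^sup>2) integrable_on {0..L}"
    by (rule integrable_eq) (simp add: power2_norm_eq_inner inner_simps inner_commute)
  then show ?thesis using assms by (auto simp: L2fun_iff)
qed

lemma L2fun_scaleR: "L2fun L f \<Longrightarrow> L2fun L (\<lambda>x. c *\<^sub>R f x)"
  by (auto simp: L2fun_iff power_mult_distrib intro!: integrable_on_mult_right)

lemma L2fun_subspace: "subspace {f. L2fun L f}"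
  by (auto simp: subspace_def zero_fun_def plus_fun_def scaleR_fun_def L2fun_continuous L2fun_add L2fun_scaleR)

lemma L2fun_integrable:
  assumes "L2fun L f"
  shows "f absolutely_integrable_on {0..L}"
proof (rule measurable_bounded_by_integrable_imp_absolutely_integrable)
  show "(\<lambda>x. 1 + (cmod (f x))\<^sup>2) integrable_on {0..L}"
    using assms by (intro integrable_add integrable_const_ivl) (simp add: L2fun_iff)
  show "cmod (f x) \<le> 1 + (cmod (f x))\<^sup>2" for x
    using sum_squares_bound[of "cmod (f x)" 1] norm_ge_zero[of "f x"] unfolding one_power2 by linarith
qed (use assms in \<open>auto simp: L2fun_iff\<close>)

definition ip :: "real \<Rightarrow> (real \<Rightarrow> complex) \<Rightarrow> (real \<Rightarrow> complex) \<Rightarrow> real" where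
  "ip L f g = integral {0..L} (\<lambda>x. f x \<bullet> g x)"

lemma ip_cong:
  assumes "\<And>x. x \<in> {0..L} \<Longrightarrow> f x = f' x" "\<And>x. x \<in> {0..L} \<Longrightarrow> g x = g' x"
  shows "ip L f g = ip L f' g'"
  unfolding ip_def by (rule integral_cong) (use assms in auto)

text \<open>Functions are not identified almost everywhere, so this form is only semidefinite;
  \<open>semi_inner\<close> is tailored to that.\<close>

interpretation L2: semi_inner "{f. L2fun L f}" "ip L" for L
proof
  show "subspace {f. L2fun L f}" by (rule L2fun_subspace)
  fix f g h c assume f: "f \<in> {f. L2fun L f}"
  show "0 \<le> ip L f f" unfolding ip_def by (rule integral_nonneg) (use f L2fun_inner_integrable in auto)
  assume h: "h \<in> {f. L2fun L f}"
  show "ip L f h = ip L h f" by (simp add: ip_def inner_commute)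
  show "ip L (c *\<^sub>R f) h = c * ip L f h"
    by (simp add: ip_def scaleR_fun_def)
  assume g: "g \<in> {f. L2fun L f}"
  show "ip L (f + g) h = ip L f h + ip L g h"
    unfolding ip_def plus_fun_def inner_add_left
    by (rule integral_add) (use f g h L2fun_inner_integrable in auto)
qed

lemma ip_self: "ip L f f = integral {0..L} (\<lambda>x. (cmod (f x))\<^sup>2)"
  by (simp add: ip_def power2_norm_eq_inner)

text \<open>Equal indefinite integrals force equality off a null set, so \<open>ip\<close> cannot
  tell two weak derivatives of the same function apart.\<close>

lemma ip_ae_cong:
  assumes "L2fun L f" "L2fun L g" and eq: "\<And>x. x \<in> {0..L} \<Longrightarrow> integral {0..x} f = integral {0..x} g"
  shows "ip L f h = ip L g h" "ip L h f = ip L h g"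
proof -
  have "f integrable_on {0..L}" "g integrable_on {0..L}"
    using assms L2fun_integrable set_lebesgue_integral_eq_integral(1) by blast+
  then have neg: "negligible {x\<in>{0..L}. f x - g x \<noteq> 0}"
    using eq
    by (intro negligible_of_null_indefinite_integral integrable_diff)
       (auto simp: Henstock_Kurzweil_Integration.integral_diff integrable_on_subinterval[of _ "{0..L}"])
  show "ip L f h = ip L g h" "ip L h f = ip L h g"
    unfolding ip_def by (rule integral_spike[OF neg]; simp)+
qed

lemma L2fun_mono:
  assumes "L2fun L f" "x \<le> L"
  shows "L2fun x f" "ip x f f \<le> ip L f f"
proof -
  have sub: "{0..x} \<subseteq> {0..L}" using assms by auto
  have f: "f \<in> borel_measurable (lebesgue_on {0..L})" "(\<lambda>x. (cmod (f x))\<^sup>2) integrable_on {0..L}"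
    using assms by (auto simp: L2fun_iff)
  have int: "(\<lambda>x. (cmod (f x))\<^sup>2) integrable_on {0..x}"
    by (rule integrable_on_subinterval[OF f(2) sub])
  with measurable_restrict_mono[OF f(1) sub] show "L2fun x f" by (simp add: L2fun_iff)
  show "ip x f f \<le> ip L f f"
    unfolding ip_self by (rule integral_subset_le[OF sub int f(2)]) simp
qed

text \<open>Cauchy-Schwarz on {0..x} against the constant function c whose value is the integral
  itself: the inner product is |c|^2, and one factor |c|^2 is cancelled at the end. Enlarging x to L
  makes the bound uniform in x.\<close>

lemma integral_norm_square_le:
  assumes "L2fun L f" "x \<in> {0..L}"
  shows "(cmod (integral {0..x} f))\<^sup>2 \<le> L * ip L f f"
proof -
  define c where "c = integral {0..x} f"
  have f: "L2fun x f" "ip x f f \<le> ip L f f" using L2fun_mono assms by auto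
  have k: "L2fun x (\<lambda>_. c)" by (intro L2fun_continuous continuous_intros)
  have intf: "f integrable_on {0..x}"
    using L2fun_integrable[OF f(1)] set_lebesgue_integral_eq_integral(1) by blast
  have 1: "ip x f (\<lambda>_. c) = (cmod c)\<^sup>2"
    using integral_linear[OF intf bounded_linear_inner_left[of c]]
    by (simp add: ip_def o_def c_def power2_norm_eq_inner)
  have 2: "ip x (\<lambda>_. c) (\<lambda>_. c) = x * (cmod c)\<^sup>2"
    using assms by (simp add: ip_self)
  have "((cmod c)\<^sup>2)\<^sup>2 \<le> (L2.nrm x f * L2.nrm x (\<lambda>_. c))\<^sup>2"
    using L2.Cauchy_Schwarz[of f x "\<lambda>_. c"] f k 1 by (intro power_mono) auto
  also have "\<dots> = ip x f f * (x * (cmod c)\<^sup>2)"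
    using f k 2 by (simp add: power_mult_distrib L2.nrm_sq)
  also have "\<dots> \<le> ip L f f * (L * (cmod c)\<^sup>2)"
    using f(2) assms L2.nonneg[of f L] by (intro mult_mono mult_right_mono) auto
  finally have *: "(cmod c)\<^sup>2 * (cmod c)\<^sup>2 \<le> (L * ip L f f) * (cmod c)\<^sup>2"
    by (simp add: power2_eq_square mult_ac)
  have nn: "0 \<le> L * ip L f f" using assms L2.nonneg[of f L] by (intro mult_nonneg_nonneg) auto
  show ?thesis
  proof (cases "c = 0")
    case True
    then show ?thesis using nn by (simp add: c_def[symmetric])
  next
    case False
    then show ?thesis using mult_right_le_imp_le[OF *] by (simp add: c_def[symmetric])
  qed
qed

section \<open>Sobolev functions\<close>

lemma Sob_L2fun: "f \<in> Sob k L \<Longrightarrow> L2fun L f"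
  by (cases k) auto

lemma Sob_SucI:
  "L2fun L f \<Longrightarrow> g \<in> Sob k L \<Longrightarrow> (\<And>x. x \<in> {0..L} \<Longrightarrow> f x = f 0 + integral {0..x} g) \<Longrightarrow> f \<in> Sob (Suc k) L"
  by (simp only: Sob.simps) blast

lemma Sob_SucE:
  assumes "f \<in> Sob (Suc k) L"
  obtains g where "L2fun L f" "g \<in> Sob k L" "\<forall>x\<in>{0..L}. f x = f 0 + integral {0..x} g"
  using assms by (simp only: Sob.simps) blast

lemma Sob_cong:
  assumes "\<And>x. x \<in> {0..L} \<Longrightarrow> f x = g x" "L > 0"
  shows "f \<in> Sob k L \<longleftrightarrow> g \<in> Sob k L"
proof (cases k)
  case 0
  then show ?thesis using L2fun_cong[OF assms(1)] by simp
next
  case (Suc n)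
  have "(\<forall>x\<in>{0..L}. f x = f 0 + integral {0..x} h) \<longleftrightarrow> (\<forall>x\<in>{0..L}. g x = g 0 + integral {0..x} h)" for h
    using assms by auto
  then show ?thesis using L2fun_cong[OF assms(1)] by (simp add: Suc)
qed

lemma Sob_subspace: "subspace (Sob k L)"
proof (induction k)
  case 0
  then show ?case using L2fun_subspace[of L] by simp
next
  case (Suc k)
  show ?case
    unfolding subspace_def
  proof (intro conjI ballI allI)
    show "0 \<in> Sob (Suc k) L"
      by (rule Sob_SucI[OF _ subspace_0[OF Suc]]) (auto simp: zero_fun_def intro!: L2fun_continuous)
  next
    fix f g assume "f \<in> Sob (Suc k) L" "g \<in> Sob (Suc k) L"
    then obtain f' g' where *: "L2fun L f" "L2fun L g" "f' \<in> Sob k L" "g' \<in> Sob k L"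
      "\<And>x. x \<in> {0..L} \<Longrightarrow> f x = f 0 + integral {0..x} f'"
      "\<And>x. x \<in> {0..L} \<Longrightarrow> g x = g 0 + integral {0..x} g'" by (elim Sob_SucE) blast
    have int: "h integrable_on {0..x}" if "x \<in> {0..L}" "L2fun L h" for x and h :: "real \<Rightarrow> complex"
      using L2fun_integrable[OF L2fun_mono(1)[OF that(2)], of x] that(1)
        set_lebesgue_integral_eq_integral(1) by auto
    show "f + g \<in> Sob (Suc k) L"
    proof (rule Sob_SucI)
      show "L2fun L (f + g)" using L2fun_add * by (simp add: plus_fun_def)
      show "f' + g' \<in> Sob k L" using subspace_add[OF Suc] * by blast
      fix x assume x: "x \<in> {0..L}"
      show "(f + g) x = (f + g) 0 + integral {0..x} (f' + g')"
        unfolding plus_fun_def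
          Henstock_Kurzweil_Integration.integral_add[OF int[OF x Sob_L2fun[OF *(3)]] int[OF x Sob_L2fun[OF *(4)]]]
        using *(5)[OF x] *(6)[OF x] by simp
    qed
  next
    fix f c assume "f \<in> Sob (Suc k) L"
    then obtain f' where *: "L2fun L f" "f' \<in> Sob k L"
      "\<And>x. x \<in> {0..L} \<Longrightarrow> f x = f 0 + integral {0..x} f'" by (elim Sob_SucE) blast
    show "c *\<^sub>R f \<in> Sob (Suc k) L"
    proof (rule Sob_SucI)
      show "L2fun L (c *\<^sub>R f)" using L2fun_scaleR * by (simp add: scaleR_fun_def)
      show "c *\<^sub>R f' \<in> Sob k L" using subspace_scale[OF Suc] * by blast
      fix x assume x: "x \<in> {0..L}"
      show "(c *\<^sub>R f) x = (c *\<^sub>R f) 0 + integral {0..x} (c *\<^sub>R f')"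
        unfolding scaleR_fun_def integral_cmul *(3)[OF x] scaleR_add_right by simp
    qed
  qed
qed

lemma Sob_I:
  assumes "L > 0" "\<And>x. x \<in> {0..L} \<Longrightarrow> (f has_vector_derivative f' x) (at x within {0..L})" "f' \<in> Sob k L"
  shows "f \<in> Sob (Suc k) L"
proof -
  have "continuous_on {0..L} f"
    using assms(2) has_vector_derivative_continuous unfolding continuous_on_eq_continuous_within by blast
  moreover have "f x = f 0 + integral {0..x} f'" if "x \<in> {0..L}" for x
  proof -
    have "(f' has_integral (f x - f 0)) {0..x}"
      by (rule fundamental_theorem_of_calculus)
         (use that in auto, rule has_vector_derivative_within_subset[OF assms(2)], use that in auto)
    then show ?thesis by (simp add: integral_unique)
  qed
  ultimately show ?thesis using assms(3) by (intro Sob_SucI L2fun_continuous)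
qed

lemma Sob_indefinite:
  assumes "L > 0" "g \<in> Sob k L"
  shows "(\<lambda>x. c + integral {0..x} g) \<in> Sob (Suc k) L"
proof -
  have "g integrable_on {0..L}"
    using L2fun_integrable[OF Sob_L2fun[OF assms(2)]] set_lebesgue_integral_eq_integral(1) by blast
  then have "continuous_on {0..L} (\<lambda>x. c + integral {0..x} g)"
    by (intro continuous_intros indefinite_integral_continuous_1)
  then show ?thesis using assms by (intro Sob_SucI[of L _ g] L2fun_continuous) auto
qed

lemma wderiv_Sob: "f \<in> Sob (Suc k) L \<Longrightarrow> wderiv k L f \<in> Sob k L"
  and wderiv_integral: "f \<in> Sob (Suc k) L \<Longrightarrow> x \<in> {0..L} \<Longrightarrow> f x = f 0 + integral {0..x} (wderiv k L f)"
proof -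
  let ?P = "\<lambda>g. g \<in> Sob k L \<and> (\<forall>x\<in>{0..L}. f x = f 0 + integral {0..x} g)"
  have "?P (wderiv k L f)" if f: "f \<in> Sob (Suc k) L"
  proof -
    from f obtain g where "L2fun L f" "g \<in> Sob k L" "\<forall>x\<in>{0..L}. f x = f 0 + integral {0..x} g"
      by (rule Sob_SucE)
    then have "\<exists>g. ?P g" by (intro exI[of _ g] conjI)
    then show ?thesis unfolding wderiv_def by (rule someI_ex[of ?P])
  qed
  then show "f \<in> Sob (Suc k) L \<Longrightarrow> wderiv k L f \<in> Sob k L"
    "f \<in> Sob (Suc k) L \<Longrightarrow> x \<in> {0..L} \<Longrightarrow> f x = f 0 + integral {0..x} (wderiv k L f)" by blast+
qed

text \<open>This is equality everywhere, although weak derivatives are unique only up to null sets: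
  both sides choose from the same predicate.\<close>

lemma wderiv_cong:
  assumes "\<And>x. x \<in> {0..L} \<Longrightarrow> f x = g x" "L > 0"
  shows "wderiv k L f = wderiv k L g"
proof -
  have "(\<forall>x\<in>{0..L}. f x = f 0 + integral {0..x} h) \<longleftrightarrow> (\<forall>x\<in>{0..L}. g x = g 0 + integral {0..x} h)" for h
    using assms by auto
  then show ?thesis unfolding wderiv_def by simp
qed

lemma Sob_Suc_continuous: "f \<in> Sob (Suc k) L \<Longrightarrow> continuous_on {0..L} f"
proof -
  assume f: "f \<in> Sob (Suc k) L"
  have "wderiv k L f integrable_on {0..L}"
    using L2fun_integrable[OF Sob_L2fun[OF wderiv_Sob[OF f]]] set_lebesgue_integral_eq_integral(1) by blast
  then have "continuous_on {0..L} (\<lambda>x. f 0 + integral {0..x} (wderiv k L f))"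
    by (intro continuous_intros indefinite_integral_continuous_1)
  then show ?thesis by (rule continuous_on_eq) (rule wderiv_integral[OF f, symmetric])
qed

lemma dv_eq:
  assumes "(f has_vector_derivative f') (at x within {0..L})" "x \<in> {0..L}" "L > 0"
  shows "dv L f x = f'"
  unfolding dv_def by (rule vector_derivative_within_closed_interval) (use assms in auto)

text \<open>The weak derivative of an H^(k+2) function lies in H^(k+1) and is therefore continuous,
  so it is the classical derivative, one-sided at 0 and L.\<close>

lemma Sob_Suc_Suc:
  assumes "f \<in> Sob (Suc (Suc k)) L" "x \<in> {0..L}" "L > 0"
  shows "(f has_vector_derivative dv L f x) (at x within {0..L})" "dv L f x = wderiv (Suc k) L f x"
proof -
  have "((\<lambda>u. integral {0..u} (wderiv (Suc k) L f)) has_vector_derivative wderiv (Suc k) L f x) (at x within {0..L})"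
    by (rule integral_has_vector_derivative[OF Sob_Suc_continuous[OF wderiv_Sob[OF assms(1)]] assms(2)])
  then have "((\<lambda>u. f 0 + integral {0..u} (wderiv (Suc k) L f)) has_vector_derivative wderiv (Suc k) L f x) (at x within {0..L})"
    by (auto intro!: derivative_eq_intros)
  then have *: "(f has_vector_derivative wderiv (Suc k) L f x) (at x within {0..L})"
    by (rule has_vector_derivative_transform[rotated 2, OF _ assms(2) wderiv_integral[OF assms(1)]])
  then show "dv L f x = wderiv (Suc k) L f x" using dv_eq assms by blast
  with * show "(f has_vector_derivative dv L f x) (at x within {0..L})" by simp
qed

lemma dv_Sob: "f \<in> Sob (Suc (Suc k)) L \<Longrightarrow> L > 0 \<Longrightarrow> dv L f \<in> Sob (Suc k) L"
  using Sob_cong[of L "dv L f" "wderiv (Suc k) L f"] Sob_Suc_Suc(2) wderiv_Sob by blast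

lemma Sob_Suc_subset: "L > 0 \<Longrightarrow> Sob (Suc k) L \<subseteq> Sob k L"
proof (induction k)
  case (Suc k)
  show ?case
  proof
    fix f assume "f \<in> Sob (Suc (Suc k)) L"
    then obtain g where "L2fun L f" "g \<in> Sob (Suc k) L"
      "\<forall>x\<in>{0..L}. f x = f 0 + integral {0..x} g" by (rule Sob_SucE)
    then show "f \<in> Sob (Suc k) L"
      using subsetD[OF Suc.IH[OF Suc.prems], of g] by (intro Sob_SucI[of L f g k]) blast+
  qed
qed auto

section \<open>Density of smooth functions\<close>

lemma L2_tendsto_0:
  assumes meas: "\<And>n. L2fun L (f n)" and dom: "h integrable_on {0..L}"
    and le: "\<And>n x. x \<in> {0..L} \<Longrightarrow> (cmod (f n x))\<^sup>2 \<le> h x"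
    and neg: "negligible N"
    and lim: "\<And>x. x \<in> {0..L} \<Longrightarrow> x \<notin> N \<Longrightarrow> (\<lambda>n. f n x) \<longlonglongrightarrow> 0"
  shows "(\<lambda>n. ip L (f n) (f n)) \<longlonglongrightarrow> 0"
proof -
  have eq: "ip L (f n) (f n) = integral ({0..L} - N) (\<lambda>x. (cmod (f n x))\<^sup>2)" for n
    unfolding ip_self
    by (rule integral_spike_set) (auto intro!: negligible_subset[OF neg])
  have int: "g integrable_on ({0..L} - N) \<longleftrightarrow> g integrable_on {0..L}" for g :: "real \<Rightarrow> real"
    by (rule integrable_spike_set_eq) (auto intro!: negligible_subset[OF neg])
  have "(\<lambda>n. integral ({0..L} - N) (\<lambda>x. (cmod (f n x))\<^sup>2)) \<longlonglongrightarrow> integral ({0..L} - N) (\<lambda>x. 0)"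
  proof (rule dominated_convergence(2))
    show "(\<lambda>x. (cmod (f n x))\<^sup>2) integrable_on {0..L} - N" for n
      using meas[of n] by (simp add: int L2fun_iff)
    show "h integrable_on {0..L} - N" using dom by (simp add: int)
    show "norm ((cmod (f n x))\<^sup>2) \<le> h x" if "x \<in> {0..L} - N" for n x using that le by simp
    show "(\<lambda>n. (cmod (f n x))\<^sup>2) \<longlonglongrightarrow> 0" if "x \<in> {0..L} - N" for x
      using tendsto_power[OF tendsto_norm_zero[OF lim], of x 2] that by simp
  qed
  then show ?thesis by (simp add: eq)
qed

lemma cmod_diff_square: "(cmod (x - y))\<^sup>2 \<le> 2 * (cmod x)\<^sup>2 + 2 * (cmod y)\<^sup>2"
proof -
  have "(cmod (x - y))\<^sup>2 \<le> (cmod x + cmod y)\<^sup>2" by (intro power_mono norm_triangle_ineq4) simp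
  also have "\<dots> \<le> 2 * (cmod x)\<^sup>2 + 2 * (cmod y)\<^sup>2"
    using sum_squares_bound[of "cmod x" "cmod y"] by (simp add: power2_sum)
  finally show ?thesis .
qed

lemma cmod_add_square: "(cmod (x + y))\<^sup>2 \<le> 2 * (cmod x)\<^sup>2 + 2 * (cmod y)\<^sup>2"
  using cmod_diff_square[of x "- y"] by simp

lemma inner_le_squares: "2 * \<bar>x \<bullet> y\<bar> \<le> (cmod x)\<^sup>2 + (cmod y)\<^sup>2"
  using Cauchy_Schwarz_ineq2[of x y] sum_squares_bound[of "cmod x" "cmod y"] by linarith

text \<open>The radial projection onto the disc of radius m; the maximum in the denominator keeps
  the formula continuous at 0.\<close>

definition clamp_norm :: "real \<Rightarrow> complex \<Rightarrow> complex" where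
  "clamp_norm m z = (m / max m (cmod z)) *\<^sub>R z"

lemma clamp_norm:
  assumes "m > 0"
  shows "cmod (clamp_norm m z) \<le> m" "cmod (clamp_norm m z) \<le> cmod z" "cmod z \<le> m \<Longrightarrow> clamp_norm m z = z"
    "continuous_on UNIV (clamp_norm m)"
proof -
  have pos: "max m (cmod z) > 0" for z using assms by auto
  show "cmod (clamp_norm m z) \<le> m" "cmod (clamp_norm m z) \<le> cmod z"
  proof -
    have "cmod (clamp_norm m z) = m * (cmod z / max m (cmod z))"
      using assms pos[of z] by (simp add: clamp_norm_def)
    also have "\<dots> \<le> m * 1" using assms pos[of z] by (intro mult_left_mono) simp_all
    finally show "cmod (clamp_norm m z) \<le> m" by simp
    have "cmod (clamp_norm m z) = m / max m (cmod z) * cmod z"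
      using assms pos[of z] by (simp add: clamp_norm_def)
    also have "\<dots> \<le> 1 * cmod z" using assms pos[of z] by (intro mult_right_mono) simp_all
    finally show "cmod (clamp_norm m z) \<le> cmod z" by simp
  qed
  show "cmod z \<le> m \<Longrightarrow> clamp_norm m z = z" using assms by (simp add: clamp_norm_def max_def)
  show "continuous_on UNIV (clamp_norm m)"
    unfolding clamp_norm_def by (intro continuous_intros) (simp add: less_imp_neq[OF pos, symmetric])
qed

text \<open>First f is replaced by a bounded truncation, then the truncation by truncated continuous
  functions; both limits are instances of dominated convergence.\<close>

lemma L2_dense_continuous:
  assumes f: "L2fun L f" and "e > 0"
  obtains g where "continuous_on UNIV g" "L2.nrm L (f - g) < e"
proof -
  have small: "\<exists>n. L2.nrm L (u n) < e / 2" if "(\<lambda>n. ip L (u n) (u n)) \<longlonglongrightarrow> 0" for u :: "nat \<Rightarrow> real \<Rightarrow> complex"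
  proof -
    have "(\<lambda>n. L2.nrm L (u n)) \<longlonglongrightarrow> 0"
      unfolding L2.nrm_def using tendsto_real_sqrt[OF that] by simp
    then have "\<forall>\<^sub>F n in sequentially. L2.nrm L (u n) < e / 2"
      by (rule order_tendstoD) (use \<open>e > 0\<close> in simp)
    then show ?thesis by (rule eventually_happens'[OF sequentially_bot])
  qed
  have Suc_pos: "0 < real (Suc n)" for n by simp
  have L2_clamp: "L2fun L (\<lambda>x. clamp_norm m (u x))" if "L2fun L u" "m > 0" for u m
    unfolding L2fun_iff
  proof
    show *: "(\<lambda>x. clamp_norm m (u x)) \<in> borel_measurable (lebesgue_on {0..L})"
      by (rule measurable_compose[of u _ borel])
         (use that clamp_norm(4) in \<open>auto simp: L2fun_iff borel_measurable_continuous_onI\<close>)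
    show "(\<lambda>x. (cmod (clamp_norm m (u x)))\<^sup>2) integrable_on {0..L}"
    proof (rule measurable_bounded_by_integrable_imp_integrable)
      show "(\<lambda>x. (cmod (clamp_norm m (u x)))\<^sup>2) \<in> borel_measurable (lebesgue_on {0..L})"
        using * by measurable
      show "(\<lambda>x. (cmod (u x))\<^sup>2) integrable_on {0..L}" using that by (simp add: L2fun_iff)
    qed (use clamp_norm(2)[OF that(2)] in \<open>auto intro: power_mono\<close>)
  qed
  have mem: "u - v \<in> {f. L2fun L f}" if "L2fun L u" "L2fun L v" for u v
    using that L2.mem(3)[of u L v] by simp
  have "(\<lambda>n. ip L (f - (\<lambda>x. clamp_norm (real (Suc n)) (f x))) (f - (\<lambda>x. clamp_norm (real (Suc n)) (f x)))) \<longlonglongrightarrow> 0"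
  proof (rule L2_tendsto_0[where h = "\<lambda>x. 4 * (cmod (f x))\<^sup>2" and N = "{}"])
    show "L2fun L (f - (\<lambda>x. clamp_norm (real (Suc n)) (f x)))" for n
      using mem[OF f L2_clamp[OF f]] by simp
    show "(\<lambda>x. 4 * (cmod (f x))\<^sup>2) integrable_on {0..L}"
      using f by (auto simp: L2fun_iff intro!: integrable_on_mult_right)
    show "(cmod ((f - (\<lambda>x. clamp_norm (real (Suc n)) (f x))) x))\<^sup>2 \<le> 4 * (cmod (f x))\<^sup>2" for n x
      using cmod_diff_square[of "f x" "clamp_norm (real (Suc n)) (f x)"]
        power_mono[OF clamp_norm(2)[OF Suc_pos, of n "f x"] norm_ge_zero, of 2]
      unfolding fun_diff_def by linarith
    show "(\<lambda>n. (f - (\<lambda>x. clamp_norm (real (Suc n)) (f x))) x) \<longlonglongrightarrow> 0" for x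
    proof (rule tendsto_eventually)
      obtain n0 :: nat where "cmod (f x) \<le> real n0" using real_arch_simple[of "cmod (f x)"] by (rule exE)
      then have "cmod (f x) \<le> real (Suc n)" if "n \<ge> n0" for n
        by (rule order_trans) (use that in simp)
      then have "\<forall>n\<ge>n0. clamp_norm (real (Suc n)) (f x) = f x"
        by (intro allI impI clamp_norm(3)[OF Suc_pos])
      then show "\<forall>\<^sub>F n in sequentially. (f - (\<lambda>x. clamp_norm (real (Suc n)) (f x))) x = 0"
        unfolding eventually_sequentially by (intro exI[of _ n0]) simp
    qed
  qed simp
  then obtain n where n: "L2.nrm L (f - (\<lambda>x. clamp_norm (real (Suc n)) (f x))) < e / 2"
    using small[of "\<lambda>n. f - (\<lambda>x. clamp_norm (real (Suc n)) (f x))"] by metis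
  define m where "m = real (Suc n)"
  have "m > 0" by (simp add: m_def)
  \<comment> \<open>Measurability supplies continuous functions that converge to f off N, but
    without a common bound; clamping them at m provides the dominating constant.\<close>
  obtain N g where N: "negligible N" and g: "\<And>n. continuous_on UNIV (g n)"
    and gf: "\<And>x. x \<notin> N \<Longrightarrow> (\<lambda>n. g n x) \<longlonglongrightarrow> (if x \<in> {0..L} then f x else 0)"
    using f unfolding L2fun_def measurable_on_def by blast
  define h where "h n = (\<lambda>x. clamp_norm m (g n x))" for n
  have h: "continuous_on UNIV (h n)" for n
    unfolding h_def by (rule continuous_on_compose2[OF clamp_norm(4)[OF \<open>m > 0\<close>] g]) auto
  then have hL: "L2fun L (h n)" for n by (intro L2fun_continuous continuous_on_subset[OF h]) simp
  have "(\<lambda>n. ip L ((\<lambda>x. clamp_norm m (f x)) - h n) ((\<lambda>x. clamp_norm m (f x)) - h n)) \<longlonglongrightarrow> 0"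
  proof (rule L2_tendsto_0[OF _ _ _ N, where h = "\<lambda>x. 4 * m\<^sup>2"])
    show "L2fun L ((\<lambda>x. clamp_norm m (f x)) - h n)" for n
      using mem[OF L2_clamp[OF f \<open>m > 0\<close>] hL] by simp
    show "(cmod (((\<lambda>x. clamp_norm m (f x)) - h n) x))\<^sup>2 \<le> 4 * m\<^sup>2" for n x
      using cmod_diff_square[of "clamp_norm m (f x)" "h n x"]
        power_mono[OF clamp_norm(1)[OF \<open>m > 0\<close>, of "f x"] norm_ge_zero, of 2]
        power_mono[OF clamp_norm(1)[OF \<open>m > 0\<close>, of "g n x"] norm_ge_zero, of 2]
      unfolding fun_diff_def h_def by linarith
    show "(\<lambda>n. ((\<lambda>x. clamp_norm m (f x)) - h n) x) \<longlonglongrightarrow> 0" if "x \<in> {0..L}" "x \<notin> N" for x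
    proof -
      have "(\<lambda>n. g n x) \<longlonglongrightarrow> f x" using gf[OF that(2)] that(1) by simp
      then have "(\<lambda>n. h n x) \<longlonglongrightarrow> clamp_norm m (f x)"
        unfolding h_def by (intro continuous_on_tendsto_compose[OF clamp_norm(4)[OF \<open>m > 0\<close>]]) auto
      then have "(\<lambda>n. clamp_norm m (f x) - h n x) \<longlonglongrightarrow> clamp_norm m (f x) - clamp_norm m (f x)"
        by (intro tendsto_diff tendsto_const)
      then show ?thesis by simp
    qed
  qed (rule integrable_const_ivl)
  then obtain n' where n': "L2.nrm L ((\<lambda>x. clamp_norm m (f x)) - h n') < e / 2"
    using small[of "\<lambda>n. (\<lambda>x. clamp_norm m (f x)) - h n"] by metis
  have "L2.nrm L (f - h n') \<le> L2.nrm L (f - (\<lambda>x. clamp_norm m (f x))) + L2.nrm L ((\<lambda>x. clamp_norm m (f x)) - h n')"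
    by (rule L2.nrm_triangle) (use f hL L2_clamp \<open>m > 0\<close> in auto)
  also have "\<dots> < e" using n n' by (simp add: m_def)
  finally show ?thesis using that h by blast
qed

lemma L2_nrm_le:
  assumes "L \<ge> 0" "\<And>x. x \<in> {0..L} \<Longrightarrow> cmod (f x) \<le> c" "L2fun L f" "c \<ge> 0"
  shows "L2.nrm L f \<le> sqrt L * c"
proof -
  have "ip L f f \<le> integral {0..L} (\<lambda>x. c\<^sup>2)"
    unfolding ip_self by (rule integral_le) (use assms in \<open>auto simp: L2fun_iff intro: power_mono\<close>)
  then have "ip L f f \<le> L * c\<^sup>2" using assms by simp
  then have "sqrt (ip L f f) \<le> sqrt (L * c\<^sup>2)" by (rule real_sqrt_le_mono)
  then show ?thesis using assms(4) by (simp add: L2.nrm_def real_sqrt_mult)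
qed

text \<open>The value at an endpoint can be prescribed by adding a multiple of a high power of the distance
  to the other endpoint, whose L2 norm is small.\<close>
lemma L2_dense_Sob1:
  assumes f: "L2fun L f" and "e > 0" "L > 0" and y: "y = 0 \<or> y = L"
  obtains g where "g \<in> Sob 1 L" "g y = \<alpha>" "L2.nrm L (f - g) < e"
proof -
  obtain g where g: "continuous_on UNIV g" "L2.nrm L (f - g) < e / 3"
    using L2_dense_continuous[OF f, of "e / 3"] \<open>e > 0\<close> by auto
  \<comment> \<open>sqrt L * c is e / 4, less than the third of e allotted to the polynomial
    approximation.\<close>
  define c where "c = e / (4 * sqrt L)"
  have c: "c > 0" "sqrt L * c < e / 3" using \<open>e > 0\<close> \<open>L > 0\<close> by (simp_all add: c_def)
  have gc: "continuous_on {0..L} g" using g(1) continuous_on_subset by blast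
  then obtain p where p: "polynomial_function p" "\<And>x. x \<in> {0..L} \<Longrightarrow> cmod (g x - p x) < c"
    using Stone_Weierstrass_polynomial_function[of "{0..L}" g c] c(1) by auto
  obtain p' where p': "polynomial_function p'" "\<And>x. (p has_vector_derivative p' x) (at x)"
    using has_vector_derivative_polynomial_function[OF p(1)] by blast
  define q where "q n x = (1 - \<bar>x - y\<bar> / L) ^ n *\<^sub>R (\<alpha> - p y)" for n x
  have "(\<lambda>n. ip L (q n) (q n)) \<longlonglongrightarrow> 0"
  proof (rule L2_tendsto_0[where h = "\<lambda>x. (cmod (\<alpha> - p y))\<^sup>2" and N = "{y}"])
    have r: "0 \<le> 1 - \<bar>x - y\<bar> / L" "1 - \<bar>x - y\<bar> / L \<le> 1" if "x \<in> {0..L}" for x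
      using that y \<open>L > 0\<close> by (auto simp: field_simps)
    show "L2fun L (q n)" for n
      unfolding q_def by (intro L2fun_continuous continuous_intros) (use \<open>L > 0\<close> in auto)
    show "(cmod (q n x))\<^sup>2 \<le> (cmod (\<alpha> - p y))\<^sup>2" if "x \<in> {0..L}" for n x
      using r[OF that] power_le_one[OF r[OF that], of n]
      by (intro power_mono) (auto simp: q_def intro!: mult_left_le_one_le)
    show "(\<lambda>n. q n x) \<longlonglongrightarrow> 0" if "x \<in> {0..L}" "x \<notin> {y}" for x
    proof -
      have "1 - \<bar>x - y\<bar> / L < 1" using that \<open>L > 0\<close> by simp
      then have "(\<lambda>n. (1 - \<bar>x - y\<bar> / L) ^ n) \<longlonglongrightarrow> 0" using r[OF that(1)] by (intro LIMSEQ_realpow_zero)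
      from tendsto_scaleR[OF this tendsto_const] show ?thesis by (simp add: q_def)
    qed
  qed (auto intro: integrable_const_ivl)
  then have "(\<lambda>n. L2.nrm L (q n)) \<longlonglongrightarrow> 0"
    unfolding L2.nrm_def using tendsto_real_sqrt by fastforce
  then have "\<forall>\<^sub>F n in sequentially. L2.nrm L (q n) < e / 3"
    by (rule order_tendstoD) (use \<open>e > 0\<close> in simp)
  then obtain n where n: "L2.nrm L (q n) < e / 3"
    using eventually_happens'[OF sequentially_bot] by blast
  \<comment> \<open>On {0..L} this is the base of the power in \<open>q\<close>, freed of the
    absolute value because y is an endpoint; being affine it can be differentiated.\<close>
  define r where "r x = (if y = 0 then (1 - x / L) else x / L)" for x
  have rq: "q n x = r x ^ n *\<^sub>R (\<alpha> - p y)" if "x \<in> {0..L}" for x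
    using that y \<open>L > 0\<close> by (auto simp: q_def r_def field_simps)
  have p'c: "continuous_on {0..L} p'" by (rule continuous_on_polymonial_function[OF p'(1)])
  have "((\<lambda>x. p x + r x ^ n *\<^sub>R (\<alpha> - p y)) has_vector_derivative
      p' x + (real n * r x ^ (n - 1) * (if y = 0 then - 1 / L else 1 / L)) *\<^sub>R (\<alpha> - p y)) (at x within {0..L})" for x
    unfolding r_def
    using \<open>L > 0\<close> by (cases "y = 0") (auto intro!: derivative_eq_intros has_vector_derivative_at_within[OF p'(2)] simp: has_real_derivative_iff_has_vector_derivative[symmetric])
  moreover have "(\<lambda>x. p' x + (real n * r x ^ (n - 1) * (if y = 0 then - 1 / L else 1 / L)) *\<^sub>R (\<alpha> - p y)) \<in> Sob 0 L"
    unfolding r_def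
    using \<open>L > 0\<close> p'c by (cases "y = 0") (auto intro!: L2fun_continuous continuous_intros)
  ultimately have "(\<lambda>x. p x + r x ^ n *\<^sub>R (\<alpha> - p y)) \<in> Sob (Suc 0) L"
    by (intro Sob_I[OF \<open>L > 0\<close>])
  moreover have "(p + q n) x = p x + r x ^ n *\<^sub>R (\<alpha> - p y)" if "x \<in> {0..L}" for x
    using rq[OF that] by simp
  ultimately have G: "p + q n \<in> Sob 1 L"
    unfolding One_nat_def by (subst Sob_cong[OF _ \<open>L > 0\<close>])
  have pL: "L2fun L p" using p(1) by (intro L2fun_continuous continuous_on_polymonial_function)
  have gL: "L2fun L g" using gc by (rule L2fun_continuous)
  have gp: "L2.nrm L (g - p) \<le> sqrt L * c"
    using p(2) c(1) \<open>L > 0\<close> L2.mem(3)[of g L p] pL gL by (intro L2_nrm_le) (auto simp: less_imp_le)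
  have qL: "L2fun L (q n)"
    using L2.mem(3)[of "p + q n" L p] pL Sob_L2fun[OF G] by simp
  have "L2.nrm L (f - (p + q n)) \<le> L2.nrm L (f - g) + L2.nrm L (g - (p + q n))"
    by (rule L2.nrm_triangle) (use f gL Sob_L2fun[OF G] in auto)
  also have "L2.nrm L (g - (p + q n)) \<le> L2.nrm L (g - p) + L2.nrm L (p - (p + q n))"
    by (rule L2.nrm_triangle) (use pL gL Sob_L2fun[OF G] in auto)
  also have "L2.nrm L (p - (p + q n)) = L2.nrm L (q n)"
    using L2.nrm_minus_commute[of p L "p + q n"] pL Sob_L2fun[OF G] by simp
  finally have "L2.nrm L (f - (p + q n)) < e" using g(2) gp c(2) n by linarith
  moreover have "(p + q n) y = \<alpha>" by (simp add: q_def)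
  ultimately show ?thesis using that G by blast
qed

section \<open>Weak derivatives under the L2 form, and traces\<close>

declare Sob.simps [simp del]

text \<open>\<open>wderiv 0\<close> is an arbitrary choice among L^2 derivatives and is not
  pointwise linear. Under \<open>ip\<close> any representative may replace it, which restores
  linearity there.\<close>

lemma ip_wderiv:
  assumes "f \<in> Sob 1 L" "L2fun L f'" "\<And>x. x \<in> {0..L} \<Longrightarrow> f x = f 0 + integral {0..x} f'"
  shows "ip L (wderiv 0 L f) h = ip L f' h" "ip L h (wderiv 0 L f) = ip L h f'"
proof -
  have f: "f \<in> Sob (Suc 0) L" using assms(1) by simp
  have "integral {0..x} (wderiv 0 L f) = integral {0..x} f'" if "x \<in> {0..L}" for x
    using wderiv_integral[OF f that] assms(3)[OF that] by (metis add_left_cancel)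
  then show "ip L (wderiv 0 L f) h = ip L f' h" "ip L h (wderiv 0 L f) = ip L h f'"
    using ip_ae_cong[OF Sob_L2fun[OF wderiv_Sob[OF f]] assms(2)] by auto
qed

lemma L2fun_wderiv: "f \<in> Sob 1 L \<Longrightarrow> L2fun L (wderiv 0 L f)"
  using wderiv_Sob[of f 0 L] Sob_L2fun by auto

lemma ip_wderiv_add:
  assumes f: "f \<in> Sob 1 L" and g: "g \<in> Sob 1 L" and h: "L2fun L h"
  shows "ip L (wderiv 0 L (f + g)) h = ip L (wderiv 0 L f) h + ip L (wderiv 0 L g) h"
proof -
  have "ip L (wderiv 0 L (f + g)) h = ip L (wderiv 0 L f + wderiv 0 L g) h"
  proof (rule ip_wderiv(1))
    show "f + g \<in> Sob 1 L" using f g by (rule subspace_add[OF Sob_subspace])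
    show "L2fun L (wderiv 0 L f + wderiv 0 L g)"
      using L2.mem(1)[of _ L] L2fun_wderiv f g by auto
    fix x assume x: "x \<in> {0..L}"
    have int: "wderiv 0 L f integrable_on {0..x}" "wderiv 0 L g integrable_on {0..x}"
      using L2fun_integrable[OF L2fun_mono(1)[OF L2fun_wderiv[OF f], of x]]
        L2fun_integrable[OF L2fun_mono(1)[OF L2fun_wderiv[OF g], of x]] x
        set_lebesgue_integral_eq_integral(1) by auto
    show "(f + g) x = (f + g) 0 + integral {0..x} (wderiv 0 L f + wderiv 0 L g)"
      unfolding plus_fun_def Henstock_Kurzweil_Integration.integral_add[OF int]
      using wderiv_integral[of f 0 L x] wderiv_integral[of g 0 L x] f g x by simp
  qed
  then show ?thesis using L2.add[of _ L] L2fun_wderiv f g h by simp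
qed

lemma ip_wderiv_scaleR:
  assumes f: "f \<in> Sob 1 L" and h: "L2fun L h"
  shows "ip L (wderiv 0 L (c *\<^sub>R f)) h = c * ip L (wderiv 0 L f) h"
proof -
  have "ip L (wderiv 0 L (c *\<^sub>R f)) h = ip L (c *\<^sub>R wderiv 0 L f) h"
  proof (rule ip_wderiv(1))
    show "c *\<^sub>R f \<in> Sob 1 L" using f by (rule subspace_scale[OF Sob_subspace])
    show "L2fun L (c *\<^sub>R wderiv 0 L f)"
      using L2.mem(2)[of _ L] L2fun_wderiv f by auto
    fix x assume x: "x \<in> {0..L}"
    show "(c *\<^sub>R f) x = (c *\<^sub>R f) 0 + integral {0..x} (c *\<^sub>R wderiv 0 L f)"
      unfolding scaleR_fun_def integral_cmul
      using arg_cong[OF wderiv_integral[of f 0 L x], of "\<lambda>y. c *\<^sub>R y"] f x by (simp add: scaleR_add_right)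
  qed
  then show ?thesis using L2.scale[of _ L] L2fun_wderiv f h by simp
qed

lemma Sob_2_D:
  assumes "w \<in> Sob 2 L" "L > 0"
  shows "w \<in> Sob 1 L" "dv L w \<in> Sob 1 L" "continuous_on {0..L} w" "continuous_on {0..L} (dv L w)"
    "x \<in> {0..L} \<Longrightarrow> (w has_vector_derivative dv L w x) (at x within {0..L})"
proof -
  have w: "w \<in> Sob (Suc (Suc 0)) L" using assms(1) by (simp add: numeral_2_eq_2)
  show "w \<in> Sob 1 L" using Sob_Suc_subset[OF assms(2)] w by auto
  show "dv L w \<in> Sob 1 L" using dv_Sob[OF w assms(2)] by simp
  then show "continuous_on {0..L} (dv L w)" using Sob_Suc_continuous[of "dv L w" 0 L] by simp
  show "continuous_on {0..L} w" using Sob_Suc_continuous w by blast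
  show "x \<in> {0..L} \<Longrightarrow> (w has_vector_derivative dv L w x) (at x within {0..L})"
    using Sob_Suc_Suc(1)[OF w _ assms(2)] by blast
qed

lemma Sob_1_continuous: "f \<in> Sob 1 L \<Longrightarrow> continuous_on {0..L} f"
  using Sob_Suc_continuous[of f 0 L] by simp

lemma Sob_2_integral:
  assumes "f \<in> Sob 2 L" "L > 0" "x \<in> {0..L}"
  shows "f x = f 0 + integral {0..x} (dv L f)"
proof -
  have "((dv L f) has_integral (f x - f 0)) {0..x}"
  proof (rule fundamental_theorem_of_calculus)
    fix t assume "t \<in> {0..x}"
    then show "(f has_vector_derivative dv L f t) (at t within {0..x})"
      using assms(3) by (intro has_vector_derivative_within_subset[OF Sob_2_D(5)[OF assms(1,2)]]) auto
  qed (use assms(3) in simp)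
  then show ?thesis by (simp add: integral_unique)
qed

lemma ip_wderiv_dv:
  assumes "f \<in> Sob 2 L" "L > 0"
  shows "ip L (wderiv 0 L f) h = ip L (dv L f) h" "ip L h (wderiv 0 L f) = ip L h (dv L f)"
  by (rule ip_wderiv[OF Sob_2_D(1)[OF assms] L2fun_continuous[OF Sob_2_D(4)[OF assms]] Sob_2_integral[OF assms]],
      assumption)+

lemma dv_add:
  assumes "f \<in> Sob 2 L" "g \<in> Sob 2 L" "x \<in> {0..L}" "L > 0"
  shows "dv L (f + g) x = dv L f x + dv L g x"
  unfolding plus_fun_def
  using assms Sob_2_D(5) by (intro dv_eq derivative_intros) auto

lemma dv_scaleR:
  assumes "f \<in> Sob 2 L" "x \<in> {0..L}" "L > 0"
  shows "dv L (c *\<^sub>R f) x = c *\<^sub>R dv L f x"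
  unfolding scaleR_fun_def
  using bounded_linear.has_vector_derivative[OF bounded_linear_scaleR_right Sob_2_D(5)] assms by (intro dv_eq) auto

text \<open>Sobolev embedding with an explicit constant. Integrating f' bounds |f(0)|^2 by 2
  |f(y)|^2 plus 2 L times the squared L^2 norm of f'; this is averaged over y, and f(x) is then
  reached from f(0).\<close>

lemma trace_bound:
  assumes f: "f \<in> Sob 1 L" and x: "x \<in> {0..L}" and "L > 0"
  shows "(cmod (f x))\<^sup>2 \<le> (4 / L + 6 * L) * (ip L f f + ip L (wderiv 0 L f) (wderiv 0 L f))"
proof -
  define g where "g = wderiv 0 L f"
  have g: "L2fun L g" using L2fun_wderiv[OF f] by (simp add: g_def)
  have fL: "L2fun L f" using f by (rule Sob_L2fun)
  have rep: "f y = f 0 + integral {0..y} g" if "y \<in> {0..L}" for y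
    using wderiv_integral[of f 0 L y] f that by (simp add: g_def)
  have nn: "0 \<le> ip L f f" "0 \<le> ip L g g" using L2.nonneg[of _ L] g fL by auto
  have 1: "(cmod (f 0))\<^sup>2 \<le> 2 * (cmod (f y))\<^sup>2 + 2 * (L * ip L g g)" if y: "y \<in> {0..L}" for y
    using cmod_diff_square[of "f y" "integral {0..y} g"] integral_norm_square_le[OF g y] rep[OF y] by simp
  have "integral {0..L} (\<lambda>y. (cmod (f 0))\<^sup>2) \<le> integral {0..L} (\<lambda>y. 2 * (cmod (f y))\<^sup>2 + 2 * (L * ip L g g))"
    by (rule integral_le) (use 1 fL in \<open>auto simp: L2fun_iff intro!: integrable_add integrable_on_mult_right\<close>)
  also have "\<dots> = 2 * ip L f f + L * (2 * (L * ip L g g))"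
    using fL \<open>L > 0\<close> by (subst Henstock_Kurzweil_Integration.integral_add)
      (auto simp: L2fun_iff ip_self intro!: integrable_on_mult_right)
  finally have "L * (cmod (f 0))\<^sup>2 \<le> 2 * ip L f f + L * (2 * (L * ip L g g))"
    using \<open>L > 0\<close> by simp
  then have 2: "(cmod (f 0))\<^sup>2 \<le> 2 / L * ip L f f + 2 * L * ip L g g"
    using \<open>L > 0\<close> by (simp add: field_simps)
  have "f x = f 0 - (- integral {0..x} g)" using rep[OF x] by simp
  then have "(cmod (f x))\<^sup>2 \<le> 2 * (cmod (f 0))\<^sup>2 + 2 * (cmod (- integral {0..x} g))\<^sup>2"
    using cmod_diff_square[of "f 0" "- integral {0..x} g"] by simp
  also have "\<dots> \<le> 2 * (2 / L * ip L f f + 2 * L * ip L g g) + 2 * (L * ip L g g)"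
    using 2 integral_norm_square_le[OF g x] by simp
  also have "\<dots> = 4 / L * ip L f f + 6 * L * ip L g g" by (simp add: algebra_simps)
  also have "\<dots> \<le> (4 / L + 6 * L) * ip L f f + (4 / L + 6 * L) * ip L g g"
    using nn \<open>L > 0\<close> by (intro add_mono mult_right_mono) auto
  finally show ?thesis by (simp add: g_def distrib_left)
qed

section \<open>The state space as an inner product space\<close>

text \<open>The first derivative of w is taken classically, since for w in H^2 it is continuous,
  pointwise linear and has end values; w'' and v' exist only weakly, hence
  \<open>wderiv 0\<close>.\<close>

definition H_form :: "real \<Rightarrow> st \<Rightarrow> st \<Rightarrow> real" where
  "H_form L z z' = (case z of (w, v, \<xi>, \<psi>) \<Rightarrow> case z' of (w', v', \<xi>', \<psi>') \<Rightarrow>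
     ip L w w' + ip L (dv L w) (dv L w') + ip L (wderiv 0 L (dv L w)) (wderiv 0 L (dv L w')) +
     ip L v v' + ip L (wderiv 0 L v) (wderiv 0 L v') + \<xi> \<bullet> \<xi>' + \<psi> \<bullet> \<psi>')"

lemma Hsp_iff:
  "(w, v, \<xi>, \<psi>) \<in> Hsp L \<longleftrightarrow> w \<in> Sob 2 L \<and> v \<in> Sob 1 L \<and> \<xi> = v L \<and> \<psi> = v 0 \<and>
     (\<forall>x. x \<notin> {0..L} \<longrightarrow> w x = 0 \<and> v x = 0)"
  by (simp add: Hsp_def)

lemma Hsp_subspace: "subspace (Hsp L)"
  unfolding subspace_def
proof (intro conjI ballI allI)
  show "0 \<in> Hsp L"
    using subspace_0[OF Sob_subspace[of 2 L]] subspace_0[OF Sob_subspace[of 1 L]]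
    by (simp add: zero_prod_def Hsp_iff)
  fix x y :: st and c :: real assume "x \<in> Hsp L"
  then show "c *\<^sub>R x \<in> Hsp L"
    using subspace_scale[OF Sob_subspace[of 2 L]] subspace_scale[OF Sob_subspace[of 1 L]]
    by (cases x) (auto simp: Hsp_iff scaleR_fun_def)
  assume "x \<in> Hsp L" "y \<in> Hsp L"
  then show "x + y \<in> Hsp L"
    using subspace_add[OF Sob_subspace[of 2 L]] subspace_add[OF Sob_subspace[of 1 L]]
    by (cases x, cases y) (auto simp: Hsp_iff)
qed

lemma ip_add: "L2fun L f \<Longrightarrow> L2fun L g \<Longrightarrow> L2fun L h \<Longrightarrow> ip L (f + g) h = ip L f h + ip L g h"
  using L2.add[of f L g h] by simp

lemma ip_scaleR: "L2fun L f \<Longrightarrow> L2fun L h \<Longrightarrow> ip L (c *\<^sub>R f) h = c * ip L f h"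
  using L2.scale[of f L h] by simp

lemma ip_sym: "ip L f g = ip L g f"
  by (simp add: ip_def inner_commute)

lemma H_form_semi_inner:
  assumes "L > 0"
  shows "semi_inner (Hsp L) (H_form L)"
proof
  show "subspace (Hsp L)" by (rule Hsp_subspace)
  show "H_form L x y = H_form L y x" for x y
    by (cases x, cases y) (simp add: H_form_def ip_sym[of L] inner_commute)
  have mem: "w \<in> Sob 2 L" "dv L w \<in> Sob 1 L" "L2fun L w" "L2fun L (dv L w)" "L2fun L (wderiv 0 L (dv L w))"
     "v \<in> Sob 1 L" "L2fun L v" "L2fun L (wderiv 0 L v)" if "(w, v, \<xi>, \<psi>) \<in> Hsp L" for w v \<xi> \<psi>
    using that Sob_2_D[of w L] assms L2fun_wderiv Sob_L2fun by (auto simp: Hsp_iff)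
  fix x y z :: st and c :: real assume x: "x \<in> Hsp L"
  obtain w v \<xi> \<psi> where xe: "x = (w, v, \<xi>, \<psi>)" by (cases x)
  show "0 \<le> H_form L x x"
    using L2.nonneg[of _ L] mem[OF x[unfolded xe]] by (simp add: xe H_form_def)
  assume z: "z \<in> Hsp L"
  obtain w'' v'' \<xi>'' \<psi>'' where ze: "z = (w'', v'', \<xi>'', \<psi>'')" by (cases z)
  note mx = mem[OF x[unfolded xe]] and mz = mem[OF z[unfolded ze]]
  have 1: "ip L (dv L (c *\<^sub>R w)) (dv L w'') = ip L (c *\<^sub>R dv L w) (dv L w'')"
    by (rule ip_cong) (simp_all add: dv_scaleR mx assms)
  have 2: "wderiv 0 L (dv L (c *\<^sub>R w)) = wderiv 0 L (c *\<^sub>R dv L w)"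
    by (rule wderiv_cong) (simp_all add: dv_scaleR mx assms)
  show "H_form L (c *\<^sub>R x) z = c * H_form L x z"
    by (simp add: xe ze H_form_def 1 2 ip_scaleR ip_wderiv_scaleR mx[simplified] mz[simplified] algebra_simps)
  assume y: "y \<in> Hsp L"
  obtain w' v' \<xi>' \<psi>' where ye: "y = (w', v', \<xi>', \<psi>')" by (cases y)
  note my = mem[OF y[unfolded ye]]
  have 1: "ip L (dv L (w + w')) (dv L w'') = ip L (dv L w + dv L w') (dv L w'')"
    by (rule ip_cong) (simp_all add: dv_add mx my assms)
  have 2: "wderiv 0 L (dv L (w + w')) = wderiv 0 L (dv L w + dv L w')"
    by (rule wderiv_cong) (simp_all add: dv_add mx my assms)
  show "H_form L (x + y) z = H_form L x z + H_form L y z"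
    by (simp add: xe ye ze H_form_def 1 2 ip_add ip_wderiv_add mx[simplified] my[simplified] mz[simplified] inner_add_left)
qed

text \<open>\<open>sobnorm2\<close> goes through \<open>wderiv 1 L w\<close>, which agrees with
  \<open>dv L w\<close> on [0,L]; by \<open>wderiv_cong\<close> both then lead to the same choice of
  second derivative.\<close>

lemma Hnorm_eq:
  assumes "z \<in> Hsp L" "L > 0"
  shows "Hnorm L z = sqrt (H_form L z z)"
proof -
  obtain w v \<xi> \<psi> where ze: "z = (w, v, \<xi>, \<psi>)" by (cases z)
  have w: "w \<in> Sob (Suc (Suc 0)) L" using assms by (simp add: ze Hsp_iff numeral_2_eq_2)
  have 1: "ip L (wderiv 1 L w) (wderiv 1 L w) = ip L (dv L w) (dv L w)"
    by (rule ip_cong) (simp_all add: Sob_Suc_Suc(2)[OF w _ assms(2)])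
  have 2: "wderiv 0 L (wderiv 1 L w) = wderiv 0 L (dv L w)"
    by (rule wderiv_cong) (simp_all add: Sob_Suc_Suc(2)[OF w _ assms(2)] assms)
  have 3: "sobnorm2 2 L w = sobnorm2 (Suc (Suc 0)) L w" by (simp only: numeral_2_eq_2)
  show ?thesis
    using 1 2 by (simp add: ze Hnorm_def H_form_def 3 power2_norm_eq_inner[symmetric] flip: ip_self)
qed

lemma sadd_eq: "sadd x y = x + y"
  by (cases x, cases y) (simp add: sadd_def plus_fun_def)

lemma sscale_eq: "sscale (complex_of_real c) x = c *\<^sub>R x"
  by (cases x) (simp add: sscale_def scaleR_fun_def scaleR_conv_of_real)

lemma sdiff_eq: "sdiff x y = x - y"
proof -
  have "sscale (-1) y = (-1) *\<^sub>R y" using sscale_eq[of "-1" y] by simp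
  then show ?thesis by (simp add: sdiff_def sadd_eq)
qed

text \<open>The complex linear semigroup is read over the real numbers. \<open>Hnorm\<close> is the
  seminorm of \<open>H_form\<close> on H only, so limits are transferred along t > 0, where the
  orbit stays in H.\<close>

lemma C0_semigroup_strong:
  assumes "C0_semigroup (Hsp L) (Hnorm L) T" "L > 0"
  shows "strong_semigroup (Hsp L) (H_form L) T"
proof -
  interpret semi_inner "Hsp L" "H_form L" by (rule H_form_semi_inner[OF assms(2)])
  have nrm: "Hnorm L z = nrm z" if "z \<in> Hsp L" for z
    using Hnorm_eq[OF that assms(2)] by (simp add: nrm_def)
  have T: "T t z \<in> Hsp L" if "t \<ge> 0" "z \<in> Hsp L" for t z
    using assms(1) that by (auto simp: C0_semigroup_def)
  show ?thesis
  proof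
    fix t s :: real and x y :: st and c :: real
    show "t \<ge> 0 \<Longrightarrow> x \<in> Hsp L \<Longrightarrow> T t x \<in> Hsp L" by (rule T)
    show "t \<ge> 0 \<Longrightarrow> x \<in> Hsp L \<Longrightarrow> y \<in> Hsp L \<Longrightarrow> T t (c *\<^sub>R x + y) = c *\<^sub>R T t x + T t y"
      using assms(1) unfolding C0_semigroup_def sadd_eq by (metis sscale_eq)
    show "\<exists>M. \<forall>x\<in>Hsp L. nrm (T t x) \<le> M * nrm x" if "t \<ge> 0"
      using assms(1) T that nrm unfolding C0_semigroup_def by metis
    show "x \<in> Hsp L \<Longrightarrow> T 0 x = x" using assms(1) by (simp add: C0_semigroup_def)
    show "s \<ge> 0 \<Longrightarrow> t \<ge> 0 \<Longrightarrow> x \<in> Hsp L \<Longrightarrow> T (s + t) x = T s (T t x)"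
      using assms(1) by (simp add: C0_semigroup_def)
    assume x: "x \<in> Hsp L"
    then have "((\<lambda>t. Hnorm L (T t x - x)) \<longlongrightarrow> 0) (at_right 0)"
      using assms(1) by (simp add: C0_semigroup_def sdiff_eq)
    then show "((\<lambda>t. nrm (T t x - x)) \<longlongrightarrow> 0) (at_right 0)"
    proof (rule Lim_transform_eventually)
      show "\<forall>\<^sub>F t in at_right 0. Hnorm L (T t x - x) = nrm (T t x - x)"
        using eventually_at_right_less[of 0]
        by eventually_elim (use x T mem(3) nrm in \<open>simp add: less_imp_le\<close>)
    qed
  qed
qed

lemma Sob_3_D:
  assumes "w \<in> Sob 3 L" "L > 0"
  shows "w \<in> Sob 2 L" "dv L w \<in> Sob 2 L"
proof -
  have w: "w \<in> Sob (Suc (Suc (Suc 0))) L" using assms(1) by (simp add: numeral_3_eq_3)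
  show "w \<in> Sob 2 L" using subsetD[OF Sob_Suc_subset[OF assms(2)] w] by (simp add: numeral_2_eq_2)
  show "dv L w \<in> Sob 2 L" using dv_Sob[OF w assms(2)] by (simp add: numeral_2_eq_2)
qed

lemma ip_by_parts:
  assumes "L > 0"
    and f: "\<And>x. x \<in> {0..L} \<Longrightarrow> (f has_vector_derivative f' x) (at x within {0..L})" "continuous_on {0..L} f'"
    and h: "\<And>x. x \<in> {0..L} \<Longrightarrow> (h has_vector_derivative h' x) (at x within {0..L})" "continuous_on {0..L} h'"
  shows "ip L f h' + ip L f' h = f L \<bullet> h L - f 0 \<bullet> h 0"
proof -
  have c: "continuous_on {0..L} f" "continuous_on {0..L} h"
    using f(1) h(1) has_vector_derivative_continuous unfolding continuous_on_eq_continuous_within by blast+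
  have "((\<lambda>x. f x \<bullet> h' x + f' x \<bullet> h x) has_integral (f L \<bullet> h L - f 0 \<bullet> h 0)) {0..L}"
    by (rule fundamental_theorem_of_calculus)
       (use assms(1) bounded_bilinear.has_vector_derivative[OF bounded_bilinear_inner f(1) h(1)] in auto)
  then have "integral {0..L} (\<lambda>x. f x \<bullet> h' x + f' x \<bullet> h x) = f L \<bullet> h L - f 0 \<bullet> h 0"
    by (rule integral_unique)
  then show ?thesis
    using c f(2) h(2) unfolding ip_def
    by (subst (asm) Henstock_Kurzweil_Integration.integral_add)
       (auto intro!: integrable_continuous_real continuous_intros)
qed

lemma dv_indefinite:
  assumes "L > 0" "continuous_on {0..L} g" "\<And>x. x \<in> {0..L} \<Longrightarrow> f x = c + integral {0..x} g" "x \<in> {0..L}"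
  shows "dv L f x = g x"
proof (rule dv_eq[OF _ assms(4,1)])
  have "((\<lambda>u. c + integral {0..u} g) has_vector_derivative g x) (at x within {0..L})"
    using integral_has_vector_derivative[OF assms(2,4)] by (auto intro!: derivative_eq_intros)
  then show "(f has_vector_derivative g x) (at x within {0..L})"
    by (rule has_vector_derivative_transform[rotated 2, OF _ assms(4,3)])
qed

lemma ip_self_le:
  assumes "L > 0" "L2fun L f" "\<And>x. x \<in> {0..L} \<Longrightarrow> (cmod (f x))\<^sup>2 \<le> c"
  shows "ip L f f \<le> L * c"
proof -
  have "ip L f f \<le> integral {0..L} (\<lambda>x. c)"
    unfolding ip_self by (rule integral_le) (use assms in \<open>auto simp: L2fun_iff\<close>)
  then show ?thesis using assms(1) by simp
qed

lemma L2fun_diff: "L2fun L f \<Longrightarrow> L2fun L g \<Longrightarrow> L2fun L (f - g)"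
  using L2.mem(3)[of f L g] by simp

lemma integral_diff_fun:
  assumes "L2fun L f" "L2fun L g" "x \<in> {0..L}"
  shows "integral {0..x} (f - g) = integral {0..x} f - integral {0..x} g"
proof -
  have "h integrable_on {0..x}" if "L2fun L h" for h :: "real \<Rightarrow> complex"
    using L2fun_integrable[OF L2fun_mono(1)[OF that, of x]] assms(3) set_lebesgue_integral_eq_integral(1) by auto
  then show ?thesis unfolding fun_diff_def using assms by (intro Henstock_Kurzweil_Integration.integral_diff)
qed

section \<open>Energy and dissipation\<close>

locale crane =
  fixes L :: real and P :: "real \<Rightarrow> real" and P0 a b \<theta>1 \<theta>2 \<theta>3 \<theta>4 :: real
  assumes L: "L > 0" and P_Sob: "(\<lambda>x. complex_of_real (P x)) \<in> Sob 2 L"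
    and P0: "P0 > 0" and P_ge: "x \<in> {0..L} \<Longrightarrow> P x \<ge> P0"
    and a: "a > 0" and b: "b > 0"
    and \<theta>1: "\<theta>1 = \<theta>3 / b - a" and \<theta>2: "\<theta>2 = \<theta>4 / b"
    and \<theta>3: "\<theta>3 < 0" and \<theta>4: "\<theta>4 > 0"
begin

abbreviation "Dom \<equiv> DomA L P \<theta>1 \<theta>2 \<theta>3 \<theta>4"
abbreviation "A \<equiv> Aop L P \<theta>1 \<theta>2 \<theta>3 \<theta>4"

definition P1 :: "real \<Rightarrow> real" where "P1 x = Re (dv L (\<lambda>x. complex_of_real (P x)) x)"

lemma P_deriv: "x \<in> {0..L} \<Longrightarrow> (P has_vector_derivative P1 x) (at x within {0..L})"
  using bounded_linear.has_vector_derivative[OF bounded_linear_Re Sob_2_D(5)[OF P_Sob L]]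
  by (simp add: P1_def)

lemma P1_cont: "continuous_on {0..L} P1"
  unfolding P1_def by (intro continuous_intros Sob_2_D(4)[OF P_Sob L])

lemma P_cont: "continuous_on {0..L} P"
  using P_deriv has_vector_derivative_continuous unfolding continuous_on_eq_continuous_within by blast

lemma P_bound:
  obtains C where "C \<ge> 1" "\<And>x. x \<in> {0..L} \<Longrightarrow> P x \<le> C" "\<And>x. x \<in> {0..L} \<Longrightarrow> \<bar>P1 x\<bar> \<le> C"
proof -
  have "bounded (P ` {0..L})" "bounded (P1 ` {0..L})"
    using compact_continuous_image[OF P_cont] compact_continuous_image[OF P1_cont] compact_imp_bounded by auto
  then obtain B B' where B: "\<And>x. x \<in> {0..L} \<Longrightarrow> \<bar>P x\<bar> \<le> B" "\<And>x. x \<in> {0..L} \<Longrightarrow> \<bar>P1 x\<bar> \<le> B'"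
    unfolding bounded_iff by (metis imageI real_norm_def)
  show ?thesis
  proof (rule that[of "max 1 (max B B')"])
    fix x assume x: "x \<in> {0..L}"
    show "P x \<le> max 1 (max B B')" "\<bar>P1 x\<bar> \<le> max 1 (max B B')" using B(1)[OF x] B(2)[OF x] by linarith+
  qed simp
qed

lemma P_pos: "x \<in> {0..L} \<Longrightarrow> P x > 0" using P_ge P0 by fastforce

text \<open>Solves \<sigma> (1 + a / b) = 1, the condition under which the products of u w and v(0)
  cancel in E z (A z).\<close>

definition \<sigma> :: real where "\<sigma> = b / (a + b)"
text \<open>Expresses the flux at 0 through u: P(0) w'(0) = k (u w - \<theta>3 w(0)).\<close>

definition k :: real where "k = P 0 / \<theta>4"

lemma \<sigma>: "\<sigma> > 0" "\<sigma> * (a + b) = b" using a b by (auto simp: \<sigma>_def field_simps)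
lemma k: "k > 0" "k * \<theta>4 = P 0" using P_pos[of 0] L \<theta>4 by (auto simp: k_def)

text \<open>The feedback splits as F[w,v] = u w + u v / b - a v(0). As w_t = v, the term u v / b is
  the time derivative of u w / b and can be moved into eta.\<close>

definition u :: "(real \<Rightarrow> complex) \<Rightarrow> complex" where
  "u w = \<theta>3 *\<^sub>R w 0 + \<theta>4 *\<^sub>R dv L w 0"

text \<open>With eta = v(0) - u w / b the feedback law becomes the ordinary differential equation
  eta' = u w - a v(0); the weight of eta in the energy makes the boundary terms at 0 negative definite.\<close>
definition E :: "st \<Rightarrow> st \<Rightarrow> real" where
  "E z z' = (case z of (w, v, \<xi>, \<psi>) \<Rightarrow> case z' of (w', v', \<xi>', \<psi>') \<Rightarrow>
     ip L (\<lambda>x. P x *\<^sub>R dv L w x) (dv L w') + ip L v v' + P L * (\<xi> \<bullet> \<xi>')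
     - k * \<theta>3 * (w 0 \<bullet> w' 0) + k * \<sigma> * ((\<psi> - u w /\<^sub>R b) \<bullet> (\<psi>' - u w' /\<^sub>R b)))"

text \<open>The time derivative of M v (v L) along the flow is - P(0) w'(0).\<close>
definition M :: "(real \<Rightarrow> complex) \<Rightarrow> complex \<Rightarrow> complex" where
  "M v \<xi> = integral {0..L} v + P L *\<^sub>R \<xi>"

text \<open>Polarised so that R z z is twice the sum of the two multiplier terms. The decreasing
  weight gives the favourable sign in the interior and at L and leaves a debt at 0; the factor
  \<beta> weighs the term that yields a negative multiple of |w(0)|^2.\<close>

definition R :: "real \<Rightarrow> real \<Rightarrow> st \<Rightarrow> st \<Rightarrow> real" where
  "R K \<beta> z z' = (case z of (w, v, \<xi>, \<psi>) \<Rightarrow> case z' of (w', v', \<xi>', \<psi>') \<Rightarrow>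
     \<beta> * (w 0 \<bullet> M v' \<xi>' + w' 0 \<bullet> M v \<xi>)
     - ip L (\<lambda>x. exp (- K * x) *\<^sub>R v x) (dv L w') - ip L (\<lambda>x. exp (- K * x) *\<^sub>R v' x) (dv L w))"

lemma H_D:
  assumes "(w, v, \<xi>, \<psi>) \<in> Hsp L"
  shows "w \<in> Sob 2 L" "v \<in> Sob 1 L" "\<xi> = v L" "\<psi> = v 0" "continuous_on {0..L} w"
    "continuous_on {0..L} (dv L w)" "continuous_on {0..L} v" "dv L w \<in> Sob 1 L" "w \<in> Sob 1 L"
  using assms Sob_2_D[of w L] Sob_1_continuous[of v L] L by (auto simp: Hsp_iff)

lemma weight_add:
  assumes "continuous_on {0..L} f" "continuous_on {0..L} f'" "continuous_on {0..L} h" "continuous_on {0..L} m"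
    and "\<And>x. x \<in> {0..L} \<Longrightarrow> g x = f x + f' x"
  shows "ip L (\<lambda>x. m x *\<^sub>R g x) h = ip L (\<lambda>x. m x *\<^sub>R f x) h + ip L (\<lambda>x. m x *\<^sub>R f' x) h"
    "ip L (\<lambda>x. m x *\<^sub>R h x) g = ip L (\<lambda>x. m x *\<^sub>R h x) f + ip L (\<lambda>x. m x *\<^sub>R h x) f'"
proof -
  have c: "L2fun L (\<lambda>x. m x *\<^sub>R f x)" "L2fun L (\<lambda>x. m x *\<^sub>R f' x)" "L2fun L (\<lambda>x. m x *\<^sub>R h x)"
    "L2fun L f" "L2fun L f'" "L2fun L h"
    using assms by (auto intro!: L2fun_continuous continuous_intros)
  have "ip L (\<lambda>x. m x *\<^sub>R g x) h = ip L ((\<lambda>x. m x *\<^sub>R f x) + (\<lambda>x. m x *\<^sub>R f' x)) h"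
    by (rule ip_cong) (simp_all add: assms(5) scaleR_add_right)
  then show "ip L (\<lambda>x. m x *\<^sub>R g x) h = ip L (\<lambda>x. m x *\<^sub>R f x) h + ip L (\<lambda>x. m x *\<^sub>R f' x) h"
    using ip_add c by simp
  have "ip L g (\<lambda>x. m x *\<^sub>R h x) = ip L (f + f') (\<lambda>x. m x *\<^sub>R h x)"
    by (rule ip_cong) (simp_all add: assms(5))
  then show "ip L (\<lambda>x. m x *\<^sub>R h x) g = ip L (\<lambda>x. m x *\<^sub>R h x) f + ip L (\<lambda>x. m x *\<^sub>R h x) f'"
    using ip_add c ip_sym by metis
qed

lemma weight_scaleR:
  assumes "\<And>x. x \<in> {0..L} \<Longrightarrow> g x = c *\<^sub>R f x"
  shows "ip L (\<lambda>x. m x *\<^sub>R g x) h = c * ip L (\<lambda>x. m x *\<^sub>R f x) h"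
    "ip L (\<lambda>x. m x *\<^sub>R h x) g = c * ip L (\<lambda>x. m x *\<^sub>R h x) f"
proof -
  have "ip L (\<lambda>x. m x *\<^sub>R g x) h = integral {0..L} (\<lambda>x. c * ((m x *\<^sub>R f x) \<bullet> h x))"
    unfolding ip_def by (rule integral_cong) (simp add: assms)
  then show "ip L (\<lambda>x. m x *\<^sub>R g x) h = c * ip L (\<lambda>x. m x *\<^sub>R f x) h" by (simp add: ip_def)
  have "ip L (\<lambda>x. m x *\<^sub>R h x) g = integral {0..L} (\<lambda>x. c * ((m x *\<^sub>R h x) \<bullet> f x))"
    unfolding ip_def by (rule integral_cong) (simp add: assms)
  then show "ip L (\<lambda>x. m x *\<^sub>R h x) g = c * ip L (\<lambda>x. m x *\<^sub>R h x) f" by (simp add: ip_def)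
qed

lemma u_add: "w \<in> Sob 2 L \<Longrightarrow> w' \<in> Sob 2 L \<Longrightarrow> u (w + w') = u w + u w'"
  using L by (simp add: u_def dv_add algebra_simps)

lemma u_scaleR: "w \<in> Sob 2 L \<Longrightarrow> u (c *\<^sub>R w) = c *\<^sub>R u w"
  using L by (simp add: u_def dv_scaleR algebra_simps)

lemma M_add: "continuous_on {0..L} v \<Longrightarrow> continuous_on {0..L} v' \<Longrightarrow> M (v + v') (\<xi> + \<xi>') = M v \<xi> + M v' \<xi>'"
  by (simp add: M_def plus_fun_def Henstock_Kurzweil_Integration.integral_add integrable_continuous_real algebra_simps)

lemma M_scaleR: "M (c *\<^sub>R v) (c *\<^sub>R \<xi>) = c *\<^sub>R M v \<xi>"
  by (simp add: M_def scaleR_fun_def algebra_simps)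

lemma ip_weight_sym: "ip L (\<lambda>x. m x *\<^sub>R f x) g = ip L (\<lambda>x. m x *\<^sub>R g x) f"
  by (simp add: ip_def inner_commute)

lemma forms_sym: "E x y = E y x" "R K \<beta> x y = R K \<beta> y x"
proof -
  obtain w v \<xi> \<psi> w' v' \<xi>' \<psi>' where e: "x = (w, v, \<xi>, \<psi>)" "y = (w', v', \<xi>', \<psi>')"
    by (cases x, cases y)
  show "E x y = E y x"
    unfolding e E_def prod.case ip_weight_sym[of P "dv L w" "dv L w'"] ip_sym[of L v v']
    by (simp only: inner_commute)
  show "R K \<beta> x y = R K \<beta> y x" by (simp add: e R_def)
qed

lemma forms_add:
  assumes "x \<in> Hsp L" "y \<in> Hsp L" "z \<in> Hsp L"
  shows "E (x + y) z = E x z + E y z" "R K \<beta> (x + y) z = R K \<beta> x z + R K \<beta> y z"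
proof -
  obtain w v \<xi> \<psi> w' v' \<xi>' \<psi>' w'' v'' \<xi>'' \<psi>''
    where e: "x = (w, v, \<xi>, \<psi>)" "y = (w', v', \<xi>', \<psi>')" "z = (w'', v'', \<xi>'', \<psi>'')"
    by (cases x, cases y, cases z)
  note x = H_D[OF assms(1)[unfolded e]] and y = H_D[OF assms(2)[unfolded e]] and z = H_D[OF assms(3)[unfolded e]]
  have exp: "continuous_on {0..L} (\<lambda>x. exp (- K * x))" by (intro continuous_intros)
  have d: "dv L (w + w') t = dv L w t + dv L w' t" if "t \<in> {0..L}" for t
    using dv_add x(1) y(1) that L by blast
  have 1: "ip L (\<lambda>x. P x *\<^sub>R dv L (w + w') x) (dv L w'') =
      ip L (\<lambda>x. P x *\<^sub>R dv L w x) (dv L w'') + ip L (\<lambda>x. P x *\<^sub>R dv L w' x) (dv L w'')"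
    by (rule weight_add(1)[OF x(6) y(6) z(6) P_cont d])
  have 2: "ip L (\<lambda>x. exp (- K * x) *\<^sub>R (v + v') x) (dv L w'') =
      ip L (\<lambda>x. exp (- K * x) *\<^sub>R v x) (dv L w'') + ip L (\<lambda>x. exp (- K * x) *\<^sub>R v' x) (dv L w'')"
    by (rule weight_add(1)[OF x(7) y(7) z(6) exp]) simp
  have 3: "ip L (\<lambda>x. exp (- K * x) *\<^sub>R v'' x) (dv L (w + w')) =
      ip L (\<lambda>x. exp (- K * x) *\<^sub>R v'' x) (dv L w) + ip L (\<lambda>x. exp (- K * x) *\<^sub>R v'' x) (dv L w')"
    by (rule weight_add(2)[OF x(6) y(6) z(7) exp d])
  have 4: "ip L (v + v') v'' = ip L v v'' + ip L v' v''"
    by (rule ip_add) (use x y z in \<open>auto intro: L2fun_continuous\<close>)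
  show "E (x + y) z = E x z + E y z"
    unfolding e
    by (simp add: E_def 1 4 u_add x y inner_add_left inner_add_right inner_diff_left inner_diff_right distrib_left
        right_diff_distrib)
  show "R K \<beta> (x + y) z = R K \<beta> x z + R K \<beta> y z"
    using 2 3 unfolding e
    by (simp add: R_def M_add x y inner_add_left inner_add_right algebra_simps)
qed

lemma forms_scaleR:
  assumes "x \<in> Hsp L" "z \<in> Hsp L"
  shows "E (c *\<^sub>R x) z = c * E x z" "R K \<beta> (c *\<^sub>R x) z = c * R K \<beta> x z"
proof -
  obtain w v \<xi> \<psi> w'' v'' \<xi>'' \<psi>''
    where e: "x = (w, v, \<xi>, \<psi>)" "z = (w'', v'', \<xi>'', \<psi>'')"
    by (cases x, cases z)
  note x = H_D[OF assms(1)[unfolded e]] and z = H_D[OF assms(2)[unfolded e]]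
  have d: "dv L (c *\<^sub>R w) t = c *\<^sub>R dv L w t" if "t \<in> {0..L}" for t
    using dv_scaleR x(1) that L by blast
  have 1: "ip L (\<lambda>x. P x *\<^sub>R dv L (c *\<^sub>R w) x) (dv L w'') = c * ip L (\<lambda>x. P x *\<^sub>R dv L w x) (dv L w'')"
    by (rule weight_scaleR(1)[OF d])
  have 2: "ip L (\<lambda>x. exp (- K * x) *\<^sub>R (c *\<^sub>R v) x) (dv L w'') = c * ip L (\<lambda>x. exp (- K * x) *\<^sub>R v x) (dv L w'')"
    by (rule weight_scaleR(1)) simp
  have 3: "ip L (\<lambda>x. exp (- K * x) *\<^sub>R v'' x) (dv L (c *\<^sub>R w)) = c * ip L (\<lambda>x. exp (- K * x) *\<^sub>R v'' x) (dv L w)"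
    by (rule weight_scaleR(2)[OF d])
  have 4: "ip L (c *\<^sub>R v) v'' = c * ip L v v''"
    by (rule ip_scaleR) (use x z in \<open>auto intro: L2fun_continuous\<close>)
  show "E (c *\<^sub>R x) z = c * E x z"
    unfolding e by (simp add: E_def 1 4 u_scaleR x inner_diff_left algebra_simps)
  show "R K \<beta> (c *\<^sub>R x) z = c * R K \<beta> x z"
    using 2 3 unfolding e
    by (simp add: R_def M_scaleR x algebra_simps)
qed

section \<open>Elements of the domain and the two balance laws\<close>

lemma flux:
  assumes "w \<in> Sob 3 L" "x \<in> {0..L}"
  shows "flux_d L P w x = P1 x *\<^sub>R dv L w x + P x *\<^sub>R dv L (dv L w) x"
    "((\<lambda>y. P y *\<^sub>R dv L w y) has_vector_derivative flux_d L P w x) (at x within {0..L})"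
proof -
  have "((\<lambda>y. P y *\<^sub>R dv L w y) has_vector_derivative (P1 x *\<^sub>R dv L w x + P x *\<^sub>R dv L (dv L w) x)) (at x within {0..L})"
    using bounded_bilinear.has_vector_derivative[OF bounded_bilinear_scaleR P_deriv[OF assms(2)]
        Sob_2_D(5)[OF Sob_3_D(2)[OF assms(1) L] L assms(2)]]
    by (simp add: add.commute)
  moreover from this show "flux_d L P w x = P1 x *\<^sub>R dv L w x + P x *\<^sub>R dv L (dv L w) x"
    unfolding flux_d_def scaleR_conv_of_real[symmetric] by (rule dv_eq[OF _ assms(2) L])
  ultimately show "((\<lambda>y. P y *\<^sub>R dv L w y) has_vector_derivative flux_d L P w x) (at x within {0..L})" by simp
qed

lemma dom_D:
  assumes "(w, v, \<xi>, \<psi>) \<in> Dom"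
  shows "(w, v, \<xi>, \<psi>) \<in> Hsp L" "dv L w \<in> Sob 2 L" "v \<in> Sob 2 L"
    "x \<in> {0..L} \<Longrightarrow> ((\<lambda>y. P y *\<^sub>R dv L w y) has_vector_derivative flux_d L P w x) (at x within {0..L})"
    "x \<in> {0..L} \<Longrightarrow> flux_d L P w x = P1 x *\<^sub>R dv L w x + P x *\<^sub>R dv L (dv L w) x"
    "continuous_on {0..L} (flux_d L P w)"
    "flux_d L P w L = - dv L w L" "flux_d L P w 0 - u v /\<^sub>R b = u w - a *\<^sub>R v 0"
    "flux_d L P w 0 = Fbd L \<theta>1 \<theta>2 \<theta>3 \<theta>4 w v"
proof -
  have *: "(w, v, \<xi>, \<psi>) \<in> Hsp L" "w \<in> Sob 3 L" "v \<in> Sob 2 L" "flux_d L P w L = - dv L w L"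
    "flux_d L P w 0 = Fbd L \<theta>1 \<theta>2 \<theta>3 \<theta>4 w v"
    using assms by (auto simp: DomA_def)
  then show "(w, v, \<xi>, \<psi>) \<in> Hsp L" "v \<in> Sob 2 L" "flux_d L P w L = - dv L w L"
    "flux_d L P w 0 = Fbd L \<theta>1 \<theta>2 \<theta>3 \<theta>4 w v" by auto
  show w1: "dv L w \<in> Sob 2 L" using Sob_3_D(2)[OF *(2) L] .
  show "x \<in> {0..L} \<Longrightarrow> flux_d L P w x = P1 x *\<^sub>R dv L w x + P x *\<^sub>R dv L (dv L w) x"
    "x \<in> {0..L} \<Longrightarrow> ((\<lambda>y. P y *\<^sub>R dv L w y) has_vector_derivative flux_d L P w x) (at x within {0..L})"
    using flux[OF *(2)] by blast+
  have "continuous_on {0..L} (\<lambda>x. P1 x *\<^sub>R dv L w x + P x *\<^sub>R dv L (dv L w) x)"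
    by (intro continuous_intros P1_cont P_cont Sob_2_D(3)[OF w1 L] Sob_2_D(4)[OF w1 L])
  then show "continuous_on {0..L} (flux_d L P w)"
    by (rule continuous_on_eq) (rule flux(1)[OF *(2), symmetric])
  \<comment> \<open>The left side is the eta component of A z, so this is the equation eta' = u w -
    a v(0).\<close>
  show "flux_d L P w 0 - u v /\<^sub>R b = u w - a *\<^sub>R v 0"
    using b by (simp add: *(5) Fbd_def u_def \<theta>1 \<theta>2 scaleR_conv_of_real field_simps)
qed

lemma flux_0: "P 0 *\<^sub>R dv L w 0 = k *\<^sub>R (u w - \<theta>3 *\<^sub>R w 0)"
  using k by (simp add: u_def)

text \<open>E z (A z) is half the time derivative of E z z along the flow, and likewise for R.\<close>
lemma E_A:
  assumes "z \<in> Dom" "z = (w, v, \<xi>, \<psi>)"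
  shows "E z (A z) = - k * \<sigma> * (a * (cmod (v 0))\<^sup>2 + (cmod (u w))\<^sup>2 / b)"
proof -
  note z = dom_D[OF assms(1)[unfolded assms(2)]]
  note h = H_D[OF z(1)]
  let ?q = "flux_d L P w"
  have "ip L (\<lambda>x. P x *\<^sub>R dv L w x) (dv L v) + ip L ?q v =
      (P L *\<^sub>R dv L w L) \<bullet> v L - (P 0 *\<^sub>R dv L w 0) \<bullet> v 0"
    by (rule ip_by_parts[OF L z(4) z(6)]) (use Sob_2_D[OF z(3) L] in auto)
  then have 1: "ip L (\<lambda>x. P x *\<^sub>R dv L w x) (dv L v) + ip L v (restr L ?q) =
      P L * (dv L w L \<bullet> v L) - k * ((u w - \<theta>3 *\<^sub>R w 0) \<bullet> v 0)"
    using ip_cong[of L v v "restr L ?q" ?q] ip_sym[of L ?q v] by (simp add: flux_0 restr_def)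
  have "E z (A z) = ip L (\<lambda>x. P x *\<^sub>R dv L w x) (dv L v) + ip L v (restr L ?q) - P L * (v L \<bullet> dv L w L)
     - k * \<theta>3 * (w 0 \<bullet> v 0) + k * \<sigma> * ((v 0 - u w /\<^sub>R b) \<bullet> (u w - a *\<^sub>R v 0))"
    using z(8,9) h(3,4) by (simp add: assms(2) E_def Aop_def)
  \<comment> \<open>The flux at L cancels against the term of the tip mass, and the w(0) part of the
    flux at 0 against the term of E in w(0); only the product of u w and v(0) is left.\<close>
  also have "\<dots> = - k * (u w \<bullet> v 0) + k * \<sigma> * ((v 0 - u w /\<^sub>R b) \<bullet> (u w - a *\<^sub>R v 0))"
    unfolding 1 by (simp add: inner_diff_left inner_commute algebra_simps)
  also have "(v 0 - u w /\<^sub>R b) \<bullet> (u w - a *\<^sub>R v 0) =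
      (a + b) / b * (u w \<bullet> v 0) - a * (v 0 \<bullet> v 0) - (u w \<bullet> u w) / b"
    using b by (simp add: inner_diff_left inner_diff_right inner_commute field_simps)
  finally have 2: "E z (A z) = - k * (u w \<bullet> v 0) +
    k * \<sigma> * ((a + b) / b * (u w \<bullet> v 0) - a * (v 0 \<bullet> v 0) - (u w \<bullet> u w) / b)" .
  have "\<sigma> * ((a + b) / b) = 1" using \<sigma>(2) b by simp
  moreover have "k * \<sigma> * ((a + b) / b * (u w \<bullet> v 0)) = k * (\<sigma> * ((a + b) / b)) * (u w \<bullet> v 0)"
    by (simp only: mult_ac)
  ultimately have "k * \<sigma> * ((a + b) / b * (u w \<bullet> v 0)) = k * (u w \<bullet> v 0)" by simp
  then show ?thesis unfolding 2 power2_norm_eq_inner by (simp only: right_diff_distrib) (simp add: algebra_simps)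
qed

text \<open>Testing the wave equation with exp(-K x) w' gains the interior energy and |v(L)|^2 at
  the price of the energy density at 0, where E dissipates. The part with \<beta> contributes
  \<beta> k \<theta>3 |w(0)|^2, which is negative because \<theta>3 < 0.\<close>

lemma R_A:
  assumes "z \<in> Dom" "z = (w, v, \<xi>, \<psi>)" and K: "K \<ge> 1" "\<And>x. x \<in> {0..L} \<Longrightarrow> K * P x + P1 x \<ge> P x"
  shows "R K \<beta> z (A z) \<le> \<beta> * (v 0 \<bullet> M v \<xi> - k * (w 0 \<bullet> (u w - \<theta>3 *\<^sub>R w 0)))
    - exp (- K * L) / 2 * (ip L (\<lambda>x. P x *\<^sub>R dv L w x) (dv L w) + ip L v v + (cmod (v L))\<^sup>2)
    + ((cmod (v 0))\<^sup>2 + P 0 * (cmod (dv L w 0))\<^sup>2) / 2"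
proof -
  note z = dom_D[OF assms(1)[unfolded assms(2)]]
  note h = H_D[OF z(1)]
  let ?q = "flux_d L P w"
  let ?w1 = "dv L w" let ?w2 = "dv L (dv L w)" let ?v1 = "dv L v"
  note w1 = Sob_2_D[OF z(2) L] and v1 = Sob_2_D[OF z(3) L]
  define e where "e x = exp (- K * x)" for x
  have e_cont: "continuous_on {0..L} e" unfolding e_def by (intro continuous_intros)
  \<comment> \<open>Its derivative is twice the integrand of the multiplier term minus a remainder
    produced by the decay of e. The remainder is positive because K P + P' \<ge> P.\<close>
  define f where "f x = e x * (v x \<bullet> v x + P x * (?w1 x \<bullet> ?w1 x))" for x
  define I where "I = ip L (\<lambda>x. P x *\<^sub>R ?w1 x) ?w1 + ip L v v"
  note cont = e_cont w1(3,4) v1(3,4) P_cont P1_cont z(6)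
  have df: "(f has_vector_derivative
      2 * (e x * (v x \<bullet> ?v1 x) + e x * (?q x \<bullet> ?w1 x)) -
      e x * (K * (v x \<bullet> v x) + (K * P x + P1 x) * (?w1 x \<bullet> ?w1 x))) (at x within {0..L})"
    if x: "x \<in> {0..L}" for x
  proof -
    have 1: "(e has_vector_derivative - K * e x) (at x within {0..L})"
      unfolding e_def has_real_derivative_iff_has_vector_derivative[symmetric]
      by (auto intro!: derivative_eq_intros)
    note 2 = bounded_bilinear.has_vector_derivative[OF bounded_bilinear_inner v1(5)[OF x] v1(5)[OF x]]
    note 3 = bounded_bilinear.has_vector_derivative[OF bounded_bilinear_inner w1(5)[OF x] w1(5)[OF x]]
    note 4 = bounded_bilinear.has_vector_derivative[OF bounded_bilinear_mult P_deriv[OF x] 3]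
    note 5 = bounded_bilinear.has_vector_derivative[OF bounded_bilinear_mult 1 has_vector_derivative_add[OF 2 4]]
    show ?thesis
      unfolding f_def
      by (rule has_vector_derivative_eq_rhs[OF 5]) (simp add: z(5)[OF x] inner_add_left inner_commute algebra_simps)
  qed
  have i1: "((\<lambda>x. 2 * (e x * (v x \<bullet> ?v1 x) + e x * (?q x \<bullet> ?w1 x)) -
      e x * (K * (v x \<bullet> v x) + (K * P x + P1 x) * (?w1 x \<bullet> ?w1 x))) has_integral (f L - f 0)) {0..L}"
    by (rule fundamental_theorem_of_calculus) (use L df in auto)
  have "(\<lambda>x. e x * (K * (v x \<bullet> v x) + (K * P x + P1 x) * (?w1 x \<bullet> ?w1 x))) integrable_on {0..L}"
    by (intro integrable_continuous_real continuous_intros cont)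
  note i2 = integrable_integral[OF this]
  have 1: "integral {0..L} (\<lambda>x. 2 * (e x * (v x \<bullet> ?v1 x) + e x * (?q x \<bullet> ?w1 x))) =
     (f L - f 0) + integral {0..L} (\<lambda>x. e x * (K * (v x \<bullet> v x) + (K * P x + P1 x) * (?w1 x \<bullet> ?w1 x)))"
    using integral_unique[OF has_integral_add[OF i1 i2]] by (simp only: diff_add_cancel)
  \<comment> \<open>The weight is smallest at L; bounding it below by e L costs only the constant
    factor exp(-K L).\<close>
  have i3: "integral {0..L} (\<lambda>x. e L * ((P x *\<^sub>R ?w1 x) \<bullet> ?w1 x + v x \<bullet> v x)) \<le>
     integral {0..L} (\<lambda>x. e x * (K * (v x \<bullet> v x) + (K * P x + P1 x) * (?w1 x \<bullet> ?w1 x)))"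
  proof (rule integral_le)
    fix x assume x: "x \<in> {0..L}"
    have "(P x *\<^sub>R ?w1 x) \<bullet> ?w1 x + v x \<bullet> v x \<le> K * (v x \<bullet> v x) + (K * P x + P1 x) * (?w1 x \<bullet> ?w1 x)"
      using mult_right_mono[OF K(2)[OF x], of "?w1 x \<bullet> ?w1 x"] mult_right_mono[OF K(1), of "v x \<bullet> v x"] by simp
    moreover have "0 \<le> (P x *\<^sub>R ?w1 x) \<bullet> ?w1 x + v x \<bullet> v x"
      using P_pos[OF x] by simp
    moreover have "e L \<le> e x" "0 \<le> e x" using x K(1) by (simp_all add: e_def)
    ultimately show "e L * ((P x *\<^sub>R ?w1 x) \<bullet> ?w1 x + v x \<bullet> v x) \<le>
        e x * (K * (v x \<bullet> v x) + (K * P x + P1 x) * (?w1 x \<bullet> ?w1 x))"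
      by (intro mult_mono) auto
  qed (intro integrable_continuous_real continuous_intros cont)+
  have i4: "integral {0..L} (\<lambda>x. e L * ((P x *\<^sub>R ?w1 x) \<bullet> ?w1 x + v x \<bullet> v x)) = e L * I"
    unfolding I_def ip_def integral_mult_right
    by (subst Henstock_Kurzweil_Integration.integral_add)
       (intro integrable_continuous_real continuous_intros cont refl)+
  have 2: "f L - f 0 + e L * I \<le> integral {0..L} (\<lambda>x. 2 * (e x * (v x \<bullet> ?v1 x) + e x * (?q x \<bullet> ?w1 x)))"
    unfolding 1 i4[symmetric] by (rule add_left_mono[OF i3])
  have "ip L (\<lambda>x. e x *\<^sub>R restr L ?q x) ?w1 = ip L (\<lambda>x. e x *\<^sub>R ?q x) ?w1"
    by (rule ip_cong) (simp_all add: restr_def)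
  moreover have "ip L (\<lambda>x. e x *\<^sub>R v x) ?v1 + ip L (\<lambda>x. e x *\<^sub>R ?q x) ?w1 =
      integral {0..L} (\<lambda>x. e x * (v x \<bullet> ?v1 x) + e x * (?q x \<bullet> ?w1 x))"
    unfolding ip_def inner_scaleR_left
    by (rule Henstock_Kurzweil_Integration.integral_add[symmetric]) (intro integrable_continuous_real continuous_intros cont)+
  ultimately have "ip L (\<lambda>x. e x *\<^sub>R v x) ?v1 + ip L (\<lambda>x. e x *\<^sub>R restr L ?q x) ?w1 =
      integral {0..L} (\<lambda>x. e x * (v x \<bullet> ?v1 x) + e x * (?q x \<bullet> ?w1 x))" by (simp only:)
  then have 3: "f L - f 0 + e L * I \<le> 2 * (ip L (\<lambda>x. e x *\<^sub>R v x) ?v1 + ip L (\<lambda>x. e x *\<^sub>R restr L ?q x) ?w1)"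
    using 2 unfolding integral_mult_right by (simp only:)
  \<comment> \<open>At L only |v(L)|^2 is kept; it pays for the tip mass in E.\<close>
  have fL: "f L \<ge> e L * (cmod (v L))\<^sup>2"
    using P_pos[of L] L by (simp add: f_def e_def power2_norm_eq_inner)
  have f0: "f 0 = (cmod (v 0))\<^sup>2 + P 0 * (cmod (?w1 0))\<^sup>2"
    by (simp add: f_def e_def power2_norm_eq_inner)
  have "integral {0..L} (restr L ?q) = integral {0..L} ?q"
    by (rule integral_cong) (simp add: restr_def)
  also have "\<dots> = P L *\<^sub>R ?w1 L - P 0 *\<^sub>R ?w1 0"
    by (rule integral_unique, rule fundamental_theorem_of_calculus) (use L z(4) in auto)
  \<comment> \<open>The flux at L cancels against P(L) times - w'(L), the last entry of
    \<open>M\<close> here; this fixes the weight P(L) in \<open>M\<close>.\<close>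
  finally have "M (restr L ?q) (- ?w1 L) = - k *\<^sub>R (u w - \<theta>3 *\<^sub>R w 0)"
    by (simp add: M_def flux_0)
  then have "R K \<beta> z (A z) = \<beta> * (v 0 \<bullet> M v \<xi> - k * (w 0 \<bullet> (u w - \<theta>3 *\<^sub>R w 0)))
      - (ip L (\<lambda>x. e x *\<^sub>R v x) ?v1 + ip L (\<lambda>x. e x *\<^sub>R restr L ?q x) ?w1)"
    by (simp add: assms(2) R_def Aop_def e_def)
  moreover have "e L / 2 * (I + (cmod (v L))\<^sup>2) - ((cmod (v 0))\<^sup>2 + P 0 * (cmod (?w1 0))\<^sup>2) / 2 \<le>
      ip L (\<lambda>x. e x *\<^sub>R v x) ?v1 + ip L (\<lambda>x. e x *\<^sub>R restr L ?q x) ?w1"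
    using 3 fL f0 by (simp add: field_simps)
  ultimately show ?thesis unfolding I_def[symmetric] e_def[of L, symmetric] by linarith
qed

section \<open>Comparison of the forms, and the dissipation inequality\<close>

lemma ip_weight:
  assumes f: "continuous_on {0..L} f"
  shows "P0 * ip L f f \<le> ip L (\<lambda>x. P x *\<^sub>R f x) f"
    "(\<And>x. x \<in> {0..L} \<Longrightarrow> P x \<le> C) \<Longrightarrow> ip L (\<lambda>x. P x *\<^sub>R f x) f \<le> C * ip L f f"
proof -
  have "integral {0..L} (\<lambda>x. P0 * (f x \<bullet> f x)) \<le> ip L (\<lambda>x. P x *\<^sub>R f x) f"
    unfolding ip_def
  proof (rule integral_le)
    fix x assume "x \<in> {0..L}"
    from mult_right_mono[OF P_ge[OF this]] show "P0 * (f x \<bullet> f x) \<le> (P x *\<^sub>R f x) \<bullet> f x" by simp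
  qed (intro integrable_continuous_real continuous_intros f P_cont)+
  then show "P0 * ip L f f \<le> ip L (\<lambda>x. P x *\<^sub>R f x) f" by (simp add: ip_def)
  assume C: "\<And>x. x \<in> {0..L} \<Longrightarrow> P x \<le> C"
  have "ip L (\<lambda>x. P x *\<^sub>R f x) f \<le> integral {0..L} (\<lambda>x. C * (f x \<bullet> f x))"
    unfolding ip_def
  proof (rule integral_le)
    fix x assume "x \<in> {0..L}"
    from mult_right_mono[OF C[OF this]] show "(P x *\<^sub>R f x) \<bullet> f x \<le> C * (f x \<bullet> f x)" by simp
  qed (intro integrable_continuous_real continuous_intros f P_cont)+
  then show "ip L (\<lambda>x. P x *\<^sub>R f x) f \<le> C * ip L f f" by (simp add: ip_def)
qed

lemma ip_nonneg: "continuous_on {0..L} f \<Longrightarrow> 0 \<le> ip L f f"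
  using L2.nonneg[of f L] L2fun_continuous by simp

lemma P_end: "P 0 > 0" "P L > 0"
  using P_pos L by auto

lemma E_self:
  "E (w, v, \<xi>, \<psi>) (w, v, \<xi>, \<psi>) = ip L (\<lambda>x. P x *\<^sub>R dv L w x) (dv L w) + ip L v v + P L * (cmod \<xi>)\<^sup>2
     + k * (- \<theta>3) * (cmod (w 0))\<^sup>2 + k * \<sigma> * (cmod (\<psi> - u w /\<^sub>R b))\<^sup>2"
  by (simp add: E_def power2_norm_eq_inner)

lemma E_parts:
  assumes "z \<in> Hsp L" "z = (w, v, \<xi>, \<psi>)"
  shows "P0 * ip L (dv L w) (dv L w) \<le> E z z" "ip L (\<lambda>x. P x *\<^sub>R dv L w x) (dv L w) \<le> E z z" "ip L v v \<le> E z z" "P L * (cmod \<xi>)\<^sup>2 \<le> E z z"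
    "k * (- \<theta>3) * (cmod (w 0))\<^sup>2 \<le> E z z" "k * \<sigma> * (cmod (\<psi> - u w /\<^sub>R b))\<^sup>2 \<le> E z z"
    "ip L v v + P L * (cmod \<xi>)\<^sup>2 \<le> E z z" "0 \<le> E z z" "0 \<le> ip L (\<lambda>x. P x *\<^sub>R dv L w x) (dv L w)"
proof -
  note h = H_D[OF assms(1)[unfolded assms(2)]]
  note w = ip_weight(1)[OF h(6)]
  have kt: "0 < k * (- \<theta>3)" using k(1) \<theta>3 by (intro mult_pos_pos) auto
  note n = mult_nonneg_nonneg[OF less_imp_le[OF P0] ip_nonneg[OF h(6)]] ip_nonneg[OF h(7)]
    mult_nonneg_nonneg[OF less_imp_le[OF P_end(2)] zero_le_power2[of "cmod \<xi>"]]
    mult_nonneg_nonneg[OF less_imp_le[OF kt] zero_le_power2[of "cmod (w 0)"]]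
    mult_nonneg_nonneg[OF mult_nonneg_nonneg[OF less_imp_le[OF k(1)] less_imp_le[OF \<sigma>(1)]]
      zero_le_power2[of "cmod (\<psi> - u w /\<^sub>R b)"]]
  show "P0 * ip L (dv L w) (dv L w) \<le> E z z" "ip L (\<lambda>x. P x *\<^sub>R dv L w x) (dv L w) \<le> E z z"
    "ip L v v \<le> E z z" "P L * (cmod \<xi>)\<^sup>2 \<le> E z z"
    "k * (- \<theta>3) * (cmod (w 0))\<^sup>2 \<le> E z z" "k * \<sigma> * (cmod (\<psi> - u w /\<^sub>R b))\<^sup>2 \<le> E z z"
    "ip L v v + P L * (cmod \<xi>)\<^sup>2 \<le> E z z" "0 \<le> E z z" "0 \<le> ip L (\<lambda>x. P x *\<^sub>R dv L w x) (dv L w)"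
    unfolding assms(2) E_self using n w by linarith+
qed

lemma M_bound:
  assumes "continuous_on {0..L} v"
  shows "(cmod (M v \<xi>))\<^sup>2 \<le> (2 * L + 2 * P L) * (ip L v v + P L * (cmod \<xi>)\<^sup>2)"
proof -
  have "(cmod (M v \<xi>))\<^sup>2 \<le> 2 * (cmod (integral {0..L} v))\<^sup>2 + 2 * (cmod (P L *\<^sub>R \<xi>))\<^sup>2"
    unfolding M_def by (rule cmod_add_square)
  also have "\<dots> \<le> 2 * (L * ip L v v) + 2 * (P L * (P L * (cmod \<xi>)\<^sup>2))"
    using integral_norm_square_le[OF L2fun_continuous[OF assms], of L] L
    by (intro add_mono mult_left_mono) (simp_all add: power2_eq_square abs_of_pos[OF P_end(2)])
  also have "\<dots> \<le> (2 * L + 2 * P L) * (ip L v v + P L * (cmod \<xi>)\<^sup>2)"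
  proof -
    have "0 \<le> P L * ip L v v" "0 \<le> L * (P L * (cmod \<xi>)\<^sup>2)"
      using ip_nonneg[OF assms] P_end L by auto
    then show ?thesis by (simp add: algebra_simps)
  qed
  finally show ?thesis .
qed

text \<open>Every factor in R is controlled by E, so n E + R is equivalent to E as soon as n exceeds
  c.\<close>

lemma R_bound:
  assumes "K \<ge> 0" "\<beta> \<ge> 0"
  obtains c where "c \<ge> 0" "\<And>z. z \<in> Hsp L \<Longrightarrow> \<bar>R K \<beta> z z\<bar> \<le> c * E z z"
proof -
  define c where "c = \<beta> * (1 / (k * (- \<theta>3)) + (2 * L + 2 * P L)) + (1 + 1 / P0)"
  have kt: "k * (- \<theta>3) > 0" using k \<theta>3 by (simp add: mult_pos_neg)
  then have "c \<ge> 0" using assms(2) L P_end P0 unfolding c_def by (intro add_nonneg_nonneg mult_nonneg_nonneg) auto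
  moreover have "\<bar>R K \<beta> z z\<bar> \<le> c * E z z" if zH: "z \<in> Hsp L" for z
  proof -
    obtain w v \<xi> \<psi> where z: "z = (w, v, \<xi>, \<psi>)" by (cases z)
    note h = H_D[OF zH[unfolded z]] and e = E_parts[OF zH z]
    have 1: "(cmod (w 0))\<^sup>2 \<le> 1 / (k * (- \<theta>3)) * E z z"
      using e(5) kt by (simp add: field_simps)
    have "(cmod (M v \<xi>))\<^sup>2 \<le> (2 * L + 2 * P L) * (ip L v v + P L * (cmod \<xi>)\<^sup>2)"
      by (rule M_bound[OF h(7)])
    also have "\<dots> \<le> (2 * L + 2 * P L) * E z z"
      by (rule mult_left_mono[OF e(7)]) (use L P_end in simp)
    finally have "(cmod (M v \<xi>))\<^sup>2 \<le> (2 * L + 2 * P L) * E z z" .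
    with 1 inner_le_squares[of "w 0" "M v \<xi>"]
    have 2: "2 * \<bar>w 0 \<bullet> M v \<xi>\<bar> \<le> (1 / (k * (- \<theta>3)) + (2 * L + 2 * P L)) * E z z"
      unfolding distrib_right[of "1 / (k * (- \<theta>3))"] by linarith
    have "\<bar>2 * ip L (\<lambda>x. exp (- K * x) *\<^sub>R v x) (dv L w)\<bar> \<le> integral {0..L} (\<lambda>x. v x \<bullet> v x + dv L w x \<bullet> dv L w x)"
      unfolding ip_def integral_mult_right[symmetric] real_norm_def[symmetric]
    proof (rule integral_norm_bound_integral)
      fix x assume x: "x \<in> {0..L}"
      have "\<bar>exp (- K * x)\<bar> \<le> 1" using x assms(1) by simp
      then have "\<bar>exp (- K * x)\<bar> * (2 * \<bar>v x \<bullet> dv L w x\<bar>) \<le> 1 * ((cmod (v x))\<^sup>2 + (cmod (dv L w x))\<^sup>2)"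
        by (intro mult_mono inner_le_squares) auto
      then show "norm (2 * ((exp (- K * x) *\<^sub>R v x) \<bullet> dv L w x)) \<le> v x \<bullet> v x + dv L w x \<bullet> dv L w x"
        by (simp add: abs_mult power2_norm_eq_inner mult_ac)
    qed (intro integrable_continuous_real continuous_intros h)+
    also have "\<dots> = ip L v v + ip L (dv L w) (dv L w)"
      unfolding ip_def by (rule Henstock_Kurzweil_Integration.integral_add) (intro integrable_continuous_real continuous_intros h)+
    also have "\<dots> \<le> (1 + 1 / P0) * E z z"
    proof -
      have "ip L (dv L w) (dv L w) \<le> 1 / P0 * E z z" using e(1) P0 by (simp add: field_simps)
      then show ?thesis using e(3) by (simp add: distrib_right)
    qed
    finally have 3: "\<bar>2 * ip L (\<lambda>x. exp (- K * x) *\<^sub>R v x) (dv L w)\<bar> \<le> (1 + 1 / P0) * E z z" .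
    have "R K \<beta> z z = \<beta> * (2 * (w 0 \<bullet> M v \<xi>)) - 2 * ip L (\<lambda>x. exp (- K * x) *\<^sub>R v x) (dv L w)"
      by (simp add: z R_def)
    then have "\<bar>R K \<beta> z z\<bar> \<le> \<beta> * (2 * \<bar>w 0 \<bullet> M v \<xi>\<bar>) + \<bar>2 * ip L (\<lambda>x. exp (- K * x) *\<^sub>R v x) (dv L w)\<bar>"
      using assms(2) abs_triangle_ineq4[of "\<beta> * (2 * (w 0 \<bullet> M v \<xi>))" "2 * ip L (\<lambda>x. exp (- K * x) *\<^sub>R v x) (dv L w)"]
      by (simp only: abs_mult[of \<beta>] abs_mult[of 2 "w 0 \<bullet> M v \<xi>"] abs_of_nonneg abs_numeral)
    also have "\<dots> \<le> \<beta> * ((1 / (k * (- \<theta>3)) + (2 * L + 2 * P L)) * E z z) + (1 + 1 / P0) * E z z"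
      by (intro add_mono mult_left_mono 2 3 assms(2))
    also have "\<dots> = c * E z z" by (simp add: c_def distrib_right mult.assoc)
    finally show ?thesis .
  qed
  ultimately show ?thesis using that by blast
qed

text \<open>First beta is chosen such that the term in |w(0)|^2 becomes negative, then n such that the energy
  dissipation at 0 absorbs the remaining boundary terms.\<close>
lemma dissipation:
  obtains n K \<beta> \<kappa> C where "\<kappa> > 0" "C \<ge> 0"
    "\<forall>z\<in>Hsp L. E z z \<le> n * E z z + R K \<beta> z z"
    "\<forall>z\<in>Hsp L. n * E z z + R K \<beta> z z \<le> C * E z z"
    "\<forall>z\<in>Dom. n * E z (A z) + R K \<beta> z (A z) \<le> - \<kappa> * (n * E z z + R K \<beta> z z)"
proof -
  obtain C where C: "C \<ge> 1" "\<And>x. x \<in> {0..L} \<Longrightarrow> P x \<le> C" "\<And>x. x \<in> {0..L} \<Longrightarrow> \<bar>P1 x\<bar> \<le> C"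
    using P_bound by blast
  \<comment> \<open>C \<le> (C / P0) P, so K P absorbs P' and still leaves P.\<close>
  define K where "K = 1 + C / P0"
  have K: "K \<ge> 1" "K * P x + P1 x \<ge> P x" if "x \<in> {0..L}" for x
  proof -
    show "K \<ge> 1" using C(1) P0 by (simp add: K_def)
    have "C = C / P0 * P0" using P0 by simp
    also have "\<dots> \<le> C / P0 * P x" using P_ge[OF that] C(1) P0 by (intro mult_left_mono) auto
    finally show "K * P x + P1 x \<ge> P x" using C(3)[OF that] by (simp add: K_def distrib_right)
  qed
  have K1: "K \<ge> 1" using K(1)[of 0] L by simp
  define \<tau> where "\<tau> = - \<theta>3"
  have \<tau>: "\<tau> > 0" using \<theta>3 by (simp add: \<tau>_def)
  define \<gamma> where "\<gamma> = exp (- K * L)"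
  have \<gamma>: "\<gamma> > 0" by (simp add: \<gamma>_def)
  \<comment> \<open>The boundary term P(0) |w'(0)|^2 of \<open>R_A\<close> equals q |u w - \<theta>3
    w(0)|^2.\<close>
  define q where "q = k\<^sup>2 / P 0"
  have q: "q > 0" using k(1) P_end(1) by (simp add: q_def)
  \<comment> \<open>The available gain is \<beta> k \<tau> W0^2. One half of it pays for the product
    W0 U, a further q \<tau>^2 W0^2 for the flux at 0, and W0^2 is left.\<close>
  define \<beta> where "\<beta> = 2 * (q * \<tau>\<^sup>2 + 1) / (k * \<tau>)"
  have \<beta>: "\<beta> > 0" "\<beta> * (k * \<tau>) = 2 * (q * \<tau>\<^sup>2 + 1)"
    using q k(1) \<tau> by (simp_all add: \<beta>_def add_pos_pos)
  define cM where "cM = (2 * L + 2 * P L) * (1 + P L)"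
  have cM: "cM > 0" using L P_end(2) by (simp add: cM_def)
  obtain c where c: "c \<ge> 0" "\<And>z. z \<in> Hsp L \<Longrightarrow> \<bar>R K \<beta> z z\<bar> \<le> c * E z z"
    using R_bound[of K \<beta>] K1 \<beta> by auto
  \<comment> \<open>cA and cU are the prices in V^2 and U^2. The quotient in cA comes from splitting
    the product V m against the interior gain; the 2 covers V^2 / 2 from \<open>R_A\<close> and
    leaves at least V^2. In cU the summands belong to W0 U, to the flux at 0, and to the U^2 that is
    left.\<close>
  define cA where "cA = \<beta>\<^sup>2 * cM / \<gamma> + 2"
  define cU where "cU = \<beta> * k / (2 * \<tau>) + q + 1"
  \<comment> \<open>1 + c makes W dominate E; each of the other two summands lets the dissipation of
    E absorb one of cA V^2 and cU U^2.\<close>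
  define n where "n = 1 + c + cA / (k * \<sigma> * a) + cU * b / (k * \<sigma>)"
  have pos: "k * \<sigma> * a > 0" "k * \<sigma> > 0" "cA > 0" "cU > 0"
    using k(1) \<sigma>(1) a \<beta> cM \<gamma> \<tau> q by (auto simp: cA_def cU_def add_pos_pos)
  have n: "n \<ge> 1 + c" "n * (k * \<sigma> * a) \<ge> cA" "n * (k * \<sigma>) / b \<ge> cU"
  proof -
    have t: "0 \<le> cA / (k * \<sigma> * a)" "0 \<le> cU * b / (k * \<sigma>)" using pos b by simp_all
    then show "n \<ge> 1 + c" by (simp add: n_def)
    have "cA / (k * \<sigma> * a) \<le> n" "cU * b / (k * \<sigma>) \<le> n" using t c(1) unfolding n_def by linarith+
    then show "n * (k * \<sigma> * a) \<ge> cA" "n * (k * \<sigma>) / b \<ge> cU"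
      using pos b by (simp_all add: pos_divide_le_eq pos_le_divide_eq)
  qed
  have n0: "n \<ge> 0" using n(1) c(1) by linarith
  \<comment> \<open>After absorption at least \<delta> times I + X + V^2 + W0^2 + U^2 is dissipated,
    and \<open>cE\<close> bounds E by the same sum; hence the rate \<delta> / (cE (n + c)).\<close>
  define \<delta> where "\<delta> = min (\<gamma> / 4) 1"
  have \<delta>: "\<delta> > 0" "\<delta> \<le> \<gamma> / 4" "\<delta> \<le> 1" using \<gamma> by (auto simp: \<delta>_def)
  define cE where "cE = 1 + P L + k * \<tau> + k * \<sigma> * (2 + 2 / b\<^sup>2)"
  have "k * \<sigma> * (2 + 2 / b\<^sup>2) > 0" using pos(2) b by (simp add: add_pos_pos)
  then have cE: "cE > 0" "1 \<le> cE" "P L \<le> cE" "k * \<tau> \<le> cE" "k * \<sigma> * (2 + 2 / b\<^sup>2) \<le> cE"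
    using P_end(2) mult_pos_pos[OF k(1) \<tau>] unfolding cE_def by linarith+
  show ?thesis
  proof
    show "\<delta> / (cE * (n + c)) > 0" using \<delta> cE n c by simp
    show "n + c \<ge> 0" using n0 c(1) by simp
    show "\<forall>z\<in>Hsp L. E z z \<le> n * E z z + R K \<beta> z z"
    proof
      fix z assume zH: "z \<in> Hsp L"
      have e: "0 \<le> E z z" using E_parts(8)[OF zH] by (cases z) auto
      have "(1 + c) * E z z \<le> n * E z z" by (rule mult_right_mono[OF n(1) e])
      then show "E z z \<le> n * E z z + R K \<beta> z z"
        using c(2)[OF zH] by (simp add: distrib_right)
    qed
    show W: "\<forall>z\<in>Hsp L. n * E z z + R K \<beta> z z \<le> (n + c) * E z z"
    proof
      fix z assume zH: "z \<in> Hsp L"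
      show "n * E z z + R K \<beta> z z \<le> (n + c) * E z z"
        using c(2)[OF zH] by (simp add: distrib_right)
    qed
    show "\<forall>z\<in>Dom. n * E z (A z) + R K \<beta> z (A z) \<le> - (\<delta> / (cE * (n + c))) * (n * E z z + R K \<beta> z z)"
    proof
      fix z assume zD: "z \<in> Dom"
      obtain w v \<xi> \<psi> where z: "z = (w, v, \<xi>, \<psi>)" by (cases z)
      have zH: "z \<in> Hsp L" using dom_D(1) zD unfolding z .
      note h = H_D[OF zH[unfolded z]]
      define I where "I = ip L (\<lambda>x. P x *\<^sub>R dv L w x) (dv L w) + ip L v v"
      define X where "X = (cmod (v L))\<^sup>2"
      define V where "V = cmod (v 0)"
      define U where "U = cmod (u w)"
      define W0 where "W0 = cmod (w 0)"
      define m where "m = cmod (M v \<xi>)"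
      have I: "I \<ge> 0" "X \<ge> 0" "ip L v v \<le> I"
        using E_parts(9)[OF zH z] ip_nonneg[OF h(7)] by (auto simp: I_def X_def)
      have 1: "v 0 \<bullet> M v \<xi> \<le> V * m"
        using Cauchy_Schwarz_ineq2[of "v 0" "M v \<xi>"] by (simp add: V_def m_def)
      have 2: "- (w 0 \<bullet> (u w - \<theta>3 *\<^sub>R w 0)) \<le> W0 * U - \<tau> * W0\<^sup>2"
        using Cauchy_Schwarz_ineq2[of "w 0" "u w"]
        by (simp add: W0_def U_def \<tau>_def inner_diff_right power2_norm_eq_inner)
      have 3: "P 0 * (cmod (dv L w 0))\<^sup>2 \<le> 2 * q * (U\<^sup>2 + \<tau>\<^sup>2 * W0\<^sup>2)"
      proof -
        have "P 0 * cmod (dv L w 0) = k * cmod (u w - \<theta>3 *\<^sub>R w 0)"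
          using arg_cong[OF flux_0[of w], of cmod] P_end k by simp
        then have "(P 0)\<^sup>2 * (cmod (dv L w 0))\<^sup>2 = k\<^sup>2 * (cmod (u w - \<theta>3 *\<^sub>R w 0))\<^sup>2"
          by (metis power_mult_distrib)
        also have "\<dots> \<le> k\<^sup>2 * (2 * U\<^sup>2 + 2 * (\<tau>\<^sup>2 * W0\<^sup>2))"
          using cmod_diff_square[of "u w" "\<theta>3 *\<^sub>R w 0"]
          by (intro mult_left_mono) (simp_all add: U_def W0_def \<tau>_def power_mult_distrib)
        finally show ?thesis using P_end(1) by (simp add: q_def field_simps power2_eq_square)
      qed
      have 4: "m\<^sup>2 \<le> cM * (I + X)"
      proof -
        have "m\<^sup>2 \<le> (2 * L + 2 * P L) * (ip L v v + P L * X)"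
          using M_bound[OF h(7), of \<xi>] h(3) by (simp add: m_def X_def)
        also have "ip L v v + P L * X \<le> (1 + P L) * (I + X)"
          using I mult_nonneg_nonneg[OF less_imp_le[OF P_end(2)] I(1)] by (simp add: distrib_left distrib_right)
        finally show ?thesis using L P_end(2) by (simp add: cM_def mult.assoc)
      qed
      have 5: "\<beta> * (V * m) \<le> \<gamma> / 4 * (I + X) + (cA - 2) * V\<^sup>2"
      proof -
        \<comment> \<open>Completed square, weighted so that m^2 consumes exactly \<gamma> / 4 (I +
          X), half of the interior gain.\<close>
        have "0 \<le> \<gamma> / (4 * cM) * (m - 2 * \<beta> * cM / \<gamma> * V)\<^sup>2" using \<gamma> cM by simp
        also have "\<dots> = \<gamma> / (4 * cM) * m\<^sup>2 - \<beta> * (V * m) + \<beta>\<^sup>2 * cM / \<gamma> * V\<^sup>2"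
          using \<gamma> cM by (simp add: power2_eq_square field_simps)
        finally have "\<beta> * (V * m) \<le> \<gamma> / (4 * cM) * m\<^sup>2 + (cA - 2) * V\<^sup>2" by (simp add: cA_def)
        also have "\<gamma> / (4 * cM) * m\<^sup>2 \<le> \<gamma> / (4 * cM) * (cM * (I + X))"
          using \<gamma> cM by (intro mult_left_mono 4) simp
        also have "\<dots> = \<gamma> / 4 * (I + X)" using cM by simp
        finally show ?thesis by simp
      qed
      have 6: "\<beta> * k * (W0 * U) \<le> (q * \<tau>\<^sup>2 + 1) * W0\<^sup>2 + \<beta> * k / (2 * \<tau>) * U\<^sup>2"
      proof -
        have "0 \<le> \<beta> * k / (2 * \<tau>) * (U - \<tau> * W0)\<^sup>2" using \<beta>(1) k(1) \<tau> by simp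
        also have "\<dots> = \<beta> * k / (2 * \<tau>) * U\<^sup>2 - \<beta> * k * (W0 * U) + (\<beta> * (k * \<tau>)) / 2 * W0\<^sup>2"
          using \<tau> by (simp add: power2_eq_square field_simps)
        also have "\<beta> * (k * \<tau>) / 2 = q * \<tau>\<^sup>2 + 1" unfolding \<beta>(2) by simp
        finally show ?thesis by linarith
      qed
      have "R K \<beta> z (A z) \<le> \<beta> * (v 0 \<bullet> M v \<xi> - k * (w 0 \<bullet> (u w - \<theta>3 *\<^sub>R w 0)))
          - \<gamma> / 2 * (I + X) + V\<^sup>2 / 2 + P 0 * (cmod (dv L w 0))\<^sup>2 / 2"
        using R_A[OF zD z K1 K(2), of \<beta>] by (simp add: \<gamma>_def I_def X_def V_def add_divide_distrib)
      also have "\<beta> * (v 0 \<bullet> M v \<xi> - k * (w 0 \<bullet> (u w - \<theta>3 *\<^sub>R w 0))) \<le>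
          \<beta> * (V * m) + \<beta> * (k * (W0 * U - \<tau> * W0\<^sup>2))"
      proof -
        have "k * (- (w 0 \<bullet> (u w - \<theta>3 *\<^sub>R w 0))) \<le> k * (W0 * U - \<tau> * W0\<^sup>2)"
          by (intro mult_left_mono 2 less_imp_le[OF k(1)])
        then have "v 0 \<bullet> M v \<xi> - k * (w 0 \<bullet> (u w - \<theta>3 *\<^sub>R w 0)) \<le> V * m + k * (W0 * U - \<tau> * W0\<^sup>2)"
          using 1 by simp
        then show ?thesis unfolding distrib_left[symmetric] by (intro mult_left_mono less_imp_le[OF \<beta>(1)])
      qed
      also have "\<beta> * (k * (W0 * U - \<tau> * W0\<^sup>2)) = \<beta> * k * (W0 * U) - 2 * (q * \<tau>\<^sup>2 + 1) * W0\<^sup>2"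
        unfolding \<beta>(2)[symmetric] by (simp add: algebra_simps)
      finally have R0: "R K \<beta> z (A z) \<le> \<beta> * (V * m) + (\<beta> * k * (W0 * U) - 2 * (q * \<tau>\<^sup>2 + 1) * W0\<^sup>2)
          - \<gamma> / 2 * (I + X) + V\<^sup>2 / 2 + P 0 * (cmod (dv L w 0))\<^sup>2 / 2" by simp
      have "2 * (q * \<tau>\<^sup>2 + 1) * W0\<^sup>2 = 2 * (q * \<tau>\<^sup>2 * W0\<^sup>2) + 2 * W0\<^sup>2"
        "2 * q * (U\<^sup>2 + \<tau>\<^sup>2 * W0\<^sup>2) = 2 * (q * U\<^sup>2) + 2 * (q * \<tau>\<^sup>2 * W0\<^sup>2)"
        "(q * \<tau>\<^sup>2 + 1) * W0\<^sup>2 = q * \<tau>\<^sup>2 * W0\<^sup>2 + W0\<^sup>2"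
        "(cA - 2) * V\<^sup>2 = cA * V\<^sup>2 - 2 * V\<^sup>2"
        "\<gamma> / 2 * (I + X) = 2 * (\<gamma> / 4 * (I + X))"
        by (simp_all add: algebra_simps)
      then have R: "R K \<beta> z (A z) \<le> - (\<gamma> / 4 * (I + X)) + (cA * V\<^sup>2 - V\<^sup>2) - W0\<^sup>2 + (q * U\<^sup>2 + \<beta> * k / (2 * \<tau>) * U\<^sup>2)"
        using R0 3 5 6 zero_le_power2[of V] by linarith
      have cU: "cU * U\<^sup>2 = \<beta> * k / (2 * \<tau>) * U\<^sup>2 + q * U\<^sup>2 + U\<^sup>2"
        by (simp add: cU_def algebra_simps)
      have nE: "n * E z (A z) = - (n * (k * \<sigma> * a)) * V\<^sup>2 - n * (k * \<sigma>) / b * U\<^sup>2"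
        unfolding E_A[OF zD z] by (simp add: V_def U_def algebra_simps)
      have "n * E z (A z) \<le> - (cA * V\<^sup>2) - cU * U\<^sup>2"
        unfolding nE using mult_right_mono[OF n(2), of "V\<^sup>2"] mult_right_mono[OF n(3), of "U\<^sup>2"] by simp
      with R cU have "n * E z (A z) + R K \<beta> z (A z) \<le> - (\<gamma> / 4 * (I + X)) - V\<^sup>2 - W0\<^sup>2 - U\<^sup>2"
        by linarith
      also have "\<dots> \<le> - (\<delta> * (I + X + V\<^sup>2 + W0\<^sup>2 + U\<^sup>2))"
      proof -
        have "\<delta> * (I + X) \<le> \<gamma> / 4 * (I + X)" "\<delta> * (V\<^sup>2 + W0\<^sup>2 + U\<^sup>2) \<le> 1 * (V\<^sup>2 + W0\<^sup>2 + U\<^sup>2)"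
          by (intro mult_right_mono \<delta>, use I in simp)+
        then have "\<delta> * (I + X) \<le> \<gamma> / 4 * (I + X)" "\<delta> * (V\<^sup>2 + W0\<^sup>2 + U\<^sup>2) \<le> V\<^sup>2 + W0\<^sup>2 + U\<^sup>2"
          by (simp_all only: mult_1_left)
        moreover have "\<delta> * (I + X + V\<^sup>2 + W0\<^sup>2 + U\<^sup>2) = \<delta> * (I + X) + \<delta> * (V\<^sup>2 + W0\<^sup>2 + U\<^sup>2)"
          by (simp add: algebra_simps)
        ultimately show ?thesis by linarith
      qed
      finally have D: "n * E z (A z) + R K \<beta> z (A z) \<le> - (\<delta> * (I + X + V\<^sup>2 + W0\<^sup>2 + U\<^sup>2))" .
      have "E z z \<le> I + P L * X + k * \<tau> * W0\<^sup>2 + k * \<sigma> * (2 + 2 / b\<^sup>2) * (V\<^sup>2 + U\<^sup>2)"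
      proof -
        have "(cmod (\<psi> - u w /\<^sub>R b))\<^sup>2 \<le> 2 * V\<^sup>2 + 2 / b\<^sup>2 * U\<^sup>2"
          using cmod_diff_square[of \<psi> "u w /\<^sub>R b"] h(4) b
          by (simp add: V_def U_def power_mult_distrib power_inverse divide_inverse)
        also have "\<dots> \<le> (2 + 2 / b\<^sup>2) * (V\<^sup>2 + U\<^sup>2)" using b by (simp add: algebra_simps)
        finally have "k * \<sigma> * (cmod (\<psi> - u w /\<^sub>R b))\<^sup>2 \<le> k * \<sigma> * ((2 + 2 / b\<^sup>2) * (V\<^sup>2 + U\<^sup>2))"
          by (intro mult_left_mono less_imp_le[OF pos(2)])
        then show ?thesis unfolding z E_self using h(3) by (simp add: I_def X_def \<tau>_def W0_def mult.assoc)
      qed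
      also have "\<dots> \<le> cE * I + cE * X + cE * W0\<^sup>2 + cE * (V\<^sup>2 + U\<^sup>2)"
        using I mult_right_mono[OF cE(2) I(1)] by (intro add_mono mult_right_mono cE) auto
      finally have Ele: "E z z \<le> cE * (I + X + V\<^sup>2 + W0\<^sup>2 + U\<^sup>2)" by (simp add: algebra_simps)
      have "n * E z z + R K \<beta> z z \<le> (n + c) * E z z" using W zH by blast
      also have "\<dots> \<le> (n + c) * (cE * (I + X + V\<^sup>2 + W0\<^sup>2 + U\<^sup>2))"
        using n0 c(1) by (intro mult_left_mono Ele) simp
      finally have "\<delta> / (cE * (n + c)) * (n * E z z + R K \<beta> z z) \<le>
          \<delta> / (cE * (n + c)) * ((n + c) * (cE * (I + X + V\<^sup>2 + W0\<^sup>2 + U\<^sup>2)))"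
        using \<delta>(1) cE(1) n0 c(1) by (intro mult_left_mono) simp_all
      also have "\<dots> = \<delta> * (I + X + V\<^sup>2 + W0\<^sup>2 + U\<^sup>2)"
        using cE(1) n(1) c(1) by simp
      finally show "n * E z (A z) + R K \<beta> z (A z) \<le> - (\<delta> / (cE * (n + c))) * (n * E z z + R K \<beta> z z)"
        using D by simp
    qed
  qed
qed

section \<open>The state norm as a graph norm, and density of the domain\<close>

lemma H_self:
  "H_form L (w, v, \<xi>, \<psi>) (w, v, \<xi>, \<psi>) = ip L w w + ip L (dv L w) (dv L w)
    + ip L (wderiv 0 L (dv L w)) (wderiv 0 L (dv L w)) + ip L v v + ip L (wderiv 0 L v) (wderiv 0 L v)
    + (cmod \<xi>)\<^sup>2 + (cmod \<psi>)\<^sup>2"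
  by (simp add: H_form_def power2_norm_eq_inner)

lemma H_parts:
  assumes "z \<in> Hsp L" "z = (w, v, \<xi>, \<psi>)"
  defines "N \<equiv> H_form L z z" and "c \<equiv> 4 / L + 6 * L"
  shows "ip L (dv L w) (dv L w) \<le> N" "ip L (wderiv 0 L (dv L w)) (wderiv 0 L (dv L w)) \<le> N" "ip L v v \<le> N"
    "ip L (wderiv 0 L v) (wderiv 0 L v) \<le> N" "(cmod \<xi>)\<^sup>2 \<le> N" "(cmod \<psi>)\<^sup>2 \<le> N"
    "(cmod (w 0))\<^sup>2 \<le> c * N" "(cmod (dv L w 0))\<^sup>2 \<le> c * N" "(cmod (dv L w L))\<^sup>2 \<le> c * N"
    "0 \<le> N" "(cmod (u w))\<^sup>2 \<le> (2 * \<theta>3\<^sup>2 + 2 * \<theta>4\<^sup>2) * c * N"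
proof -
  note h = H_D[OF assms(1)[unfolded assms(2)]]
  have n: "0 \<le> ip L w w" "0 \<le> ip L (dv L w) (dv L w)" "0 \<le> ip L v v"
    "0 \<le> ip L (wderiv 0 L (dv L w)) (wderiv 0 L (dv L w))" "0 \<le> ip L (wderiv 0 L v) (wderiv 0 L v)"
    using L2.nonneg[of _ L] L2fun_wderiv h L2fun_continuous[of L] by simp_all
  show 1: "ip L (dv L w) (dv L w) \<le> N" "ip L (wderiv 0 L (dv L w)) (wderiv 0 L (dv L w)) \<le> N" "ip L v v \<le> N"
    "ip L (wderiv 0 L v) (wderiv 0 L v) \<le> N" "(cmod \<xi>)\<^sup>2 \<le> N" "(cmod \<psi>)\<^sup>2 \<le> N" "0 \<le> N"
    unfolding N_def assms(2) H_self using n zero_le_power2[of "cmod \<xi>"] zero_le_power2[of "cmod \<psi>"] by linarith+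
  have c: "c \<ge> 0" using L by (simp add: c_def)
  have w: "ip L w w + ip L (wderiv 0 L w) (wderiv 0 L w) \<le> N"
    "ip L (dv L w) (dv L w) + ip L (wderiv 0 L (dv L w)) (wderiv 0 L (dv L w)) \<le> N"
    unfolding N_def assms(2) H_self ip_wderiv_dv[OF h(1) L]
    using n zero_le_power2[of "cmod \<xi>"] zero_le_power2[of "cmod \<psi>"] by linarith+
  show 2: "(cmod (w 0))\<^sup>2 \<le> c * N" "(cmod (dv L w 0))\<^sup>2 \<le> c * N" "(cmod (dv L w L))\<^sup>2 \<le> c * N"
    using trace_bound[OF h(9) _ L, of 0] trace_bound[OF h(8) _ L, of 0] trace_bound[OF h(8) _ L, of L]
      mult_left_mono[OF w(1) c] mult_left_mono[OF w(2) c] L unfolding c_def by auto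
  have "(cmod (u w))\<^sup>2 \<le> 2 * (cmod (\<theta>3 *\<^sub>R w 0))\<^sup>2 + 2 * (cmod (\<theta>4 *\<^sub>R dv L w 0))\<^sup>2"
    unfolding u_def by (rule cmod_add_square)
  also have "\<dots> = 2 * \<theta>3\<^sup>2 * (cmod (w 0))\<^sup>2 + 2 * \<theta>4\<^sup>2 * (cmod (dv L w 0))\<^sup>2"
    by (simp add: power_mult_distrib)
  also have "\<dots> \<le> 2 * \<theta>3\<^sup>2 * (c * N) + 2 * \<theta>4\<^sup>2 * (c * N)"
    by (intro add_mono mult_left_mono 2) simp_all
  finally show "(cmod (u w))\<^sup>2 \<le> (2 * \<theta>3\<^sup>2 + 2 * \<theta>4\<^sup>2) * c * N" by (simp add: algebra_simps)
qed

text \<open>eta contains w'(0), whose trace estimate asks for w'' in L^2; here the full H^2 norm of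
  w enters.\<close>

lemma E_le_H: obtains C where "\<forall>z\<in>Hsp L. E z z \<le> C * H_form L z z"
proof -
  obtain CP where CP: "CP \<ge> 1" "\<And>x. x \<in> {0..L} \<Longrightarrow> P x \<le> CP" "\<And>x. x \<in> {0..L} \<Longrightarrow> \<bar>P1 x\<bar> \<le> CP"
    using P_bound by blast
  define c where "c = 4 / L + 6 * L"
  define cu where "cu = (2 * \<theta>3\<^sup>2 + 2 * \<theta>4\<^sup>2) * c"
  define C where "C = CP + 1 + P L + k * (- \<theta>3) * c + k * \<sigma> * (2 + 2 / b\<^sup>2 * cu)"
  have c: "c \<ge> 0" "cu \<ge> 0" using L by (auto simp: c_def cu_def)
  have kt: "0 \<le> k * (- \<theta>3)" using k(1) \<theta>3 by (intro mult_nonneg_nonneg) auto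
  have ks: "0 \<le> k * \<sigma>" using k(1) \<sigma>(1) by simp
  have "E z z \<le> C * H_form L z z" if zH: "z \<in> Hsp L" for z
  proof -
    obtain w v \<xi> \<psi> where z: "z = (w, v, \<xi>, \<psi>)" by (cases z)
    define N where "N = H_form L z z"
    note h = H_D[OF zH[unfolded z]] and p = H_parts[OF zH z, folded N_def c_def, folded cu_def]
    have "(cmod (\<psi> - u w /\<^sub>R b))\<^sup>2 \<le> 2 * (cmod \<psi>)\<^sup>2 + 2 / b\<^sup>2 * (cmod (u w))\<^sup>2"
      using cmod_diff_square[of \<psi> "u w /\<^sub>R b"] b
      by (simp add: power_mult_distrib power_inverse divide_inverse)
    also have "\<dots> \<le> 2 * N + 2 / b\<^sup>2 * (cu * N)"
      by (intro add_mono mult_left_mono p) auto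
    finally have 1: "(cmod (\<psi> - u w /\<^sub>R b))\<^sup>2 \<le> 2 * N + 2 / b\<^sup>2 * (cu * N)" .
    have 2: "ip L (\<lambda>x. P x *\<^sub>R dv L w x) (dv L w) \<le> CP * N"
      using ip_weight(2)[OF h(6) CP(2)] mult_left_mono[OF p(1), of CP] CP(1) by linarith
    have "E z z \<le> CP * N + N + P L * N + k * (- \<theta>3) * (c * N) + k * \<sigma> * (2 * N + 2 / b\<^sup>2 * (cu * N))"
      unfolding z E_self
      by (intro add_mono mult_left_mono 1 2 p kt ks less_imp_le[OF P_end(2)])
    also have "\<dots> = C * N" by (simp add: C_def algebra_simps)
    finally show ?thesis by (simp add: N_def)
  qed
  then show ?thesis using that by blast
qed

lemma A_self:
  assumes "z \<in> Dom" "z = (w, v, \<xi>, \<psi>)"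
  shows "E (A z) (A z) = ip L (\<lambda>x. P x *\<^sub>R dv L v x) (dv L v) + ip L (flux_d L P w) (flux_d L P w)
    + P L * (cmod (dv L w L))\<^sup>2 + k * (- \<theta>3) * (cmod (v 0))\<^sup>2 + k * \<sigma> * (cmod (u w - a *\<^sub>R v 0))\<^sup>2"
proof -
  note z = dom_D[OF assms(1)[unfolded assms(2)]]
  have "ip L (restr L (flux_d L P w)) (restr L (flux_d L P w)) = ip L (flux_d L P w) (flux_d L P w)"
    by (rule ip_cong) (simp_all add: restr_def)
  then show ?thesis
    using z(8,9) unfolding assms(2) Aop_def prod.case E_self by simp
qed

text \<open>Both bounds come from (P w')' = P' w' + P w''. The lower bound P \<ge> P0 is what allows
  w'' to be recovered from the flux and w'.\<close>

lemma flux_bounds: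
  assumes "z \<in> Dom" "z = (w, v, \<xi>, \<psi>)" and C: "\<And>x. x \<in> {0..L} \<Longrightarrow> P x \<le> C" "\<And>x. x \<in> {0..L} \<Longrightarrow> \<bar>P1 x\<bar> \<le> C"
  shows "ip L (flux_d L P w) (flux_d L P w) \<le> 2 * C\<^sup>2 * (ip L (dv L w) (dv L w) + ip L (wderiv 0 L (dv L w)) (wderiv 0 L (dv L w)))"
    "P0\<^sup>2 * ip L (wderiv 0 L (dv L w)) (wderiv 0 L (dv L w)) \<le> 2 * ip L (flux_d L P w) (flux_d L P w) + 2 * C\<^sup>2 * ip L (dv L w) (dv L w)"
proof -
  note z = dom_D[OF assms(1)[unfolded assms(2)]]
  let ?w1 = "dv L w" let ?w2 = "dv L (dv L w)" let ?q = "flux_d L P w"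
  note w1 = Sob_2_D[OF z(2) L]
  have i: "continuous_on {0..L} g \<Longrightarrow> (\<lambda>x. (cmod (g x))\<^sup>2) integrable_on {0..L}" for g :: "real \<Rightarrow> complex"
    by (intro integrable_continuous_real continuous_intros)
  have sq: "(cmod (r *\<^sub>R x))\<^sup>2 \<le> C\<^sup>2 * (cmod x)\<^sup>2" if "\<bar>r\<bar> \<le> C" for r :: real and x :: complex
    using that by (auto simp: power_mult_distrib abs_le_square_iff[symmetric] intro!: mult_right_mono)
  have "ip L ?q ?q \<le> integral {0..L} (\<lambda>x. 2 * C\<^sup>2 * (cmod (?w1 x))\<^sup>2 + 2 * C\<^sup>2 * (cmod (?w2 x))\<^sup>2)"
    unfolding ip_self
  proof (rule integral_le)
    fix x assume x: "x \<in> {0..L}"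
    have "\<bar>P x\<bar> \<le> C" using C(1)[OF x] P_pos[OF x] by simp
    from sq[OF C(2)[OF x], of "?w1 x"] sq[OF this, of "?w2 x"]
    show "(cmod (?q x))\<^sup>2 \<le> 2 * C\<^sup>2 * (cmod (?w1 x))\<^sup>2 + 2 * C\<^sup>2 * (cmod (?w2 x))\<^sup>2"
      using cmod_add_square[of "P1 x *\<^sub>R ?w1 x" "P x *\<^sub>R ?w2 x"] z(5)[OF x] by simp
  qed (intro i z(6) integrable_add integrable_on_mult_right w1)+
  also have "\<dots> = 2 * C\<^sup>2 * ip L ?w1 ?w1 + 2 * C\<^sup>2 * ip L ?w2 ?w2"
    unfolding ip_self integral_mult_right[symmetric]
    by (rule Henstock_Kurzweil_Integration.integral_add) (intro integrable_on_mult_right i w1)+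
  finally show "ip L ?q ?q \<le> 2 * C\<^sup>2 * (ip L ?w1 ?w1 + ip L (wderiv 0 L ?w1) (wderiv 0 L ?w1))"
    by (simp add: ip_wderiv_dv[OF z(2) L] distrib_left)
  have "integral {0..L} (\<lambda>x. P0\<^sup>2 * (cmod (?w2 x))\<^sup>2) \<le> integral {0..L} (\<lambda>x. 2 * (cmod (?q x))\<^sup>2 + 2 * C\<^sup>2 * (cmod (?w1 x))\<^sup>2)"
  proof (rule integral_le)
    fix x assume x: "x \<in> {0..L}"
    have "P0\<^sup>2 * (cmod (?w2 x))\<^sup>2 \<le> (P x)\<^sup>2 * (cmod (?w2 x))\<^sup>2"
      using P_ge[OF x] P0 by (intro mult_right_mono power_mono) auto
    also have "\<dots> = (cmod (?q x - P1 x *\<^sub>R ?w1 x))\<^sup>2" by (simp add: z(5)[OF x] power_mult_distrib)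
    also have "\<dots> \<le> 2 * (cmod (?q x))\<^sup>2 + 2 * (cmod (P1 x *\<^sub>R ?w1 x))\<^sup>2" by (rule cmod_diff_square)
    also have "\<dots> \<le> 2 * (cmod (?q x))\<^sup>2 + 2 * C\<^sup>2 * (cmod (?w1 x))\<^sup>2"
      using sq[OF C(2)[OF x], of "?w1 x"] by simp
    finally show "P0\<^sup>2 * (cmod (?w2 x))\<^sup>2 \<le> 2 * (cmod (?q x))\<^sup>2 + 2 * C\<^sup>2 * (cmod (?w1 x))\<^sup>2" .
  qed (intro i z(6) integrable_add integrable_on_mult_right w1)+
  also have "\<dots> = 2 * ip L ?q ?q + 2 * C\<^sup>2 * ip L ?w1 ?w1"
    unfolding ip_self integral_mult_right[symmetric]
    by (rule Henstock_Kurzweil_Integration.integral_add) (intro integrable_on_mult_right i w1 z(6))+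
  finally show "P0\<^sup>2 * ip L (wderiv 0 L ?w1) (wderiv 0 L ?w1) \<le> 2 * ip L ?q ?q + 2 * C\<^sup>2 * ip L ?w1 ?w1"
    by (simp only: ip_wderiv_dv[OF z(2) L]) (simp add: ip_self)
qed

text \<open>E (A z) asks for v', (P w')' and the end values v(0), w'(L) and u w; all of these are
  just within reach of the state norm of z.\<close>

lemma EA_le_H: obtains C where "\<forall>z\<in>Dom. E (A z) (A z) \<le> C * H_form L z z"
proof -
  obtain CP where CP: "CP \<ge> 1" "\<And>x. x \<in> {0..L} \<Longrightarrow> P x \<le> CP" "\<And>x. x \<in> {0..L} \<Longrightarrow> \<bar>P1 x\<bar> \<le> CP"
    using P_bound by blast
  define c where "c = 4 / L + 6 * L"
  define cu where "cu = (2 * \<theta>3\<^sup>2 + 2 * \<theta>4\<^sup>2) * c"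
  define C where "C = CP + 4 * CP\<^sup>2 + P L * c + k * (- \<theta>3) + k * \<sigma> * (2 * cu + 2 * a\<^sup>2)"
  have c: "c \<ge> 0" "cu \<ge> 0" using L by (auto simp: c_def cu_def)
  have kt: "0 \<le> k * (- \<theta>3)" using k(1) \<theta>3 by (intro mult_nonneg_nonneg) auto
  have ks: "0 \<le> k * \<sigma>" using k(1) \<sigma>(1) by simp
  have "E (A z) (A z) \<le> C * H_form L z z" if zD: "z \<in> Dom" for z
  proof -
    obtain w v \<xi> \<psi> where z: "z = (w, v, \<xi>, \<psi>)" by (cases z)
    note d = dom_D[OF zD[unfolded z]]
    have zH: "z \<in> Hsp L" using d(1) z by simp
    define N where "N = H_form L z z"
    note h = H_D[OF zH[unfolded z]] and p = H_parts[OF zH z, folded N_def c_def, folded cu_def]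
    have "(cmod (u w - a *\<^sub>R v 0))\<^sup>2 \<le> 2 * (cmod (u w))\<^sup>2 + 2 * a\<^sup>2 * (cmod \<psi>)\<^sup>2"
      using cmod_diff_square[of "u w" "a *\<^sub>R v 0"] h(4) by (simp add: power_mult_distrib)
    also have "\<dots> \<le> 2 * (cu * N) + 2 * a\<^sup>2 * N"
      by (intro add_mono mult_left_mono p) auto
    finally have 1: "(cmod (u w - a *\<^sub>R v 0))\<^sup>2 \<le> 2 * (cu * N) + 2 * a\<^sup>2 * N" .
    have 2: "ip L (\<lambda>x. P x *\<^sub>R dv L v x) (dv L v) \<le> CP * N"
      using ip_weight(2)[OF Sob_2_D(4)[OF d(3) L] CP(2)] mult_left_mono[OF p(4), of CP] CP(1)
      unfolding ip_wderiv_dv[OF d(3) L] by linarith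
    have "ip L (flux_d L P w) (flux_d L P w) \<le> 2 * CP\<^sup>2 * (N + N)"
      by (rule order_trans[OF flux_bounds(1)[OF zD z CP(2) CP(3)] mult_left_mono[OF add_mono[OF p(1,2)]]]) simp_all
    then have 3: "ip L (flux_d L P w) (flux_d L P w) \<le> 4 * CP\<^sup>2 * N" by simp
    have 4: "(cmod (v 0))\<^sup>2 \<le> N" using p(6) h(4) by simp
    have "E (A z) (A z) \<le> CP * N + 4 * CP\<^sup>2 * N + P L * (c * N) + k * (- \<theta>3) * N + k * \<sigma> * (2 * (cu * N) + 2 * a\<^sup>2 * N)"
      unfolding A_self[OF zD z]
      by (intro add_mono mult_left_mono 1 2 3 4 p kt ks less_imp_le[OF P_end(2)])
    also have "\<dots> = C * N" by (simp add: C_def algebra_simps)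
    finally show ?thesis by (simp add: N_def)
  qed
  then show ?thesis using that by blast
qed

text \<open>E z supplies w', w(0), v and v(L), while E (A z) supplies v', (P w')' and v(0). Then w''
  follows from the flux and w', and w from w(0) and w'.\<close>

lemma H_le_EA: obtains C where "C \<ge> 0" "\<forall>z\<in>Dom. H_form L z z \<le> C * (E z z + E (A z) (A z))"
proof -
  obtain CP where CP: "CP \<ge> 1" "\<And>x. x \<in> {0..L} \<Longrightarrow> P x \<le> CP" "\<And>x. x \<in> {0..L} \<Longrightarrow> \<bar>P1 x\<bar> \<le> CP"
    using P_bound by blast
  define kt where "kt = k * (- \<theta>3)"
  have kt: "kt > 0" unfolding kt_def using k(1) \<theta>3 by (intro mult_pos_pos) auto
  have ks: "0 \<le> k * \<sigma>" using k(1) \<sigma>(1) by simp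
  define C where "C = (2 * L / kt + 2 * L\<^sup>2 / P0) + 1 / P0 + (2 / P0\<^sup>2 + 2 * CP\<^sup>2 / (P0\<^sup>2 * P0)) + 1 + 1 / P0 + 1 / P L + 1 / kt"
  have C: "C \<ge> 0" unfolding C_def using L kt P0 P_end(2) by (intro add_nonneg_nonneg) auto
  have "H_form L z z \<le> C * (E z z + E (A z) (A z))" if zD: "z \<in> Dom" for z
  proof -
    obtain w v \<xi> \<psi> where z: "z = (w, v, \<xi>, \<psi>)" by (cases z)
    note d = dom_D[OF zD[unfolded z]]
    have zH: "z \<in> Hsp L" using d(1) z by simp
    note h = H_D[OF zH[unfolded z]] and p = E_parts[OF zH z]
    define S where "S = E z z + E (A z) (A z)"
    have v1: "continuous_on {0..L} (dv L v)" by (rule Sob_2_D(4)[OF d(3) L])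
    have nn: "0 \<le> ip L (\<lambda>x. P x *\<^sub>R dv L v x) (dv L v)" "0 \<le> ip L (flux_d L P w) (flux_d L P w)"
      "0 \<le> P L * (cmod (dv L w L))\<^sup>2" "0 \<le> k * (- \<theta>3) * (cmod (v 0))\<^sup>2" "0 \<le> k * \<sigma> * (cmod (u w - a *\<^sub>R v 0))\<^sup>2"
      using order_trans[OF mult_nonneg_nonneg[OF less_imp_le[OF P0] ip_nonneg[OF v1]] ip_weight(1)[OF v1]] ip_nonneg[OF d(6)]
        mult_nonneg_nonneg[OF less_imp_le[OF P_end(2)] zero_le_power2]
        mult_nonneg_nonneg[OF less_imp_le[OF kt] zero_le_power2] mult_nonneg_nonneg[OF ks zero_le_power2]
      unfolding kt_def by (simp_all only:)
    have EA: "ip L (\<lambda>x. P x *\<^sub>R dv L v x) (dv L v) \<le> S" "ip L (flux_d L P w) (flux_d L P w) \<le> S" "kt * (cmod (v 0))\<^sup>2 \<le> S"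
      unfolding S_def A_self[OF zD z] kt_def using nn p(8) by linarith+
    have EE: "E z z \<le> S" unfolding S_def A_self[OF zD z] using nn by linarith
    have w1: "ip L (dv L w) (dv L w) \<le> 1 / P0 * S" using p(1) EE P0 by (simp add: field_simps)
    have w0: "(cmod (w 0))\<^sup>2 \<le> 1 / kt * S" using p(5) EE kt unfolding kt_def[symmetric] by (simp add: field_simps)
    have v0: "(cmod \<psi>)\<^sup>2 \<le> 1 / kt * S" using EA(3) kt h(4) by (simp add: field_simps)
    have vL: "(cmod \<xi>)\<^sup>2 \<le> 1 / P L * S" using p(4) EE P_end(2) by (simp add: field_simps)
    have vv: "ip L v v \<le> S" using p(3) EE by linarith
    have vd: "ip L (wderiv 0 L v) (wderiv 0 L v) \<le> 1 / P0 * S"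
      using ip_weight(1)[OF v1] EA(1) P0 unfolding ip_wderiv_dv[OF d(3) L] by (simp add: field_simps)
    have w2: "ip L (wderiv 0 L (dv L w)) (wderiv 0 L (dv L w)) \<le> (2 / P0\<^sup>2 + 2 * CP\<^sup>2 / (P0\<^sup>2 * P0)) * S"
    proof -
      have "P0\<^sup>2 * ip L (wderiv 0 L (dv L w)) (wderiv 0 L (dv L w)) \<le> 2 * ip L (flux_d L P w) (flux_d L P w) + 2 * CP\<^sup>2 * ip L (dv L w) (dv L w)"
        by (rule flux_bounds(2)[OF zD z CP(2,3)])
      also have "\<dots> \<le> 2 * S + 2 * CP\<^sup>2 * (1 / P0 * S)" by (intro add_mono mult_left_mono EA w1) simp_all
      finally show ?thesis using P0 by (simp add: field_simps)
    qed
    have ww: "ip L w w \<le> (2 * L / kt + 2 * L\<^sup>2 / P0) * S"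
    proof -
      have "ip L w w \<le> integral {0..L} (\<lambda>x. 2 * (1 / kt * S) + 2 * (L * (1 / P0 * S)))"
        unfolding ip_self
      proof (rule integral_le)
        fix x assume x: "x \<in> {0..L}"
        have "w x = w 0 + integral {0..x} (dv L w)" by (rule Sob_2_integral[OF h(1) L x])
        then have "(cmod (w x))\<^sup>2 \<le> 2 * (cmod (w 0))\<^sup>2 + 2 * (cmod (integral {0..x} (dv L w)))\<^sup>2"
          using cmod_add_square[of "w 0"] by simp
        also have "\<dots> \<le> 2 * (1 / kt * S) + 2 * (L * (1 / P0 * S))"
          by (intro add_mono mult_left_mono w0 order_trans[OF integral_norm_square_le[OF L2fun_continuous[OF h(6)] x]] w1)
             (use L in simp_all)
        finally show "(cmod (w x))\<^sup>2 \<le> 2 * (1 / kt * S) + 2 * (L * (1 / P0 * S))" .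
      qed (use h(5) in \<open>auto intro!: integrable_continuous_real continuous_intros\<close>)
      also have "\<dots> = (2 * L / kt + 2 * L\<^sup>2 / P0) * S" using L by (simp add: algebra_simps power2_eq_square)
      finally show ?thesis .
    qed
    have "H_form L z z \<le> (2 * L / kt + 2 * L\<^sup>2 / P0) * S + 1 / P0 * S + (2 / P0\<^sup>2 + 2 * CP\<^sup>2 / (P0\<^sup>2 * P0)) * S + S + 1 / P0 * S
       + 1 / P L * S + 1 / kt * S"
      unfolding z H_self by (intro add_mono ww w1 w2 vv vd vL v0)
    also have "\<dots> = C * S" unfolding C_def by (simp only: distrib_right mult_1_left)
    finally show ?thesis by (simp add: S_def)
  qed
  with C show ?thesis using that by blast
qed

text \<open>w'' and v' are approximated in L2 by functions with prescribed values at L and 0, respectively,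
  which makes the two boundary conditions of the domain hold exactly.\<close>
lemma Dom_dense:
  assumes zH: "z \<in> Hsp L" and e: "e > 0"
  shows "\<exists>y\<in>Dom. H_form L (z - y) (z - y) < e\<^sup>2"
proof -
  obtain w v \<xi> \<psi> where z: "z = (w, v, \<xi>, \<psi>)" by (cases z)
  note h = H_D[OF zH[unfolded z]]
  \<comment> \<open>The sum of the coefficients of \<epsilon>^2 in the final estimate; e^2 is (Q +
    1)^2 \<epsilon>^2, which exceeds Q \<epsilon>^2.\<close>
  define Q where "Q = 4 * L ^ 4 + 4 * L\<^sup>2 + 1 + L\<^sup>2 + 1 + L"
  have Q: "Q > 0" using L unfolding Q_def by (intro add_pos_pos) auto
  define \<epsilon> where "\<epsilon> = e / (Q + 1)"
  have \<epsilon>: "\<epsilon> > 0" using e Q by (simp add: \<epsilon>_def)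
  define w2 where "w2 = wderiv 0 L (dv L w)"
  define v1 where "v1 = wderiv 0 L v"
  have w2: "L2fun L w2" and v1: "L2fun L v1" using L2fun_wderiv h by (auto simp: w2_def v1_def)
  \<comment> \<open>The prescribed value is P' w' + P w'' = - w' at L solved for w''(L).\<close>
  obtain f where f: "f \<in> Sob 1 L" "f L = (- (1 + P1 L) / P L) *\<^sub>R dv L w L" "L2.nrm L (w2 - f) < \<epsilon>"
    using L2_dense_Sob1[OF w2 \<epsilon> L, of L] by blast
  have fL: "L2fun L f" and fc: "continuous_on {0..L} f" using f Sob_L2fun Sob_1_continuous by auto
  \<comment> \<open>The integration constant is fixed at L, not at 0, to preserve w'(L), on which
    the prescribed value of f depends.\<close>
  define c0 where "c0 = dv L w L - integral {0..L} f"
  define W1 where "W1 x = c0 + integral {0..x} f" for x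
  define W where "W = restr L (\<lambda>x. w 0 + integral {0..x} W1)"
  have W1: "W1 \<in> Sob 2 L"
    using Sob_indefinite[OF L f(1), of c0] by (simp add: W1_def[abs_def] numeral_2_eq_2)
  have W1c: "continuous_on {0..L} W1" by (rule Sob_2_D(3)[OF W1 L])
  have W: "W \<in> Sob 3 L"
    using Sob_indefinite[OF L W1, of "w 0"]
      Sob_cong[of L W "\<lambda>x. w 0 + integral {0..x} W1" 3] L
    by (simp add: W_def restr_def numeral_3_eq_3 numeral_2_eq_2)
  note W2 = Sob_3_D[OF W L]
  have dW: "dv L W x = W1 x" if "x \<in> {0..L}" for x
    by (rule dv_indefinite[OF L W1c _ that, of _ "w 0"]) (simp add: W_def restr_def)
  have ddW: "dv L (dv L W) x = f x" if "x \<in> {0..L}" for x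
    by (rule dv_indefinite[OF L fc _ that, of _ c0]) (simp add: dW W1_def)
  have WL: "W1 L = dv L w L" by (simp add: W1_def c0_def)
  \<comment> \<open>The condition at 0 solved for v'(0) by dividing by \<theta>2; W is already fixed
    and v(0) is kept.\<close>
  define g0 where "g0 = (1 / \<theta>2) *\<^sub>R (flux_d L P W 0 - \<theta>1 *\<^sub>R v 0 - \<theta>3 *\<^sub>R W 0 - \<theta>4 *\<^sub>R dv L W 0)"
  obtain g where g: "g \<in> Sob 1 L" "g 0 = g0" "L2.nrm L (v1 - g) < \<epsilon>"
    using L2_dense_Sob1[OF v1 \<epsilon> L, of 0] by blast
  have gL: "L2fun L g" and gc: "continuous_on {0..L} g" using g Sob_L2fun Sob_1_continuous by auto
  define V where "V = restr L (\<lambda>x. v 0 + integral {0..x} g)"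
  have V: "V \<in> Sob 2 L"
    using Sob_indefinite[OF L g(1), of "v 0"]
      Sob_cong[of L V "\<lambda>x. v 0 + integral {0..x} g" 2] L
    by (simp add: V_def restr_def numeral_2_eq_2)
  have dV: "dv L V x = g x" if "x \<in> {0..L}" for x
    by (rule dv_indefinite[OF L gc _ that, of _ "v 0"]) (simp add: V_def restr_def)
  have V0: "V 0 = v 0" and W0: "W 0 = w 0" using L by (auto simp: V_def W_def restr_def)
  define y where "y = (W, V, V L, V 0)"
  have yH: "y \<in> Hsp L"
    using W2(1) Sob_2_D(1)[OF V L] by (simp add: y_def Hsp_iff) (simp add: W_def V_def restr_def)
  have "flux_d L P W L = - dv L W L"
  proof -
    have LL: "L \<in> {0..L}" using L by simp
    have "P L * (- (1 + P1 L) / P L) = - (1 + P1 L)" using P_end(2) by simp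
    then show ?thesis
      unfolding flux(1)[OF W LL] dW[OF LL] ddW[OF LL] WL f(2) scaleR_scaleR by (simp add: scaleR_left_diff_distrib)
  qed
  moreover have "flux_d L P W 0 = Fbd L \<theta>1 \<theta>2 \<theta>3 \<theta>4 W V"
  proof -
    have "\<theta>2 > 0" using \<theta>2 \<theta>4 b by simp
    then have "\<theta>2 *\<^sub>R g0 = flux_d L P W 0 - \<theta>1 *\<^sub>R v 0 - \<theta>3 *\<^sub>R W 0 - \<theta>4 *\<^sub>R dv L W 0"
      by (simp add: g0_def)
    then show ?thesis using L by (simp add: Fbd_def dV g(2) V0 scaleR_conv_of_real[symmetric])
  qed
  ultimately have yD: "y \<in> Dom"
    using yH W V by (simp add: DomA_def y_def)
  let ?w = "w - W" let ?v = "v - V"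
  have zy: "z - y = (?w, ?v, \<xi> - V L, \<psi> - V 0)" by (simp add: z y_def)
  have zyH: "z - y \<in> Hsp L" using zH yH Hsp_subspace by (intro subspace_diff)
  note d = H_D[OF zyH[unfolded zy]]
  have small: "ip L u u \<le> \<epsilon>\<^sup>2" if "L2fun L u" "L2.nrm L u < \<epsilon>" for u
    using that L2.nrm_sq[of u L] power_mono[of "L2.nrm L u" \<epsilon> 2] by simp
  have sf: "ip L (w2 - f) (w2 - f) \<le> \<epsilon>\<^sup>2" "ip L (v1 - g) (v1 - g) \<le> \<epsilon>\<^sup>2"
    using small L2fun_diff w2 v1 fL gL f(3) g(3) by auto
  have sfL: "L * ip L (w2 - f) (w2 - f) \<le> L * \<epsilon>\<^sup>2" "L * ip L (v1 - g) (v1 - g) \<le> L * \<epsilon>\<^sup>2"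
    by (intro mult_left_mono sf less_imp_le[OF L])+
  have rep_w1: "dv L w x = dv L w 0 + integral {0..x} w2" if "x \<in> {0..L}" for x
    using wderiv_integral[of "dv L w" 0 L x] h(8) that by (simp add: w2_def)
  have rep_v: "v x = v 0 + integral {0..x} v1" if "x \<in> {0..L}" for x
    using wderiv_integral[of v 0 L x] h(2) that by (simp add: v1_def)
  have dw: "dv L ?w x = dv L w x - W1 x" if "x \<in> {0..L}" for x
    using dv_add[OF h(1) subspace_neg[OF Sob_subspace W2(1)] that L] dv_scaleR[OF W2(1) that L, of "-1"] dW[OF that]
    by simp
  \<comment> \<open>The error of the slope at 0. The slopes agree at L, so it is minus the integral
    of w2 - f over the whole interval and hence small.\<close>
  define D where "D = dv L w 0 - c0"
  have rep: "dv L ?w x = D + integral {0..x} (w2 - f)" if "x \<in> {0..L}" for x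
    unfolding dw[OF that] rep_w1[OF that] W1_def integral_diff_fun[OF w2 fL that] D_def by simp
  have "D = - integral {0..L} (w2 - f)"
    using rep[of L] dw[of L] WL L by (simp add: eq_neg_iff_add_eq_0)
  then have "cmod D = cmod (integral {0..L} (w2 - f))" by simp
  then have D: "(cmod D)\<^sup>2 \<le> L * \<epsilon>\<^sup>2"
    using order_trans[OF integral_norm_square_le[OF L2fun_diff[OF w2 fL], of L] sfL(1)] L by simp
  have dw_le: "(cmod (dv L ?w x))\<^sup>2 \<le> 4 * (L * \<epsilon>\<^sup>2)" if "x \<in> {0..L}" for x
    using cmod_add_square[of D "integral {0..x} (w2 - f)"] D
      integral_norm_square_le[OF L2fun_diff[OF w2 fL] that] sfL(1)
    unfolding rep[OF that] by linarith
  have n1: "ip L (dv L ?w) (dv L ?w) \<le> L * (4 * (L * \<epsilon>\<^sup>2))"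
    by (rule ip_self_le[OF L Sob_L2fun[OF d(8)] dw_le])
  have n2: "ip L (wderiv 0 L (dv L ?w)) (wderiv 0 L (dv L ?w)) \<le> \<epsilon>\<^sup>2"
  proof -
    have *: "dv L ?w x = dv L ?w 0 + integral {0..x} (w2 - f)" if "x \<in> {0..L}" for x
      using rep[OF that] rep[of 0] L by simp
    note i = ip_wderiv[OF d(8) L2fun_diff[OF w2 fL] *]
    show ?thesis using sf(1) by (simp only: i)
  qed
  have n0: "ip L ?w ?w \<le> L * (L * (L * (4 * (L * \<epsilon>\<^sup>2))))"
  proof (rule ip_self_le[OF L Sob_L2fun[OF d(1)]])
    fix x assume x: "x \<in> {0..L}"
    have "?w x = integral {0..x} (dv L ?w)" using Sob_2_integral[OF d(1) L x] W0 by simp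
    then have "(cmod (?w x))\<^sup>2 \<le> L * ip L (dv L ?w) (dv L ?w)"
      using integral_norm_square_le[OF L2fun_continuous[OF d(6)] x] by simp
    also have "\<dots> \<le> L * (L * (4 * (L * \<epsilon>\<^sup>2)))" using n1 L by (intro mult_left_mono) auto
    finally show "(cmod (?w x))\<^sup>2 \<le> L * (L * (4 * (L * \<epsilon>\<^sup>2)))" .
  qed
  have rv: "?v x = integral {0..x} (v1 - g)" if "x \<in> {0..L}" for x
    using that integral_diff_fun[OF v1 gL that] rep_v[OF that] by (simp add: V_def restr_def)
  have v_le: "(cmod (?v x))\<^sup>2 \<le> L * \<epsilon>\<^sup>2" if "x \<in> {0..L}" for x
    unfolding rv[OF that] by (rule order_trans[OF integral_norm_square_le[OF L2fun_diff[OF v1 gL] that] sfL(2)])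
  have n3: "ip L ?v ?v \<le> L * (L * \<epsilon>\<^sup>2)"
    by (rule ip_self_le[OF L Sob_L2fun[OF d(2)] v_le])
  have n4: "ip L (wderiv 0 L ?v) (wderiv 0 L ?v) \<le> \<epsilon>\<^sup>2"
  proof -
    have *: "?v x = ?v 0 + integral {0..x} (v1 - g)" if "x \<in> {0..L}" for x
      using rv[OF that] rv[of 0] L by simp
    note i = ip_wderiv[OF d(2) L2fun_diff[OF v1 gL] *]
    show ?thesis using sf(2) by (simp only: i)
  qed
  have n5: "(cmod (\<xi> - V L))\<^sup>2 \<le> L * \<epsilon>\<^sup>2" using v_le[of L] L d(3) by simp
  have n6: "(cmod (\<psi> - V 0))\<^sup>2 \<le> 0" using h(4) V0 by simp
  have "H_form L (z - y) (z - y) \<le> L * (L * (L * (4 * (L * \<epsilon>\<^sup>2)))) + L * (4 * (L * \<epsilon>\<^sup>2)) + \<epsilon>\<^sup>2 + L * (L * \<epsilon>\<^sup>2) + \<epsilon>\<^sup>2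
      + L * \<epsilon>\<^sup>2 + 0"
    unfolding zy H_self by (intro add_mono n0 n1 n2 n3 n4 n5 n6)
  also have "\<dots> = Q * \<epsilon>\<^sup>2" by (simp add: Q_def algebra_simps power2_eq_square power4_eq_xxxx)
  also have "\<dots> < (Q + 1) * ((Q + 1) * \<epsilon>\<^sup>2)"
  proof -
    have "(Q + 1) * \<epsilon>\<^sup>2 \<le> (Q + 1) * ((Q + 1) * \<epsilon>\<^sup>2)"
      using Q \<epsilon> mult_right_mono[of 1 "Q + 1" "\<epsilon>\<^sup>2"] by (intro mult_left_mono) auto
    moreover have "Q * \<epsilon>\<^sup>2 < (Q + 1) * \<epsilon>\<^sup>2" using \<epsilon> by (intro mult_strict_right_mono) auto
    ultimately show ?thesis by linarith
  qed
  also have "\<dots> = e\<^sup>2" using Q by (simp add: \<epsilon>_def power2_eq_square)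
  finally show ?thesis using yD by blast
qed

section \<open>Application of the abstract decay theorem\<close>

theorem stable:
  assumes gen: "generated_by (Hsp L) (Hnorm L) T Dom A" and z: "z \<in> Hsp L"
  shows "((\<lambda>t. Hnorm L (T t z)) \<longlongrightarrow> 0) at_top"
proof -
  interpret S: strong_semigroup "Hsp L" "H_form L" T
    using gen by (intro C0_semigroup_strong L) (simp add: generated_by_def)
  have nrm: "Hnorm L x = S.nrm x" if "x \<in> Hsp L" for x
    using Hnorm_eq[OF that L] by (simp add: S.nrm_def)
  obtain n K \<beta> \<kappa> C where d: "\<kappa> > 0" "C \<ge> 0"
    "\<forall>z\<in>Hsp L. E z z \<le> n * E z z + R K \<beta> z z"
    "\<forall>z\<in>Hsp L. n * E z z + R K \<beta> z z \<le> C * E z z"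
    "\<forall>z\<in>Dom. n * E z (A z) + R K \<beta> z (A z) \<le> - \<kappa> * (n * E z z + R K \<beta> z z)"
    by (rule dissipation)
  obtain c1 where c1: "\<forall>z\<in>Hsp L. E z z \<le> c1 * H_form L z z" by (rule E_le_H)
  obtain c2 where c2: "\<forall>z\<in>Dom. E (A z) (A z) \<le> c2 * H_form L z z" by (rule EA_le_H)
  obtain c3 where c3: "c3 \<ge> 0" "\<forall>z\<in>Dom. H_form L z z \<le> c3 * (E z z + E (A z) (A z))" by (rule H_le_EA)
  define W where "W z z' = n * E z z' + R K \<beta> z z'" for z z'
  have DS: "Dom \<subseteq> Hsp L" and AS: "\<And>z. z \<in> Dom \<Longrightarrow> A z \<in> Hsp L"
    using gen by (auto simp: generated_by_def)
  \<comment> \<open>The two quotients are compared for h > 0 only: there T h x lies in H, the set on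
    which \<open>Hnorm\<close> is known to be the seminorm.\<close>
  have quot: "((\<lambda>h. S.nrm ((1 / h) *\<^sub>R (T h x - x) - y)) \<longlongrightarrow> 0) (at_right 0) \<longleftrightarrow>
      ((\<lambda>h. Hnorm L (sdiff (sscale (complex_of_real (1 / h)) (sdiff (T h x) x)) y)) \<longlongrightarrow> 0) (at_right 0)"
    if "x \<in> Hsp L" "y \<in> Hsp L" for x y
  proof (rule filterlim_cong[OF refl refl])
    show "\<forall>\<^sub>F h in at_right 0. S.nrm ((1 / h) *\<^sub>R (T h x - x) - y) =
        Hnorm L (sdiff (sscale (complex_of_real (1 / h)) (sdiff (T h x) x)) y)"
      using eventually_at_right_less[of 0]
    proof eventually_elim
      case (elim h)
      then have "(1 / h) *\<^sub>R (T h x - x) - y \<in> Hsp L"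
        using S.T_mem that by (intro S.mem) auto
      then show ?case unfolding sdiff_eq sscale_eq by (rule nrm[symmetric])
    qed
  qed
  interpret S: damped_semigroup "Hsp L" "H_form L" T W "C * c1" Dom A \<kappa> c3 "C * c2"
  proof
    show "subspace (Hsp L)" by (rule Hsp_subspace)
    fix x y z :: st and c e :: real
    show "x \<in> Hsp L \<Longrightarrow> y \<in> Hsp L \<Longrightarrow> W x y = W y x"
      unfolding W_def forms_sym(1)[of x y] forms_sym(2)[of K \<beta> x y] by (rule refl)
    show "x \<in> Hsp L \<Longrightarrow> y \<in> Hsp L \<Longrightarrow> z \<in> Hsp L \<Longrightarrow> W (x + y) z = W x z + W y z"
      by (simp add: W_def forms_add distrib_left)
    show "x \<in> Hsp L \<Longrightarrow> z \<in> Hsp L \<Longrightarrow> W (c *\<^sub>R x) z = c * W x z"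
      by (simp add: W_def forms_scaleR distrib_left)
    have E0: "0 \<le> E x x" if "x \<in> Hsp L" for x
      using E_parts(8)[OF that] by (cases x) auto
    show "x \<in> Hsp L \<Longrightarrow> 0 \<le> W x x"
      using bspec[OF d(3)] E0 unfolding W_def by (meson order_trans)
    show "W x x \<le> C * c1 * H_form L x x" if "x \<in> Hsp L"
      using bspec[OF d(4), OF that] mult_left_mono[OF bspec[OF c1, OF that] d(2)] by (simp add: W_def mult.assoc)
    show "Dom \<subseteq> Hsp L" by (rule DS)
    show "z \<in> Dom \<Longrightarrow> A z \<in> Hsp L" by (rule AS)
    show "((\<lambda>h. S.nrm ((1 / h) *\<^sub>R (T h z - z) - A z)) \<longlongrightarrow> 0) (at_right 0)" if "z \<in> Dom"
      unfolding quot[OF subsetD[OF DS that] AS[OF that]] using gen that unfolding generated_by_def by blast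
    show "z \<in> Dom" if "z \<in> Hsp L" "y \<in> Hsp L" "((\<lambda>h. S.nrm ((1 / h) *\<^sub>R (T h z - z) - y)) \<longlongrightarrow> 0) (at_right 0)"
      using gen that(1,2) that(3)[unfolded quot[OF that(1,2)]] unfolding generated_by_def by blast
    show "\<exists>y\<in>Dom. S.nrm (z - y) < e" if "z \<in> Hsp L" "e > 0"
    proof -
      obtain y where y: "y \<in> Dom" "H_form L (z - y) (z - y) < e\<^sup>2" using Dom_dense[OF \<open>z \<in> Hsp L\<close> \<open>e > 0\<close>] by blast
      then have "S.nrm (z - y) < e"
        using \<open>e > 0\<close> unfolding S.nrm_def by (simp add: real_less_lsqrt)
      with y show ?thesis by blast
    qed
    show "\<kappa> > 0" by (rule d(1))
    assume zD: "z \<in> Dom"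
    then have zH: "z \<in> Hsp L" and AH: "A z \<in> Hsp L" using DS AS by auto
    show "W z (A z) \<le> - \<kappa> * W z z" using bspec[OF d(5), OF zD] by (simp add: W_def)
    \<comment> \<open>The graph estimate is known for E; as W dominates E at z and at A z, it
      carries over to W.\<close>
    have "E z z + E (A z) (A z) \<le> W z z + W (A z) (A z)"
      unfolding W_def using bspec[OF d(3), OF zH] bspec[OF d(3), OF AH] by linarith
    with c3(1) have "c3 * (E z z + E (A z) (A z)) \<le> c3 * (W z z + W (A z) (A z))" by (rule mult_left_mono[rotated])
    with bspec[OF c3(2), OF zD] show "H_form L z z \<le> c3 * (W z z + W (A z) (A z))" by linarith
    show "W (A z) (A z) \<le> C * c2 * H_form L z z"
      using bspec[OF d(4), OF AH] mult_left_mono[OF bspec[OF c2, OF zD] d(2)] by (simp add: W_def mult.assoc)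
  qed
  have "((\<lambda>t. S.nrm (T t z)) \<longlongrightarrow> 0) at_top" by (rule S.stable[OF z])
  then show ?thesis
  proof (rule Lim_transform_eventually)
    show "\<forall>\<^sub>F t in at_top. S.nrm (T t z) = Hnorm L (T t z)"
      using eventually_ge_at_top[of 0] by eventually_elim (use S.T_mem[OF _ z] nrm in simp)
  qed
qed

end

theorem theorem3p3:
  fixes L :: real and P :: "real \<Rightarrow> real" and P0 a b \<theta>1 \<theta>2 \<theta>3 \<theta>4 :: real
    and T :: "real \<Rightarrow> st \<Rightarrow> st"
  assumes "L > 0"
    and "(\<lambda>x. complex_of_real (P x)) \<in> Sob 2 L"
    and "P0 > 0" and "\<forall>x\<in>{0..L}. P x \<ge> P0"
    and "a > 0" and "b > 0" and "(a + b - 1)\<^sup>2 < 4 * a * b"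
    and "\<theta>1 = \<theta>3 / b - a" and "\<theta>2 = \<theta>4 / b"
    and "\<theta>1 < 0" and "\<theta>3 < 0" and "\<theta>2 > 0" and "\<theta>4 > 0"
    and "generated_by (Hsp L) (Hnorm L) T (DomA L P \<theta>1 \<theta>2 \<theta>3 \<theta>4) (Aop L P \<theta>1 \<theta>2 \<theta>3 \<theta>4)"
  shows "\<forall>z0\<in>Hsp L. ((\<lambda>t. Hnorm L (T t z0)) \<longlongrightarrow> 0) at_top"
proof -
  interpret crane L P P0 a b \<theta>1 \<theta>2 \<theta>3 \<theta>4
    by unfold_locales (use assms in auto)
  show ?thesis using stable assms by blast
qed

end
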